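(* As meromorphic functions in $(x,z)\in\mathbb{C}\times\mathbb{C}$, $$\Phi(-x,z)=\left(\frac{c(x,z)-c^d(z,x)}{c^d(z,-x)}\right)\Phi(x,z)+\frac{c(x,-z)}{c^d(z,-x)}\Phi(x,-z).$$
   Context: Fix $\tau\in\sqrt{-1}\,\mathbb{R}_{>0}$, put $q^x:=e^{2\pi\sqrt{-1}\tau x}$ for $x\in\mathbb{C}$, so $0<q=e^{2\pi\sqrt{-1}\tau}<1$. Fix a step-size $s\in\mathbb{Q}_{>0}$ and real Hecke parameters $\kappa,\lambda,\upsilon,\varsigma$. Askey--Wilson parameters: $a_s=q^{\kappa+\lambda}$, $b_s=-q^{\kappa-\lambda}$, $c_s=q^{\frac{s}{2}+\upsilon+\varsigma}$, $d_s=-q^{\frac{s}{2}+\upsilon-\varsigma}$. Dual Askey--Wilson parameters ($\lambda$ and $\upsilon$ interchanged): $\widetilde a_s=q^{\kappa+\upsilon}$, $\widetilde b_s=-q^{\kappa-\upsilon}$, $\widetilde c_s=q^{\frac{s}{2}+\lambda+\varsigma}$, $\widetilde d_s=-q^{\frac{s}{2}+\lambda-\varsigma}$. $q$-shifted factorials: $(a_1,\ldots,a_m;p)_j=\prod_{r=1}^m\prod_{i=0}^{j-1}(1-a_rp^i)$ for $j\in\mathbb{Z}_{\geq 0}\cup\{\infty\}$. Theta functions: $\theta(u;p)=(u,p/u;p)_\infty$, $\theta(u_1,\ldots,u_r;p)=\prod_{i=1}^r\theta(u_i;p)$. $W(x,z)=q^{(\kappa+\lambda+x)(\kappa+\upsilon+z)/s}$,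 $\ \mathrm{St}(x)=\bigl(q^{s+x}/a_s,q^{s+x}/b_s,q^{s+x}/c_s,q^{s+x}/d_s;q^s\bigr)_\infty$, $\ \mathrm{St}^d(z)=\bigl(q^{s+z}/\widetilde a_s,q^{s+z}/\widetilde b_s,q^{s+z}/\widetilde c_s,q^{s+z}/\widetilde d_s;q^s\bigr)_\infty$. Very-well-poised series in base $p$ ($0<p<1$): ${}_8W_7(\alpha_0;\alpha_1,\ldots,\alpha_5;p,u)=\sum_{r=0}^\infty\frac{1-\alpha_0p^{2r}}{1-\alpha_0}u^r\prod_{j=0}^5\frac{(\alpha_j;p)_r}{(p\alpha_0/\alpha_j;p)_r}$ for $|u|<1$. $\Psi(x,z)$ is the holomorphic function on $\mathbb{C}\times\mathbb{C}$ which for $|d_sq^x|<1$ is given by $$\Psi(x,z)=\frac{\Bigl(\frac{q^{s+x+z}a_s}{\widetilde{a}_s},\frac{q^{s+x+z}b_s}{\widetilde{a}_s},\frac{q^{s+x+z}c_s}{\widetilde{a}_s},\frac{q^{s+x+z}\widetilde{a}_s}{d_s},q^{s+2z},d_sq^x;q^s\Bigr)_{\infty}}{\Bigl(\frac{q^{2s+x+2z}}{d_s};q^s\Bigr)_{\infty}}\;{}_8W_7\Bigl(\frac{q^{s+x+2z}}{d_s};\frac{q^{s+z}}{\widetilde{a}_s},\frac{q^{s+z}}{\widetilde{d}_s},\widetilde{b}_sq^z,\widetilde{c}_sq^z,\frac{q^{s+x}}{d_s};q^s,d_sq^x\Bigr).$$ The asymptotically free eigenfunction is the meromorphic function $\Phi(x,z)=\frac{W(x,z)}{\mathrm{St}(x)\mathrm{St}^d(z)}\Psi(x,z)$.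 The normalized $c$-function is $$c(x,z)=c(x,z;\kappa,\lambda,\upsilon,\varsigma;q,s)=\frac{\theta\bigl(\widetilde a_sq^{-z},\widetilde b_sq^{-z},\widetilde c_sq^{-z},\frac{d_sq^{x-z}}{\widetilde a_s};q^s\bigr)}{W(x,z)\,\theta\bigl(q^{-2z},d_sq^x;q^s\bigr)},$$ and $c^d(x,z)=c(x,z;\kappa,\upsilon,\lambda,\varsigma;q,s)$ is the $c$-function with $\lambda$ and $\upsilon$ interchanged (so all Askey--Wilson parameters and their duals are interchanged). *)

theory Defs
  imports "HOL-Analysis.Analysis"
begin

text \<open>Complex differentiability at every point of an open set: the Frechet derivative
  exists and is complex linear.\<close>

definition holomorphic2_on :: "(complex \<times> complex \<Rightarrow> complex) \<Rightarrow> (complex \<times> complex) set \<Rightarrow> bool"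
  where "holomorphic2_on f S \<longleftrightarrow>
    (\<forall>w\<in>S. \<exists>a b. (f has_derivative (\<lambda>h. a * fst h + b * snd h)) (at w))"

text \<open>A meromorphic function is represented by a total function; its values on the zero set of a
  suitable local denominator \<open>h\<close> are irrelevant. The condition \<open>U \<subseteq> closure \<dots>\<close> says that
  \<open>h\<close> vanishes identically on no nonempty open subset of \<open>U\<close>.\<close>

definition meromorphic2 :: "(complex \<times> complex \<Rightarrow> complex) \<Rightarrow> bool"
  where "meromorphic2 f \<longleftrightarrow>
    (\<forall>w. \<exists>U g h. open U \<and> w \<in> U \<and> holomorphic2_on g U \<and> holomorphic2_on h U \<and>
       U \<subseteq> closure {v \<in> U. h v \<noteq> 0} \<and> (\<forall>v\<in>U. h v \<noteq> 0 \<longrightarrow> f v = g v / h v))"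

definition meromorphic2_eq ::
    "(complex \<times> complex \<Rightarrow> complex) \<Rightarrow> (complex \<times> complex \<Rightarrow> complex) \<Rightarrow> bool"
  where "meromorphic2_eq f g \<longleftrightarrow>
    meromorphic2 f \<and> meromorphic2 g \<and>
    (\<exists>D. open D \<and> closure D = UNIV \<and> (\<forall>w\<in>D. f w = g w))"

definition qpoch :: "complex \<Rightarrow> complex \<Rightarrow> nat \<Rightarrow> complex"
  where "qpoch a p j = (\<Prod>i<j. 1 - a * p ^ i)"

definition qpoch_inf :: "complex list \<Rightarrow> complex \<Rightarrow> complex"
  where "qpoch_inf as p = (\<Prod>a\<leftarrow>as. \<Prod>i. 1 - a * p ^ i)"

definition theta :: "complex list \<Rightarrow> complex \<Rightarrow> complex"
  where "theta us p = (\<Prod>u\<leftarrow>us. qpoch_inf [u, p / u] p)"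

text \<open>\<open>W87 \<alpha>\<^sub>0 [\<alpha>\<^sub>1, \<dots>, \<alpha>\<^sub>5] p u\<close>.\<close>

definition W87 :: "complex \<Rightarrow> complex list \<Rightarrow> complex \<Rightarrow> complex \<Rightarrow> complex"
  where "W87 \<alpha>0 \<alpha>s p u =
    (\<Sum>r. (1 - \<alpha>0 * p ^ (2 * r)) / (1 - \<alpha>0) * u ^ r *
         (\<Prod>\<alpha>\<leftarrow>\<alpha>0 # \<alpha>s. qpoch \<alpha> p r / qpoch (p * \<alpha>0 / \<alpha>) p r))"

text \<open>No term of the series has a vanishing denominator.\<close>

definition W87_defined :: "complex \<Rightarrow> complex list \<Rightarrow> complex \<Rightarrow> bool"
  where "W87_defined \<alpha>0 \<alpha>s p \<longleftrightarrow>
    \<alpha>0 \<noteq> 1 \<and> (\<forall>\<alpha>\<in>set (\<alpha>0 # \<alpha>s). \<alpha> \<noteq> 0 \<and> (\<forall>r. qpoch (p * \<alpha>0 / \<alpha>) p r \<noteq> 0))"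

text \<open>Throughout, the parameters are listed in the order \<open>\<tau> s \<kappa> \<lambda> \<upsilon> \<sigma>\<close>, with \<open>lam\<close> for
  \<open>\<lambda>\<close> and \<open>\<sigma>\<close> for final sigma, neither of which is available as a variable name. Dual objects are obtained by interchanging \<open>lam\<close> and
  \<open>\<upsilon>\<close>. All theta functions and infinite products have base \<open>qpow \<tau> s\<close>.\<close>

definition qpow :: "complex \<Rightarrow> complex \<Rightarrow> complex"
  where "qpow \<tau> x = exp (2 * of_real pi * \<i> * \<tau> * x)"

definition AW_a :: "complex \<Rightarrow> real \<Rightarrow> real \<Rightarrow> real \<Rightarrow> real \<Rightarrow> real \<Rightarrow> complex"
  where "AW_a \<tau> s \<kappa> lam \<upsilon> \<sigma> = qpow \<tau> (of_real (\<kappa> + lam))"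

definition AW_b :: "complex \<Rightarrow> real \<Rightarrow> real \<Rightarrow> real \<Rightarrow> real \<Rightarrow> real \<Rightarrow> complex"
  where "AW_b \<tau> s \<kappa> lam \<upsilon> \<sigma> = - qpow \<tau> (of_real (\<kappa> - lam))"

definition AW_c :: "complex \<Rightarrow> real \<Rightarrow> real \<Rightarrow> real \<Rightarrow> real \<Rightarrow> real \<Rightarrow> complex"
  where "AW_c \<tau> s \<kappa> lam \<upsilon> \<sigma> = qpow \<tau> (of_real (s / 2 + \<upsilon> + \<sigma>))"

definition AW_d :: "complex \<Rightarrow> real \<Rightarrow> real \<Rightarrow> real \<Rightarrow> real \<Rightarrow> real \<Rightarrow> complex"
  where "AW_d \<tau> s \<kappa> lam \<upsilon> \<sigma> = - qpow \<tau> (of_real (s / 2 + \<upsilon> - \<sigma>))"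

definition W_fun ::
    "complex \<Rightarrow> real \<Rightarrow> real \<Rightarrow> real \<Rightarrow> real \<Rightarrow> real \<Rightarrow> complex \<Rightarrow> complex \<Rightarrow> complex"
  where "W_fun \<tau> s \<kappa> lam \<upsilon> \<sigma> x z =
    qpow \<tau> ((of_real (\<kappa> + lam) + x) * (of_real (\<kappa> + \<upsilon>) + z) / of_real s)"

definition St :: "complex \<Rightarrow> real \<Rightarrow> real \<Rightarrow> real \<Rightarrow> real \<Rightarrow> real \<Rightarrow> complex \<Rightarrow> complex"
  where "St \<tau> s \<kappa> lam \<upsilon> \<sigma> x =
    qpoch_inf
      [qpow \<tau> (of_real s + x) / AW_a \<tau> s \<kappa> lam \<upsilon> \<sigma>, qpow \<tau> (of_real s + x) / AW_b \<tau> s \<kappa> lam \<upsilon> \<sigma>,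
       qpow \<tau> (of_real s + x) / AW_c \<tau> s \<kappa> lam \<upsilon> \<sigma>, qpow \<tau> (of_real s + x) / AW_d \<tau> s \<kappa> lam \<upsilon> \<sigma>]
      (qpow \<tau> (of_real s))"

definition St_dual :: "complex \<Rightarrow> real \<Rightarrow> real \<Rightarrow> real \<Rightarrow> real \<Rightarrow> real \<Rightarrow> complex \<Rightarrow> complex"
  where "St_dual \<tau> s \<kappa> lam \<upsilon> \<sigma> z = St \<tau> s \<kappa> \<upsilon> lam \<sigma> z"

text \<open>\<open>Psi\<close> is the holomorphic function on the complex plane squared given, for
  \<open>|d q\<^sup>x| < 1\<close>, by an explicit formula. That formula has removable singularities, where
  the division convention \<open>x / 0 = 0\<close> would give it a wrong value; it is therefore
  imposed at the points where no denominator vanishes. These are dense in the nonempty open set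
  \<open>|d q\<^sup>x| < 1\<close>, so they determine \<open>Psi\<close> uniquely.\<close>

definition is_Psi ::
    "complex \<Rightarrow> real \<Rightarrow> real \<Rightarrow> real \<Rightarrow> real \<Rightarrow> real \<Rightarrow> (complex \<Rightarrow> complex \<Rightarrow> complex) \<Rightarrow> bool"
  where "is_Psi \<tau> s \<kappa> lam \<upsilon> \<sigma> Psi \<longleftrightarrow>
    holomorphic2_on (\<lambda>(x, z). Psi x z) UNIV \<and>
    (\<forall>x z.
      let q = qpow \<tau>; S = complex_of_real s; p = q S;
          a = AW_a \<tau> s \<kappa> lam \<upsilon> \<sigma>; b = AW_b \<tau> s \<kappa> lam \<upsilon> \<sigma>;
          c = AW_c \<tau> s \<kappa> lam \<upsilon> \<sigma>; d = AW_d \<tau> s \<kappa> lam \<upsilon> \<sigma>;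
          a' = AW_a \<tau> s \<kappa> \<upsilon> lam \<sigma>; b' = AW_b \<tau> s \<kappa> \<upsilon> lam \<sigma>;
          c' = AW_c \<tau> s \<kappa> \<upsilon> lam \<sigma>; d' = AW_d \<tau> s \<kappa> \<upsilon> lam \<sigma>;
          \<alpha>0 = q (S + x + 2 * z) / d;
          \<alpha>s = [q (S + z) / a', q (S + z) / d', b' * q z, c' * q z, q (S + x) / d]
      in norm (d * q x) < 1 \<longrightarrow>
         qpoch_inf [q (2 * S + x + 2 * z) / d] p \<noteq> 0 \<longrightarrow>
         W87_defined \<alpha>0 \<alpha>s p \<longrightarrow>
         Psi x z =
           qpoch_inf
             [q (S + x + z) * a / a', q (S + x + z) * b / a', q (S + x + z) * c / a',
              q (S + x + z) * a' / d, q (S + 2 * z), d * q x] p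
           / qpoch_inf [q (2 * S + x + 2 * z) / d] p
           * W87 \<alpha>0 \<alpha>s p (d * q x))"

definition Phi ::
    "(complex \<Rightarrow> complex \<Rightarrow> complex) \<Rightarrow> complex \<Rightarrow> real \<Rightarrow> real \<Rightarrow> real \<Rightarrow> real \<Rightarrow> real \<Rightarrow>
     complex \<Rightarrow> complex \<Rightarrow> complex"
  where "Phi Psi \<tau> s \<kappa> lam \<upsilon> \<sigma> x z =
    W_fun \<tau> s \<kappa> lam \<upsilon> \<sigma> x z / (St \<tau> s \<kappa> lam \<upsilon> \<sigma> x * St_dual \<tau> s \<kappa> lam \<upsilon> \<sigma> z) * Psi x z"

definition c_fun ::
    "complex \<Rightarrow> real \<Rightarrow> real \<Rightarrow> real \<Rightarrow> real \<Rightarrow> real \<Rightarrow> complex \<Rightarrow> complex \<Rightarrow> complex"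
  where "c_fun \<tau> s \<kappa> lam \<upsilon> \<sigma> x z =
    (let q = qpow \<tau>; p = q (of_real s);
         d = AW_d \<tau> s \<kappa> lam \<upsilon> \<sigma>;
         a' = AW_a \<tau> s \<kappa> \<upsilon> lam \<sigma>; b' = AW_b \<tau> s \<kappa> \<upsilon> lam \<sigma>; c' = AW_c \<tau> s \<kappa> \<upsilon> lam \<sigma>
     in theta [a' * q (- z), b' * q (- z), c' * q (- z), d * q (x - z) / a'] p
        / (W_fun \<tau> s \<kappa> lam \<upsilon> \<sigma> x z * theta [q (- 2 * z), d * q x] p))"

definition c_dual ::
    "complex \<Rightarrow> real \<Rightarrow> real \<Rightarrow> real \<Rightarrow> real \<Rightarrow> real \<Rightarrow> complex \<Rightarrow> complex \<Rightarrow> complex"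
  where "c_dual \<tau> s \<kappa> lam \<upsilon> \<sigma> x z = c_fun \<tau> s \<kappa> \<upsilon> lam \<sigma> x z"

end

theory Submission
  imports Defs "HOL-Complex_Analysis.Complex_Analysis"
begin

text \<open>The Askey-Wilson function is, up to a factor, a very-well-poised series \<open>E(x, z)\<close>. A three-term
  relation gives \<open>E(x, z) = c(x, z) \<Phi>(x, z) + c(x, -z) \<Phi>(x, -z)\<close>. A two-term transformation shows
  that \<open>E\<close> is invariant under duality, which exchanges \<open>x\<close> with \<open>z\<close> and the parameters with their
  duals, and so is \<open>\<Phi>\<close>; hence also \<open>E(x, z) = c\<^sup>d(z, x) \<Phi>(x, z) + c\<^sup>d(z, -x) \<Phi>(-x, z)\<close>. Equating the two
  expansions gives the formula on a small open set, and the identity theorem does the rest. No smallness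
  of the parameters is needed: the two expansions converge for small \<open>q\<^sup>x\<close> and for small \<open>q\<^sup>z\<close>,
  respectively.\<close>

section \<open>Infinite products\<close>

text \<open>The comparison involves \<open>Psi\<close> at (x, z), (x, -z) and (-x, z), but its
  defining series needs |d q^x| < 1. Two transforms of that series resolve this. The argument of
  \<open>Psi1\<close> depends on q^x alone, so one small q^x serves both z and -z; the argument of
  the dual \<open>Psi1\<close> depends on q^z alone, so for a fixed small q^z it can be continued in
  x as far as -x. Both transforms and the duality of \<open>EAW\<close> come from a single two-term
  transformation. Its classical form carries quotients of infinite products;
  \<open>norm_series\<close> absorbs them, so that repeated use needs no bookkeeping. Both
  hypergeometric inputs rest on finite identities for divided differences at nodes t + 1/(a t): the
  Leibniz rule yields the two-term transformation, the vanishing on polynomials of low degree yields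
  the three-term relation. Vanishing denominators are excluded all at once: the parameters and p are
  real, and x and z are taken from strips in which none of the relevant monomials in q^x and q^z is
  real.\<close>

lemma qpoch_0 [simp]: "qpoch a p 0 = 1"
  by (simp add: qpoch_def)

lemma qpoch_Suc: "qpoch a p (Suc n) = qpoch a p n * (1 - a * p ^ n)"
  by (simp add: qpoch_def)

lemma qpoch_add: "qpoch a p (m + n) = qpoch a p m * qpoch (a * p ^ m) p n"
  by (induction n) (simp_all add: qpoch_Suc power_add algebra_simps)

lemma qpoch_eq_0_iff: "qpoch a p n = 0 \<longleftrightarrow> (\<exists>i<n. a * p ^ i = 1)"
  by (auto simp: qpoch_def)

locale q_base =
  fixes p :: complex
  assumes p_nz: "p \<noteq> 0" and p_norm: "norm p < 1"
begin

definition qinf :: "complex \<Rightarrow> complex"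
  where "qinf a = (\<Prod>i. 1 - a * p ^ i)"

definition theta1 :: "complex \<Rightarrow> complex"
  where "theta1 x = qinf x * qinf (p / x)"

text \<open>Extracting \<open>r ^ n\<close> leaves factors 1 + (A/r) |p|^i, controlled by the
  exponential of a geometric series. With \<open>r = 1\<close> this bounds q-factorials uniformly in
  \<open>n\<close>; a general \<open>r\<close> is needed for the products of
  \<open>w - p ^ i\<close> in \<open>reg_series_inv_term\<close>, which grow like a power of the
  radius.\<close>

lemma norm_factor_bound:
  assumes "0 \<le> A" "0 \<le> (r :: real)"
  shows "(\<Prod>i<n. r + A * norm p ^ i) \<le> (if r = 0 then A ^ n else r ^ n * exp (A / (r * (1 - norm p))))"
proof (cases "r = 0")
  case True
  have "(\<Prod>i<n. A * norm p ^ i) \<le> (\<Prod>i<n. A)"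
    using assms p_norm by (intro prod_mono) (auto simp: mult_left_le power_le_one)
  with True show ?thesis by simp
next
  case False
  with assms have r: "r > 0" by simp
  have "(\<Prod>i<n. r + A * norm p ^ i) = (\<Prod>i<n. r * (1 + A / r * norm p ^ i))"
    using r by (intro prod.cong refl) (simp add: field_simps)
  also have "\<dots> = r ^ n * (\<Prod>i<n. 1 + A / r * norm p ^ i)"
    by (simp add: prod.distrib)
  also have "(\<Prod>i<n. 1 + A / r * norm p ^ i) \<le> exp (\<Sum>i<n. A / r * norm p ^ i)"
    using r assms by (intro prod_le_exp_sum) auto
  also have "(\<Sum>i<n. A / r * norm p ^ i) \<le> A / r * (1 / (1 - norm p))"
  proof -
    have "(\<Sum>i<n. norm p ^ i) \<le> (\<Sum>i. norm p ^ i)"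
      using p_norm by (intro sum_le_suminf summable_geometric) auto
    also have "\<dots> = 1 / (1 - norm p)"
      using p_norm by (intro suminf_geometric) auto
    finally have "A / r * (\<Sum>i<n. norm p ^ i) \<le> A / r * (1 / (1 - norm p))"
      using r assms by (intro mult_left_mono) auto
    thus ?thesis by (simp add: sum_distrib_left)
  qed
  finally show ?thesis using r False by (simp add: mult_left_mono)
qed

lemma qpoch_norm_le:
  assumes "norm a \<le> A"
  shows "norm (qpoch a p n) \<le> exp (A / (1 - norm p))"
proof -
  have "norm (qpoch a p n) = (\<Prod>i<n. norm (1 - a * p ^ i))"
    by (simp add: qpoch_def prod_norm)
  also have "\<dots> \<le> (\<Prod>i<n. 1 + A * norm p ^ i)"
  proof (intro prod_mono conjI)
    fix i
    have "norm (1 - a * p ^ i) \<le> 1 + norm a * norm p ^ i"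
      by (metis norm_triangle_ineq4 norm_one norm_mult norm_power)
    also have "\<dots> \<le> 1 + A * norm p ^ i"
      using assms by (intro add_left_mono mult_right_mono) auto
    finally show "norm (1 - a * p ^ i) \<le> 1 + A * norm p ^ i" .
  qed auto
  also have "\<dots> \<le> exp (A / (1 - norm p))"
    using norm_factor_bound[of A 1 n] assms order_trans[OF norm_ge_zero assms] by simp
  finally show ?thesis .
qed

lemma abs_summable_factors: "summable (\<lambda>i. norm (- (a * p ^ i)))"
  using p_norm by (simp add: norm_mult norm_power summable_mult summable_geometric)

lemma qinf_convergent: "convergent_prod (\<lambda>i. 1 - a * p ^ i)"
  using summable_imp_convergent_prod_complex[OF abs_summable_factors[of a]]
    abs_convergent_prod_imp_convergent_prod
      [of "\<lambda>i. 1 - a * p ^ i"] abs_summable_factors[of a]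
  by (simp add: summable_imp_abs_convergent_prod)

lemma qpoch_tendsto_qinf: "(\<lambda>n. qpoch a p n) \<longlonglongrightarrow> qinf a"
proof -
  have "(\<lambda>n. \<Prod>i\<le>n. 1 - a * p ^ i) \<longlonglongrightarrow> qinf a"
    unfolding qinf_def by (rule convergent_prod_LIMSEQ[OF qinf_convergent])
  hence "(\<lambda>n. qpoch a p (Suc n)) \<longlonglongrightarrow> qinf a"
    by (simp add: qpoch_def lessThan_Suc_atMost)
  thus ?thesis by (rule LIMSEQ_imp_Suc)
qed

lemma qinf_split: "qinf a = qpoch a p n * qinf (a * p ^ n)"
proof (rule LIMSEQ_unique)
  show "(\<lambda>m. qpoch a p (n + m)) \<longlonglongrightarrow> qinf a"
    using LIMSEQ_ignore_initial_segment[OF qpoch_tendsto_qinf[of a], of n] by (simp add: add.commute)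
  show "(\<lambda>m. qpoch a p (n + m)) \<longlonglongrightarrow> qpoch a p n * qinf (a * p ^ n)"
    unfolding qpoch_add by (intro tendsto_intros qpoch_tendsto_qinf)
qed

lemma qinf_norm_le:
  assumes "norm a \<le> A"
  shows "norm (qinf a) \<le> exp (A / (1 - norm p))"
  by (rule LIMSEQ_le_const2[OF tendsto_norm[OF qpoch_tendsto_qinf[of a]]])
    (auto intro!: exI[of _ 0] qpoch_norm_le assms)

lemma qinf_eq_0_iff: "qinf a = 0 \<longleftrightarrow> (\<exists>i. a * p ^ i = 1)"
proof
  assume "qinf a = 0"
  thus "\<exists>i. a * p ^ i = 1"
    using prodinf_nonzero[OF qinf_convergent[of a]] by (auto simp: qinf_def)
next
  assume "\<exists>i. a * p ^ i = 1"
  then obtain i where i: "a * p ^ i = 1" by blast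
  have "qpoch a p (Suc i) = 0" using i by (simp add: qpoch_Suc)
  thus "qinf a = 0" using qinf_split[of a "Suc i"] by simp
qed

lemma qpoch_nz: "qinf a \<noteq> 0 \<Longrightarrow> qpoch a p n \<noteq> 0"
  by (auto simp: qinf_eq_0_iff qpoch_eq_0_iff)

lemma qpoch_inverse_bounded:
  assumes "qinf a \<noteq> 0"
  obtains C where "\<And>n. norm (inverse (qpoch a p n)) \<le> C" "C > 0"
proof -
  have "(\<lambda>n. inverse (qpoch a p n)) \<longlonglongrightarrow> inverse (qinf a)"
    by (intro tendsto_inverse qpoch_tendsto_qinf assms)
  hence "Bseq (\<lambda>n. inverse (qpoch a p n))"
    by (meson convergentI convergent_imp_Bseq)
  thus ?thesis using that by (auto simp: Bseq_def)
qed

lemma qpoch_holomorphic: "(\<lambda>a. qpoch a p n) holomorphic_on A"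
  unfolding qpoch_def by (intro holomorphic_intros)

lemma qinf_holomorphic_UNIV: "qinf holomorphic_on UNIV"
proof (rule holomorphic_uniform_sequence[where f = "\<lambda>n a. qpoch a p n"])
  fix x :: complex
  show "\<exists>d>0. cball x d \<subseteq> UNIV \<and> uniform_limit (cball x d) (\<lambda>n a. qpoch a p n) qinf sequentially"
  proof (intro exI[of _ 1] conjI)
    have "uniformly_convergent_on (cball x 1) (\<lambda>N a. \<Prod>n<N. 1 + (- (a * p ^ n)))"
    proof (rule Infinite_Products.uniformly_convergent_on_prod)
      show "uniformly_convergent_on (cball x 1) (\<lambda>N a. \<Sum>n<N. norm (- (a * p ^ n)))"
      proof (rule Weierstrass_m_test')
        show "summable (\<lambda>n. (norm x + 1) * norm p ^ n)"
          using p_norm by (intro summable_mult summable_geometric) auto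
        show "norm (norm (- (a * p ^ n))) \<le> (norm x + 1) * norm p ^ n" if "a \<in> cball x 1" for n a
        proof -
          have "norm a \<le> norm x + 1"
            using that norm_triangle_ineq2[of a x] by (simp add: dist_norm norm_minus_commute)
          thus ?thesis by (simp add: norm_mult norm_power mult_right_mono)
        qed
      qed
    qed (auto intro!: continuous_intros)
    then obtain l where l: "uniform_limit (cball x 1) (\<lambda>N a. qpoch a p N) l sequentially"
      by (auto simp: uniformly_convergent_on_def qpoch_def)
    have "l a = qinf a" if "a \<in> cball x 1" for a
      using tendsto_uniform_limitI[OF l that] qpoch_tendsto_qinf[of a] LIMSEQ_unique by blast
    thus "uniform_limit (cball x 1) (\<lambda>n a. qpoch a p n) qinf sequentially"
      using l uniform_limit_cong'[of "cball x 1" "\<lambda>N a. qpoch a p N" "\<lambda>N a. qpoch a p N" l qinf] by simp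
  qed auto
qed (auto intro: qpoch_holomorphic)

lemma qinf_holomorphic [holomorphic_intros]:
  assumes "f holomorphic_on A"
  shows "(\<lambda>x. qinf (f x)) holomorphic_on A"
  using holomorphic_on_compose_gen[OF assms qinf_holomorphic_UNIV] by (simp add: o_def)

lemma theta1_inverse:
  assumes "x \<noteq> 0"
  shows "theta1 (1 / x) = - theta1 x / x"
proof -
  have 1: "qinf (1 / x) = (1 - 1 / x) * qinf (p / x)"
    using qinf_split[of "1 / x" 1] by (simp add: qpoch_Suc)
  have 2: "qinf x = (1 - x) * qinf (p * x)"
    using qinf_split[of x 1] by (simp add: qpoch_Suc mult.commute)
  have "theta1 (1 / x) = (1 - 1 / x) * qinf (p / x) * qinf (p * x)"
    unfolding theta1_def 1 by simp
  also have "(1 - 1 / x) = - (1 - x) / x" using assms by (simp add: field_simps)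
  finally show ?thesis unfolding theta1_def 2 using assms by (simp add: field_simps)
qed

end

section \<open>Divided differences and the terminating transformation\<close>

text \<open>Lagrange form over an arbitrary finite index set: intervals of exponents serve the
  two-term transformation, pairs of a progression and an exponent serve the three-term
  relation.\<close>

definition ddiff :: "('i \<Rightarrow> complex) \<Rightarrow> ('i \<Rightarrow> complex) \<Rightarrow> 'i set \<Rightarrow> complex"
  where "ddiff \<sigma> g A = (\<Sum>r\<in>A. g r / (\<Prod>k\<in>A - {r}. \<sigma> r - \<sigma> k))"

lemma ddiff_add: "ddiff \<sigma> (\<lambda>r. f r + g r) A = ddiff \<sigma> f A + ddiff \<sigma> g A"
  by (simp add: ddiff_def add_divide_distrib sum.distrib)

lemma ddiff_diff: "ddiff \<sigma> (\<lambda>r. f r - g r) A = ddiff \<sigma> f A - ddiff \<sigma> g A"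
  by (simp add: ddiff_def diff_divide_distrib sum_subtractf)

lemma ddiff_cmult: "ddiff \<sigma> (\<lambda>r. c * g r) A = c * ddiff \<sigma> g A"
  by (simp add: ddiff_def sum_distrib_left)

lemma ddiff_linear_factor:
  assumes "finite A" "i \<in> A" "inj_on \<sigma> A"
  shows "ddiff \<sigma> (\<lambda>r. (\<sigma> r - \<sigma> i) * g r) A = ddiff \<sigma> g (A - {i})"
proof -
  have "ddiff \<sigma> (\<lambda>r. (\<sigma> r - \<sigma> i) * g r) A =
      (\<Sum>r\<in>A - {i}. (\<sigma> r - \<sigma> i) * g r / (\<Prod>k\<in>A - {r}. \<sigma> r - \<sigma> k))"
    unfolding ddiff_def using assms by (subst sum.remove[of A i]) auto
  also have "\<dots> = ddiff \<sigma> g (A - {i})"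
    unfolding ddiff_def
  proof (intro sum.cong refl)
    fix r assume r: "r \<in> A - {i}"
    have "(\<Prod>k\<in>A - {r}. \<sigma> r - \<sigma> k) = (\<sigma> r - \<sigma> i) * (\<Prod>k\<in>A - {r} - {i}. \<sigma> r - \<sigma> k)"
      using assms r by (intro prod.remove) auto
    moreover have "A - {r} - {i} = A - {i} - {r}" by auto
    moreover have "\<sigma> r - \<sigma> i \<noteq> 0" using assms r by (auto simp: inj_on_def)
    ultimately show "(\<sigma> r - \<sigma> i) * g r / (\<Prod>k\<in>A - {r}. \<sigma> r - \<sigma> k) =
        g r / (\<Prod>k\<in>A - {i} - {r}. \<sigma> r - \<sigma> k)"
      by simp
  qed
  finally show ?thesis .
qed

lemma ddiff_rec:
  assumes "finite A" "i \<in> A" "j \<in> A" "inj_on \<sigma> A"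
  shows "(\<sigma> j - \<sigma> i) * ddiff \<sigma> g A = ddiff \<sigma> g (A - {i}) - ddiff \<sigma> g (A - {j})"
proof -
  have "(\<sigma> j - \<sigma> i) * ddiff \<sigma> g A =
      ddiff \<sigma> (\<lambda>r. (\<sigma> r - \<sigma> i) * g r - (\<sigma> r - \<sigma> j) * g r) A"
    unfolding ddiff_cmult[symmetric] by (intro arg_cong2[of _ _ _ _ "ddiff \<sigma>"] ext) (simp_all add: algebra_simps)
  also have "\<dots> = ddiff \<sigma> g (A - {i}) - ddiff \<sigma> g (A - {j})"
    using assms by (simp add: ddiff_diff ddiff_linear_factor)
  finally show ?thesis .
qed

text \<open>A divided difference at N nodes kills polynomials of degree below N - 1. One linear
  factor is rewritten as a multiple of \<open>\<sigma> r - \<sigma> i\<close> plus a constant: the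
  first part removes a node together with the factor, the second removes only the factor, so enough
  nodes remain in both cases.\<close>

lemma ddiff_prod_linear_eq_0:
  assumes "finite A" "inj_on \<sigma> A" "finite B" "card B + 2 \<le> card A"
  shows "ddiff \<sigma> (\<lambda>r. \<Prod>k\<in>B. \<alpha> k + \<beta> k * \<sigma> r) A = 0"
  using assms(3,1,2,4)
proof (induction B arbitrary: A rule: finite_induct)
  case empty
  have "\<lbrakk>finite A; inj_on \<sigma> A; card A = Suc (Suc n)\<rbrakk> \<Longrightarrow> ddiff \<sigma> (\<lambda>r. 1) A = 0" for n A
  proof (induction n arbitrary: A)
    case 0
    then obtain i j where "A = {i, j}" "i \<noteq> j"
      by (metis One_nat_def card_2_iff numeral_2_eq_2)
    moreover from this have "\<sigma> i \<noteq> \<sigma> j" using 0 by (auto simp: inj_on_def)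
    ultimately show ?case by (simp add: ddiff_def insert_Diff_if field_simps)
  next
    case (Suc n)
    then obtain i where i: "i \<in> A" by fastforce
    with Suc obtain j where j: "j \<in> A - {i}"
      by (metis card_Diff_singleton card.empty diff_Suc_1 ex_in_conv nat.distinct(1))
    have "ddiff \<sigma> (\<lambda>r. 1) (A - {k}) = 0" if "k \<in> A" for k
      using that Suc.prems by (intro Suc.IH) (auto intro: inj_on_subset)
    with ddiff_rec[of A i j \<sigma> "\<lambda>r. 1"] i j Suc.prems
    have "(\<sigma> j - \<sigma> i) * ddiff \<sigma> (\<lambda>r. 1) A = 0" by simp
    moreover have "\<sigma> j \<noteq> \<sigma> i" using i j Suc.prems by (auto simp: inj_on_def)
    ultimately show ?case by simp
  qed
  from this[of A "card A - 2"] empty show ?case by simp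
next
  case (insert x B)
  let ?P = "\<lambda>r. \<Prod>k\<in>B. \<alpha> k + \<beta> k * \<sigma> r"
  from insert.prems obtain i where i: "i \<in> A" by fastforce
  have "ddiff \<sigma> (\<lambda>r. \<Prod>k\<in>insert x B. \<alpha> k + \<beta> k * \<sigma> r) A =
      ddiff \<sigma> (\<lambda>r. \<beta> x * ((\<sigma> r - \<sigma> i) * ?P r) + (\<alpha> x + \<beta> x * \<sigma> i) * ?P r) A"
    using insert.hyps by (simp add: algebra_simps)
  also have "\<dots> = \<beta> x * ddiff \<sigma> ?P (A - {i}) + (\<alpha> x + \<beta> x * \<sigma> i) * ddiff \<sigma> ?P A"
    unfolding ddiff_add ddiff_cmult ddiff_linear_factor[OF insert.prems(1) i insert.prems(2)] ..
  also have "\<dots> = 0"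
    using insert.IH[of A] insert.IH[of "A - {i}"] insert.prems insert.hyps i
    by (simp add: inj_on_subset[of _ A])
  finally show ?case .
qed

lemma ddiff_interval_rec:
  fixes \<sigma> :: "nat \<Rightarrow> complex"
  assumes "inj \<sigma>"
  shows "(\<sigma> (i + Suc n) - \<sigma> i) * ddiff \<sigma> g {i..i + Suc n} =
    ddiff \<sigma> g {Suc i..Suc i + n} - ddiff \<sigma> g {i..i + n}"
proof -
  have "{i..i + Suc n} - {i} = {Suc i..Suc i + n}" "{i..i + Suc n} - {i + Suc n} = {i..i + n}"
    by auto
  thus ?thesis
    using ddiff_rec[of "{i..i + Suc n}" i "i + Suc n" \<sigma> g] assms by (simp add: inj_on_subset)
qed

text \<open>Induction on the number of nodes. The difference of the two outer nodes is split at the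
  intermediate node \<open>\<sigma> (i + k)\<close>; by the interval recursion one part lowers the
  order for \<open>g\<close>, the other the order for \<open>f\<close>, and the mixed products
  cancel.\<close>

lemma ddiff_Leibniz:
  fixes \<sigma> :: "nat \<Rightarrow> complex"
  assumes "inj \<sigma>"
  shows "ddiff \<sigma> (\<lambda>r. f r * g r) {i..i + n} =
    (\<Sum>k\<le>n. ddiff \<sigma> f {i..i + k} * ddiff \<sigma> g {i + k..i + n})"
proof (induction n arbitrary: i)
  case 0
  show ?case by (simp add: ddiff_def)
next
  case (Suc n)
  let ?F = "\<lambda>i k. ddiff \<sigma> f {i..k}" and ?G = "\<lambda>i k. ddiff \<sigma> g {i..k}"
  let ?m = "i + Suc n"
  have G: "(\<sigma> ?m - \<sigma> (i + k)) * ?G (i + k) ?m = (if k \<le> n then ?G (Suc (i + k)) ?m - ?G (i + k) (i + n) else 0)"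
    if "k \<le> Suc n" for k
  proof (cases "k \<le> n")
    case True
    have "i + k + Suc (n - k) = ?m" "Suc (i + k) + (n - k) = ?m" "i + k + (n - k) = i + n"
      using True by auto
    with ddiff_interval_rec[OF assms, of "i + k" "n - k" g] True show ?thesis by simp
  next
    case False
    with that have "k = Suc n" by simp
    thus ?thesis by simp
  qed
  have F: "(\<sigma> (i + Suc k) - \<sigma> i) * ?F i (i + Suc k) = ?F (Suc i) (i + Suc k) - ?F i (i + k)" for k
    using ddiff_interval_rec[OF assms, of i k f] by simp
  have "(\<sigma> ?m - \<sigma> i) * (\<Sum>k\<le>Suc n. ?F i (i + k) * ?G (i + k) ?m) =
      (\<Sum>k\<le>Suc n. ?F i (i + k) * ((\<sigma> ?m - \<sigma> (i + k)) * ?G (i + k) ?m)) +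
      (\<Sum>k\<le>Suc n. ((\<sigma> (i + k) - \<sigma> i) * ?F i (i + k)) * ?G (i + k) ?m)"
    unfolding sum_distrib_left sum.distrib[symmetric] by (intro sum.cong refl) (simp add: algebra_simps)
  also have "(\<Sum>k\<le>Suc n. ?F i (i + k) * ((\<sigma> ?m - \<sigma> (i + k)) * ?G (i + k) ?m)) =
      (\<Sum>k\<le>Suc n. ?F i (i + k) * (if k \<le> n then ?G (Suc (i + k)) ?m - ?G (i + k) (i + n) else 0))"
    by (intro sum.cong refl) (simp only: G atMost_iff)
  also have "\<dots> = (\<Sum>k\<le>n. ?F i (i + k) * (?G (Suc (i + k)) ?m - ?G (i + k) (i + n)))"
    by simp
  \<comment> \<open>The term with k = 0 has the factor \<open>\<sigma> i - \<sigma> i\<close>, so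
    the index can be shifted without a boundary term.\<close>
  also have "(\<Sum>k\<le>Suc n. ((\<sigma> (i + k) - \<sigma> i) * ?F i (i + k)) * ?G (i + k) ?m) =
     (\<Sum>k\<le>n. (?F (Suc i) (i + Suc k) - ?F i (i + k)) * ?G (i + Suc k) ?m)"
    by (subst sum.atMost_Suc_shift) (simp only: F, simp)
  also have "(\<Sum>k\<le>n. ?F i (i + k) * (?G (Suc (i + k)) ?m - ?G (i + k) (i + n))) + \<dots> =
      (\<Sum>k\<le>n. ?F (Suc i) (Suc i + k) * ?G (Suc i + k) (Suc i + n)) - (\<Sum>k\<le>n. ?F i (i + k) * ?G (i + k) (i + n))"
    unfolding sum_subtractf[symmetric] sum.distrib[symmetric]
    by (intro sum.cong refl) (simp add: algebra_simps)
  also have "\<dots> = (\<sigma> ?m - \<sigma> i) * ddiff \<sigma> (\<lambda>r. f r * g r) {i..?m}"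
    unfolding ddiff_interval_rec[OF assms] Suc.IH[symmetric] by simp
  finally have "(\<sigma> ?m - \<sigma> i) * (\<Sum>k\<le>Suc n. ?F i (i + k) * ?G (i + k) ?m) = \<dots>" .
  moreover have "\<sigma> ?m - \<sigma> i \<noteq> 0" using injD[OF assms, of ?m i] by auto
  ultimately show ?case by simp
qed

section \<open>Arguments off the powers of \<open>p\<close>, and the nodes of very-well-poised
  sums\<close>

context q_base
begin

text \<open>For nonzero \<open>x\<close> this amounts to \<open>theta1 x \<noteq> 0\<close>. Integer
  powers make it visibly stable under shifts by \<open>p\<close> and under inversion, and every
  \<open>qpoch\<close> and \<open>qinf\<close> of such an argument is nonzero.\<close>

definition nonres :: "complex \<Rightarrow> bool"
  where "nonres x \<longleftrightarrow> x \<noteq> 0 \<and> (\<forall>k::int. x \<noteq> p powi k)"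

lemma nonres_nz: "nonres x \<Longrightarrow> x \<noteq> 0"
  by (simp add: nonres_def)

lemma nonres_mult_powi:
  assumes "nonres x"
  shows "nonres (x * p powi m)"
proof -
  have "x * p powi m \<noteq> p powi k" for k
  proof
    assume "x * p powi m = p powi k"
    hence "x = p powi (k - m)" using p_nz by (simp add: power_int_diff field_simps)
    with assms show False unfolding nonres_def by blast
  qed
  with assms p_nz show ?thesis by (simp add: nonres_def)
qed

lemma nonres_mult_power: "nonres x \<Longrightarrow> nonres (x * p ^ n)"
  using nonres_mult_powi[of x "int n"] by simp

lemma nonres_mult: "nonres x \<Longrightarrow> nonres (x * p)"
  using nonres_mult_power[of x 1] by simp

lemma nonres_inverse:
  assumes "nonres x"
  shows "nonres (1 / x)"
proof -
  have "1 / x \<noteq> p powi k" for k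
  proof
    assume "1 / x = p powi k"
    hence "x = p powi (- k)" using p_nz assms by (simp add: power_int_minus field_simps nonres_def)
    with assms show False unfolding nonres_def by blast
  qed
  with assms show ?thesis by (simp add: nonres_def)
qed

lemma nonres_p_over: "nonres x \<Longrightarrow> nonres (p / x)"
  using nonres_mult[OF nonres_inverse] by simp

lemma nonres_neq_1: "nonres x \<Longrightarrow> x * p ^ n \<noteq> 1"
  using nonres_mult_power[of x n] by (auto simp: nonres_def dest: spec[of _ 0])

lemma nonres_qinf: "nonres x \<Longrightarrow> qinf x \<noteq> 0"
  using nonres_neq_1 by (auto simp: qinf_eq_0_iff)

lemma nonres_qpoch: "nonres x \<Longrightarrow> qpoch x p n \<noteq> 0"
  by (intro qpoch_nz nonres_qinf)

lemma nonres_theta1: "nonres x \<Longrightarrow> theta1 x \<noteq> 0"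
  by (simp add: theta1_def nonres_qinf nonres_p_over)

lemma p_power_inj: "p ^ m = p ^ n \<Longrightarrow> m = n"
proof (induction m n rule: linorder_wlog)
  case (le m n)
  then obtain k where k: "n = m + k" using le_Suc_ex by blast
  with le p_nz have "p ^ k = 1" by (simp add: power_add)
  hence "norm p ^ k = 1" by (metis norm_one norm_power)
  hence "k = 0" using p_norm by (metis less_irrefl norm_ge_zero not_gr_zero power_less_one_iff)
  with k show ?case by simp
qed simp

lemma qinf_p_nz: "qinf p \<noteq> 0"
proof -
  have "p * p ^ i \<noteq> 1" for i using p_power_inj[of "Suc i" 0] by auto
  thus ?thesis by (simp add: qinf_eq_0_iff)
qed

lemma qpoch_p_nz: "qpoch p p n \<noteq> 0"
  by (intro qpoch_nz qinf_p_nz)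

text \<open>The q-quadratic lattice. A difference of two nodes splits into a factor in p^(k - r) and
  one in p^(k + r), see \<open>node_diff\<close>; multiplied over all nodes these build the
  very-well-poised part of a series.\<close>

definition node :: "complex \<Rightarrow> nat \<Rightarrow> complex"
  where "node a r = p ^ r + 1 / (a * p ^ r)"

text \<open>This is p^(r(r+1)/2); the exponent stays a sum so that successor steps need no division
  by two.\<close>

definition tri :: "nat \<Rightarrow> complex"
  where "tri r = p ^ (\<Sum>{..r})"

lemma tri_0: "tri 0 = 1" and tri_Suc: "tri (Suc r) = tri r * p ^ Suc r"
  by (simp_all add: tri_def power_add)

lemma tri_nz: "tri r \<noteq> 0"
  using p_nz by (simp add: tri_def)

lemma tri_add: "tri (k + m) = tri k * tri m * p ^ (k * m)"
  by (induction m) (simp_all add: tri_0 tri_Suc power_add algebra_simps)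

lemma node_diff:
  assumes "a \<noteq> 0"
  shows "node a r - node a k = - ((1 - p ^ k / p ^ r) * (1 - a * p ^ r * p ^ k)) / (a * p ^ k)"
  using assms p_nz by (simp add: node_def divide_simps) algebra

lemma inj_node:
  assumes "nonres a"
  shows "inj (node a)"
proof (rule injI)
  fix r k assume "node a r = node a k"
  hence "(1 - p ^ k / p ^ r) * (1 - a * p ^ r * p ^ k) = 0"
    using node_diff[of a r k] nonres_nz[OF assms] p_nz by simp
  moreover have "a * p ^ r * p ^ k \<noteq> 1"
    using nonres_neq_1[OF assms, of "r + k"] by (simp add: power_add mult.assoc)
  ultimately show "r = k" using p_power_inj[of k r] p_nz by auto
qed

definition vwp_pair :: "complex \<Rightarrow> complex \<Rightarrow> complex \<Rightarrow> nat \<Rightarrow> complex"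
  where "vwp_pair a b c r =
    qpoch b p r * qpoch c p r / (qpoch (a * p / b) p r * qpoch (a * p / c) p r) * (a * p / (b * c)) ^ r"

text \<open>Classically this is the terminating very-well-poised 6phi5 summation, with products of
  node differences in place of the factors of \<open>a\<close> and p^(-k). The closed form is
  verified against the interval recursion.\<close>

lemma ddiff_vwp_pair:
  assumes "nonres a" "nonres (a / b)" "nonres (a / c)"
  shows "ddiff (node a) (vwp_pair a b c) {i..i + k} =
    vwp_pair a b c i * qpoch (a * p / (b * c)) p k * (- a) ^ k * tri k * p ^ (i * k) /
      (qpoch p p k * qpoch (a * p * p ^ i / b) p k * qpoch (a * p * p ^ i / c) p k)"
proof (induction k arbitrary: i)
  case 0
  show ?case by (simp add: ddiff_def tri_0)
next
  case (Suc k)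
  have nz: "a \<noteq> 0" "b \<noteq> 0" "c \<noteq> 0" using assms by (auto simp: nonres_def)
  define P where "P = p ^ i"
  define K where "K = p ^ k"
  have PK: "P \<noteq> 0" "K \<noteq> 0" using p_nz by (auto simp: P_def K_def)
  \<comment> \<open>Common factor of the two lower differences and of the claimed value. Its
    denominators run up to \<open>Suc k\<close>, so that \<open>A\<close> and \<open>B\<close>
    become polynomial multiples of it; what then remains to be checked is the rational identity
    \<open>E\<close>.\<close>
  define F where "F = vwp_pair a b c i * qpoch (a * p / (b * c)) p k * (- a) ^ k * tri k * p ^ (i * k) /
      (qpoch p p k * qpoch (a * p * P / b) p (Suc k) * qpoch (a * p * P / c) p (Suc k))"
  have gb: "nonres (a * p * P / x * p ^ m)" if "nonres (a / x)" for x m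
    using nonres_mult_power[OF nonres_mult_power[OF nonres_mult[OF that], of i], of m] by (simp add: P_def)
  have nzb: "qpoch (a * p * P / x) p m \<noteq> 0" "1 - a * p * P / x * p ^ m \<noteq> 0" if "nonres (a / x)" for x m
    using nonres_qpoch[OF gb[OF that, of 0]] gb[OF that, of m] by (auto simp: nonres_def dest: spec[of _ 0])
  have shift: "qpoch (a * p * P / x) p (Suc k) = (1 - a * p * P / x) * qpoch (a * p * (P * p) / x) p k" for x
    using qpoch_add[of "a * p * P / x" p 1 k] by (simp add: qpoch_Suc mult_ac)
  have nzb': "qpoch (a * p * (P * p) / x) p k \<noteq> 0" if "nonres (a / x)" for x
    using nzb(1)[OF that, of "Suc k"] shift[of x] by auto
  have pk: "1 - p * K \<noteq> 0" using p_power_inj[of "Suc k" 0] by (auto simp: K_def)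
  have 1: "vwp_pair a b c (Suc i) = vwp_pair a b c i * (1 - b * P) * (1 - c * P) * (a * p / (b * c)) /
      ((1 - a * p * P / b) * (1 - a * p * P / c))"
    by (simp add: vwp_pair_def qpoch_Suc P_def mult_ac)
  have A: "ddiff (node a) (vwp_pair a b c) {Suc i..Suc i + k} =
      F * (K * (1 - b * P) * (1 - c * P) * (a * p / (b * c)))"
    unfolding Suc.IH F_def 1 shift
    using nzb'[OF assms(2)] nzb'[OF assms(3)] nzb(2)[OF assms(2), of 0] nzb(2)[OF assms(3), of 0]
      qpoch_p_nz[of k]
    by (simp add: power_add power_mult[symmetric] P_def[symmetric] K_def[symmetric] mult_ac)
  have B: "ddiff (node a) (vwp_pair a b c) {i..i + k} =
      F * ((1 - a * p * P * K / b) * (1 - a * p * P * K / c))"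
  proof -
    have cancel: "x / (y * v * w) = x / (y * (v * s) * (w * t)) * (s * t)" if "s \<noteq> 0" "t \<noteq> 0" for x y v w s t :: complex
      using that by simp
    have K: "a * p * P * K / x = a * p * P / x * p ^ k" for x by (simp add: K_def)
    show ?thesis
      unfolding Suc.IH F_def P_def[symmetric] qpoch_Suc[of "a * p * P / b"] qpoch_Suc[of "a * p * P / c"] K
      by (rule cancel[OF nzb(2)[OF assms(2), of k] nzb(2)[OF assms(3), of k]])
  qed
  have C: "vwp_pair a b c i * qpoch (a * p / (b * c)) p (Suc k) * (- a) ^ Suc k * tri (Suc k) * p ^ (i * Suc k) /
      (qpoch p p (Suc k) * qpoch (a * p * p ^ i / b) p (Suc k) * qpoch (a * p * p ^ i / c) p (Suc k)) =
      F * ((1 - a * p / (b * c) * K) * (- a) * K * p * P / (1 - p * K))"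
    unfolding F_def
    by (simp add: P_def[symmetric] K_def[symmetric] qpoch_Suc[of "a * p / (b * c)"] qpoch_Suc[of p] tri_Suc power_add mult_ac)
  have D: "node a (i + Suc k) - node a i = (p * K - 1) * (P - 1 / (a * P * p * K))"
    using nz p_nz PK by (simp add: node_def power_add P_def[symmetric] K_def[symmetric] divide_simps) algebra
  have E: "K * (1 - b * P) * (1 - c * P) * (a * p / (b * c)) - (1 - a * p * P * K / b) * (1 - a * p * P * K / c)
     = (p * K - 1) * (P - 1 / (a * P * p * K)) * ((1 - a * p / (b * c) * K) * (- a) * K * p * P / (1 - p * K))"
  proof -
    have L: "K * (1 - b * P) * (1 - c * P) * (a * p / (b * c)) - (1 - a * p * P * K / b) * (1 - a * p * P * K / c) =
          (a * p * K * P^2 - 1) * (1 - a * p / (b * c) * K)"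
      using nz by (simp add: divide_simps power2_eq_square) algebra
    have "(p * K - 1) * (P - 1 / (a * P * p * K)) * ((1 - a * p / (b * c) * K) * (- a) * K * p * P / (1 - p * K)) =
       (P - 1 / (a * P * p * K)) * ((1 - a * p / (b * c) * K) * a * K * p * P)"
    proof -
      have "(s - 1) * w * (v * (- a) * K * p * P / (1 - s)) = w * (v * a * K * p * P)"
        if "1 - s \<noteq> 0" for s v w :: complex
        using that by (simp add: divide_simps) algebra
      from this[OF pk] show ?thesis .
    qed
    also have "\<dots> = (a * p * K * P^2 - 1) * (1 - a * p / (b * c) * K)"
      using nz p_nz PK by (simp add: divide_simps power2_eq_square)
    finally show ?thesis unfolding L by (rule sym)
  qed
  have "(node a (i + Suc k) - node a i) * ddiff (node a) (vwp_pair a b c) {i..i + Suc k} =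
      (node a (i + Suc k) - node a i) * (F * ((1 - a * p / (b * c) * K) * (- a) * K * p * P / (1 - p * K)))"
  proof -
    have "(node a (i + Suc k) - node a i) * ddiff (node a) (vwp_pair a b c) {i..i + Suc k} =
        F * (K * (1 - b * P) * (1 - c * P) * (a * p / (b * c)) -
          (1 - a * p * P * K / b) * (1 - a * p * P * K / c))"
      unfolding ddiff_interval_rec[OF inj_node[OF assms(1)]] A B right_diff_distrib[symmetric] ..
    thus ?thesis unfolding E D by (simp only: mult_ac)
  qed
  moreover have "node a (i + Suc k) - node a i \<noteq> 0"
    using inj_node[OF assms(1)] by (auto dest: injD)
  ultimately show ?case unfolding C using mult_left_cancel by blast
qed

text \<open>The Leibniz rule turns the divided difference of a product of two very-well-poised pairs into
  a balanced sum. That sum is also produced by the parameters \<open>l\<close> of the transformation below, so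
  this is Watson's transformation, used twice.\<close>

lemma ddiff_two_pairs:
  assumes "nonres a" "nonres (a / b)" "nonres (a / c)" "nonres (a / d)" "nonres (a / e)"
  shows "ddiff (node a) (\<lambda>r. vwp_pair a b c r * vwp_pair a d e r) {0..n} *
      (qpoch (a * p / d) p n * qpoch (a * p / e) p n) =
    (- a) ^ n * tri n *
    (\<Sum>k\<le>n. qpoch (a * p / (b * c)) p k * qpoch d p k * qpoch e p k * (a * p / (d * e)) ^ k *
       qpoch (a * p / (d * e)) p (n - k) /
       (qpoch p p k * qpoch p p (n - k) * qpoch (a * p / b) p k * qpoch (a * p / c) p k))"
  using ddiff_Leibniz[OF inj_node[OF assms(1)], of "vwp_pair a b c" "vwp_pair a d e" 0 n]
proof (simp, unfold sum_distrib_left sum_distrib_right, intro sum.cong refl)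
  fix k assume "k \<in> {..n}"
  then obtain m where n: "n = k + m" using le_Suc_ex by auto
  have g: "qpoch (a * p / x) p i \<noteq> 0" "qpoch (a * p * p ^ k / x) p i \<noteq> 0" if "nonres (a / x)" for x i
    using nonres_qpoch[OF nonres_mult[OF that]] nonres_qpoch[OF nonres_mult_power[OF nonres_mult[OF that]], of k]
    by (simp_all add: mult_ac)
  have s: "qpoch (a * p / x) p n = qpoch (a * p / x) p k * qpoch (a * p * p ^ k / x) p m" for x
    unfolding n by (simp add: qpoch_add)
  have "ddiff (node a) (vwp_pair a b c) {0..k} = qpoch (a * p / (b * c)) p k * (- a) ^ k * tri k /
      (qpoch p p k * qpoch (a * p / b) p k * qpoch (a * p / c) p k)"
    using ddiff_vwp_pair[OF assms(1-3), of 0 k] by (simp add: vwp_pair_def)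
  moreover have "ddiff (node a) (vwp_pair a d e) {k..n} = vwp_pair a d e k *
      qpoch (a * p / (d * e)) p m * (- a) ^ m * tri m * p ^ (k * m) /
      (qpoch p p m * qpoch (a * p * p ^ k / d) p m * qpoch (a * p * p ^ k / e) p m)"
    unfolding n by (rule ddiff_vwp_pair[OF assms(1,4,5)])
  ultimately show "ddiff (node a) (vwp_pair a b c) {0..k} * ddiff (node a) (vwp_pair a d e) {k..n} *
         (qpoch (a * p / d) p n * qpoch (a * p / e) p n) =
         (- a) ^ n * tri n *
         (qpoch (a * p / (b * c)) p k * qpoch d p k * qpoch e p k * (a * p / (d * e)) ^ k *
          qpoch (a * p / (d * e)) p (n - k) /
          (qpoch p p k * qpoch p p (n - k) * qpoch (a * p / b) p k * qpoch (a * p / c) p k))"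
    using g[OF assms(4)] g[OF assms(5)]
    by (simp add: s vwp_pair_def) (simp add: n tri_add power_add mult_ac)
qed

end

section \<open>Two-term transformations of very-well-poised series\<close>

lemma holomorphic_on_suminf_geometric:
  fixes f :: "nat \<Rightarrow> complex \<Rightarrow> complex"
  assumes "open S" and hol: "\<And>r. f r holomorphic_on S"
    and bound: "\<And>w. w \<in> S \<Longrightarrow> \<exists>\<delta> C \<rho>. 0 < \<delta> \<and> cball w \<delta> \<subseteq> S \<and> 0 \<le> \<rho> \<and> \<rho> < 1 \<and>
      (\<forall>x\<in>cball w \<delta>. \<forall>r. norm (f r x) \<le> C * \<rho> ^ r)"
  shows "(\<lambda>x. \<Sum>r. f r x) holomorphic_on S"
proof (rule holomorphic_uniform_sequence[OF \<open>open S\<close>, where f = "\<lambda>n x. \<Sum>r<n. f r x"])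
  show "(\<lambda>x. \<Sum>r<n. f r x) holomorphic_on S" for n
    by (intro holomorphic_intros hol)
  fix w assume "w \<in> S"
  then obtain \<delta> C \<rho> where *: "0 < \<delta>" "cball w \<delta> \<subseteq> S" "0 \<le> (\<rho>::real)" "\<rho> < 1"
    "\<And>x r. x \<in> cball w \<delta> \<Longrightarrow> norm (f r x) \<le> C * \<rho> ^ r"
    using bound by metis
  have "uniform_limit (cball w \<delta>) (\<lambda>n x. \<Sum>r<n. f r x) (\<lambda>x. \<Sum>r. f r x) sequentially"
    using * by (intro Weierstrass_m_test[where M = "\<lambda>r. C * \<rho> ^ r"] summable_mult summable_geometric) auto
  with * show "\<exists>d>0. cball w d \<subseteq> S \<and>
      uniform_limit (cball w d) (\<lambda>n x. \<Sum>r<n. f r x) (\<lambda>x. \<Sum>r. f r x) sequentially"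
    by blast
qed

context q_base
begin

text \<open>Reversal of a q-factorial with negative exponents: 1 - y p^(-j) equals -y p^(-j) (1 -
  p^j / y), and the powers p^(-j) for j = 1, ..., r collect to the inverse of
  \<open>tri r\<close>.\<close>

lemma prod_power_quotient:
  assumes "y \<noteq> 0"
  shows "(\<Prod>k<r. 1 - y * p ^ k / p ^ r) = (- y) ^ r / tri r * qpoch (p / y) p r"
proof (induction r)
  case 0
  show ?case by (simp add: tri_0)
next
  case (Suc r)
  have "(\<Prod>k<Suc r. 1 - y * p ^ k / p ^ Suc r) = (1 - y / p ^ Suc r) * (\<Prod>k<r. 1 - y * p ^ k / p ^ r)"
    unfolding prod.lessThan_Suc_shift using p_nz by simp
  also have "1 - y / p ^ Suc r = - y / p ^ Suc r * (1 - p / y * p ^ r)"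
    using assms p_nz by (simp add: field_simps)
  finally show ?case
    unfolding Suc.IH by (simp add: tri_Suc qpoch_Suc mult_ac)
qed

lemma prod_power_quotient_upto:
  assumes "y \<noteq> 0" "r \<le> n"
  shows "(\<Prod>k<n. 1 - y * p ^ k / p ^ r) = (- y) ^ r / tri r * qpoch (p / y) p r * qpoch y p (n - r)"
proof -
  obtain m where n: "n = r + m" using assms le_Suc_ex by blast
  have "(\<Prod>k<r + m. 1 - y * p ^ k / p ^ r) =
      (\<Prod>k<r. 1 - y * p ^ k / p ^ r) * (\<Prod>k<m. 1 - y * p ^ (r + k) / p ^ r)"
    by (induction m) (simp_all add: mult.assoc)
  also have "(\<Prod>k<m. 1 - y * p ^ (r + k) / p ^ r) = qpoch y p m"
    using p_nz by (simp add: qpoch_def power_add)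
  finally show ?thesis unfolding n prod_power_quotient[OF assms(1)] by simp
qed

lemma prod_power_quotient_remove:
  assumes "r \<le> n"
  shows "(\<Prod>k\<in>{..n} - {r}. 1 - p ^ k / p ^ r) = (- 1) ^ r / tri r * qpoch p p r * qpoch p p (n - r)"
proof -
  obtain m where n: "n = r + m" using assms le_Suc_ex by blast
  have "{..n} - {r} = {..<r} \<union> (\<lambda>k. r + Suc k) ` {..<m}"
  proof (intro equalityI subsetI)
    fix k assume "k \<in> {..n} - {r}"
    hence "k < r \<or> k = r + Suc (k - r - 1) \<and> k - r - 1 < m" unfolding n by auto
    thus "k \<in> {..<r} \<union> (\<lambda>k. r + Suc k) ` {..<m}" by blast
  qed (auto simp: n)
  hence "(\<Prod>k\<in>{..n} - {r}. 1 - p ^ k / p ^ r) =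
      (\<Prod>k<r. 1 - p ^ k / p ^ r) * (\<Prod>k\<in>(\<lambda>k. r + Suc k) ` {..<m}. 1 - p ^ k / p ^ r)"
    by (simp only:) (rule prod.union_disjoint, auto)
  also have "(\<Prod>k\<in>(\<lambda>k. r + Suc k) ` {..<m}. 1 - p ^ k / p ^ r) = (\<Prod>k<m. 1 - p ^ (r + Suc k) / p ^ r)"
    by (subst prod.reindex) (auto simp: inj_on_def)
  also have "\<dots> = qpoch p p m"
    using p_nz by (simp add: qpoch_def power_add)
  finally show ?thesis using prod_power_quotient[of 1 r] by (simp add: n)
qed

lemma prod_mult_power_remove:
  assumes "nonres a" "r \<le> n"
  shows "(\<Prod>k\<in>{..n} - {r}. 1 - a * p ^ r * p ^ k) = qpoch (a * p ^ r) p (Suc n) / (1 - a * p ^ (2 * r))"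
proof -
  have "qpoch (a * p ^ r) p (Suc n) = (\<Prod>k\<in>{..n}. 1 - a * p ^ r * p ^ k)"
    by (simp add: qpoch_def lessThan_Suc_atMost)
  also have "\<dots> = (1 - a * p ^ r * p ^ r) * (\<Prod>k\<in>{..n} - {r}. 1 - a * p ^ r * p ^ k)"
    using assms by (intro prod.remove) auto
  also have "a * p ^ r * p ^ r = a * p ^ (2 * r)" by (simp add: mult_2 power_add)
  finally show ?thesis using nonres_neq_1[OF assms(1), of "2 * r"] by simp
qed

text \<open>The reason for the choice of nodes: the denominators of a divided difference over 0,
  ..., n supply the very-well-poised factor \<open>1 - a * p ^ (2 * r)\<close>, the parameter
  \<open>a\<close> and the terminating parameter p^(-n). The identity is stated without
  quotients.\<close>

lemma prod_node_diff:
  assumes "nonres a" "r \<le> n"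
  shows "(\<Prod>k\<in>{..n} - {r}. node a r - node a k) * ((- a) ^ n * tri n * tri r * (- 1) ^ r * (1 - a * p ^ (2 * r))) =
    p ^ r * qpoch p p r * qpoch p p (n - r) * qpoch (a * p ^ r) p (Suc n)"
proof -
  have a: "a \<noteq> 0" using assms by (simp add: nonres_def)
  have a2: "1 - a * p ^ (2 * r) \<noteq> 0" using nonres_neq_1[OF assms(1), of "2 * r"] by simp
  have "(\<Prod>k\<le>n. - a * p ^ k) = (- a * p ^ r) * (\<Prod>k\<in>{..n} - {r}. - a * p ^ k)"
    using assms by (intro prod.remove) auto
  moreover have "(\<Prod>k\<le>n. - a * p ^ k) = (- a) ^ Suc n * tri n"
    by (simp only: prod.distrib tri_def power_sum) simp
  ultimately have "p ^ r * (\<Prod>k\<in>{..n} - {r}. - a * p ^ k) = (- a) ^ n * tri n"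
    using a by simp
  moreover have "(\<Prod>k\<in>{..n} - {r}. - a * p ^ k) * (\<Prod>k\<in>{..n} - {r}. node a r - node a k) =
      (\<Prod>k\<in>{..n} - {r}. 1 - p ^ k / p ^ r) * (\<Prod>k\<in>{..n} - {r}. 1 - a * p ^ r * p ^ k)"
    unfolding prod.distrib[symmetric]
  proof (intro prod.cong refl)
    fix k
    show "- a * p ^ k * (node a r - node a k) = (1 - p ^ k / p ^ r) * (1 - a * p ^ r * p ^ k)"
      unfolding node_diff[OF a] using a p_nz by simp
  qed
  moreover have "(- 1 :: complex) ^ r * (- 1) ^ r = 1" by (simp flip: power_mult_distrib)
  ultimately show ?thesis
    unfolding prod_power_quotient_remove[OF assms(2)] prod_mult_power_remove[OF assms]
  proof -
    fix Q X q1 q2 q3 :: complex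
    define s :: complex where "s = (- 1) ^ r"
    assume *: "p ^ r * Q = (- a) ^ n * tri n"
      "Q * X = (- 1) ^ r / tri r * q1 * q2 * (q3 / (1 - a * p ^ (2 * r)))" "(- 1 :: complex) ^ r * (- 1) ^ r = 1"
    have "X * ((- a) ^ n * tri n * tri r * s * (1 - a * p ^ (2 * r))) =
        p ^ r * (Q * X) * tri r * s * (1 - a * p ^ (2 * r))"
      unfolding *(1)[symmetric] by (simp only: mult_ac)
    also have "\<dots> = p ^ r * q1 * q2 * q3 * (s * s)"
      unfolding *(2) s_def[symmetric] using a2 tri_nz[of r] by simp
    finally show "X * ((- a) ^ n * tri n * tri r * (- 1) ^ r * (1 - a * p ^ (2 * r))) = p ^ r * q1 * q2 * q3"
      using *(3) by (simp add: s_def)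
  qed
qed

text \<open>This is (x;p)_r / (ap/x;p)_r times the infinite product (ap/x;p). Keeping the tail of
  that product instead of a denominator makes each term holomorphic in the nonzero parameters;
  \<open>vwp\<close> treats (a;p)_r / (p;p)_r in the same way.\<close>

definition wp_factor :: "complex \<Rightarrow> complex \<Rightarrow> nat \<Rightarrow> complex"
  where "wp_factor a x r = qpoch x p r * qinf (a * p ^ Suc r / x)"

definition vwp :: "complex \<Rightarrow> nat \<Rightarrow> complex"
  where "vwp a r = (1 - a * p ^ (2 * r)) * (qpoch a p r * qinf (p ^ Suc r))"

definition reg_series_term :: "complex \<Rightarrow> complex \<Rightarrow> complex \<Rightarrow> complex \<Rightarrow> complex \<Rightarrow> complex \<Rightarrow> nat \<Rightarrow> complex"
  where "reg_series_term a b c d e f r = (p ^ 2 * a ^ 2 / (b * c * d * e * f)) ^ r * vwp a r *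
    (wp_factor a b r * wp_factor a c r * wp_factor a d r * wp_factor a e r * wp_factor a f r)"

definition reg_series :: "complex \<Rightarrow> complex \<Rightarrow> complex \<Rightarrow> complex \<Rightarrow> complex \<Rightarrow> complex \<Rightarrow> complex"
  where "reg_series a b c d e f = (\<Sum>r. reg_series_term a b c d e f r)"

text \<open>In this normalization Bailey's two-term transformations are invariances, and \<open>Psi\<close> is
  \<open>norm_series\<close> divided by \<open>(p;p)\<^sub>\<infinity>\<close>.\<close>

definition norm_series :: "complex \<Rightarrow> complex \<Rightarrow> complex \<Rightarrow> complex \<Rightarrow> complex \<Rightarrow> complex \<Rightarrow> complex"
  where "norm_series a b c d e f = qinf (p ^ 2 * a ^ 2 / (b * c * d * e * f)) * reg_series a b c d e f / qinf a"

text \<open>In terms of \<open>w = 1 / f\<close> the series is holomorphic up to \<open>w = 0\<close>.\<close>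

definition reg_series_inv_term :: "complex \<Rightarrow> complex \<Rightarrow> complex \<Rightarrow> complex \<Rightarrow> complex \<Rightarrow> nat \<Rightarrow> complex \<Rightarrow> complex"
  where "reg_series_inv_term a b c d e r w = (p ^ 2 * a ^ 2 / (b * c * d * e)) ^ r * vwp a r *
    (wp_factor a b r * wp_factor a c r * wp_factor a d r * wp_factor a e r) * ((\<Prod>i<r. w - p ^ i) * qinf (a * p ^ Suc r * w))"

definition reg_series_inv :: "complex \<Rightarrow> complex \<Rightarrow> complex \<Rightarrow> complex \<Rightarrow> complex \<Rightarrow> complex \<Rightarrow> complex"
  where "reg_series_inv a b c d e w = (\<Sum>r. reg_series_inv_term a b c d e r w)"

lemma reg_series_inv_eq_reg_series:
  assumes "f \<noteq> 0"
  shows "reg_series_inv a b c d e (1 / f) = reg_series a b c d e f"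
proof -
  have "(\<Prod>i<r. 1 / f - p ^ i) = (1 / f) ^ r * qpoch f p r" for r
  proof -
    have "(\<Prod>i<r. 1 / f - p ^ i) = (\<Prod>i<r. 1 / f * (1 - f * p ^ i))"
      using assms by (intro prod.cong refl) (simp add: field_simps)
    thus ?thesis by (simp only: prod.distrib qpoch_def prod_constant card_lessThan)
  qed
  hence "reg_series_inv_term a b c d e r (1 / f) = reg_series_term a b c d e f r" for r
    by (simp add: reg_series_inv_term_def reg_series_term_def wp_factor_def power_divide power_mult_distrib mult_ac)
  thus ?thesis by (simp add: reg_series_inv_def reg_series_def)
qed

lemma norm_power_le_1: "norm (p ^ r) \<le> 1"
  using p_norm by (simp add: norm_power power_le_one)

lemma norm_mult_power_le: "norm x \<le> K \<Longrightarrow> norm (x * p ^ r) \<le> K"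
proof -
  assume "norm x \<le> K"
  moreover have "norm x * norm (p ^ r) \<le> norm x" by (rule mult_left_le[OF norm_power_le_1]) simp
  ultimately show ?thesis unfolding norm_mult by linarith
qed

lemma wp_factor_bound:
  assumes "norm x \<le> K" "norm (a / x) \<le> K"
  shows "norm (wp_factor a x r) \<le> exp (K / (1 - norm p)) ^ 2"
proof -
  have "norm (a * p ^ Suc r / x) \<le> K"
    using norm_mult_power_le[OF assms(2), of "Suc r"] by simp
  from mult_mono[OF qpoch_norm_le[OF assms(1), of r] qinf_norm_le[OF this]]
  show ?thesis by (simp add: wp_factor_def norm_mult power2_eq_square)
qed

lemma vwp_bound:
  assumes "norm a \<le> K" "1 \<le> K"
  shows "norm (vwp a r) \<le> (1 + K) * exp (K / (1 - norm p)) ^ 2"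
proof -
  have "norm (1 - a * p ^ (2 * r)) \<le> 1 + K"
    using norm_mult_power_le[OF assms(1), of "2 * r"] norm_triangle_ineq4[of 1 "a * p ^ (2 * r)"] by simp
  moreover have "norm (qinf (p ^ Suc r)) \<le> exp (K / (1 - norm p))"
    using norm_power_le_1[of "Suc r"] assms by (intro qinf_norm_le) simp
  ultimately show ?thesis
    using qpoch_norm_le[OF assms(1), of r] assms(2)
    unfolding vwp_def norm_mult power2_eq_square by (intro mult_mono) auto
qed

lemma norm_prod4_le:
  assumes "norm x1 \<le> k" "norm x2 \<le> k" "norm x3 \<le> k" "norm (x4::complex) \<le> k"
  shows "norm (x1 * x2 * x3 * x4) \<le> k * k * k * k"
  using assms order_trans[OF norm_ge_zero assms(1)] unfolding norm_mult by (intro mult_mono) auto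

text \<open>The product of the \<open>w - p ^ i\<close> grows like |w|^r up to a constant, and all
  other factors except the explicit power are bounded in \<open>r\<close>. Hence the terms have a
  geometric majorant inside the disc, uniformly near each of its points.\<close>

lemma reg_series_inv_holomorphic:
  assumes nz: "a \<noteq> 0" "b \<noteq> 0" "c \<noteq> 0" "d \<noteq> 0" "e \<noteq> 0"
    and R: "0 < R" "norm (p ^ 2 * a ^ 2 / (b * c * d * e)) * R \<le> 1"
  shows "reg_series_inv a b c d e holomorphic_on ball 0 R"
  unfolding reg_series_inv_def
proof (rule holomorphic_on_suminf_geometric)
  show "reg_series_inv_term a b c d e r holomorphic_on ball 0 R" for r
    unfolding reg_series_inv_term_def by (intro holomorphic_intros)
  fix w :: complex assume w: "w \<in> ball 0 R"
  define u where "u = p ^ 2 * a ^ 2 / (b * c * d * e)"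
  have u: "norm u > 0" using nz p_nz by (simp add: u_def)
  \<comment> \<open>The disc of radius \<delta> about \<open>w\<close> lies in |x| \<le>
    \<open>R'\<close>, and \<open>R'\<close> < \<open>R\<close> leaves room for a ratio strictly
    below 1.\<close>
  define \<delta> where "\<delta> = (R - norm w) / 2"
  define R' where "R' = (R + norm w) / 2"
  have \<delta>: "\<delta> > 0" and R': "R' > 0" "R' < R" using w R by (auto simp: \<delta>_def R'_def intro: add_pos_nonneg)
  define S where "S = {1, norm a, norm b, norm c, norm d, norm e, norm (a / b), norm (a / c), norm (a / d), norm (a / e), norm a * R'}"
  define K where "K = Max S"
  have K_ge: "x \<le> K" if "x \<in> S" for x
    unfolding K_def by (rule Max_ge[OF _ that]) (simp add: S_def)
  have K: "1 \<le> K" "norm a \<le> K" "norm b \<le> K" "norm c \<le> K" "norm d \<le> K" "norm e \<le> K"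
    "norm (a / b) \<le> K" "norm (a / c) \<le> K" "norm (a / d) \<le> K" "norm (a / e) \<le> K" "norm a * R' \<le> K"
    by (rule K_ge, unfold S_def, blast)+
  define M where "M = exp (K / (1 - norm p))"
  define C where "C = (1 + K) * M ^ 2 * (M ^ 2 * M ^ 2 * M ^ 2 * M ^ 2) * (exp (1 / (R' * (1 - norm p))) * M)"
  have bound: "norm (reg_series_inv_term a b c d e r x) \<le> C * (norm u * R') ^ r" if "x \<in> cball w \<delta>" for x r
  proof -
    have x: "norm x \<le> R'"
    proof -
      have "norm (x - w) \<le> \<delta>" using that by (simp add: dist_norm norm_minus_commute)
      hence "norm x \<le> norm w + \<delta>" using norm_triangle_sub[of x w] by simp
      thus ?thesis by (simp add: \<delta>_def R'_def field_simps)
    qed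
    have 1: "norm (\<Prod>i<r. x - p ^ i) \<le> R' ^ r * exp (1 / (R' * (1 - norm p)))"
    proof -
      have "norm (\<Prod>i<r. x - p ^ i) \<le> (\<Prod>i<r. R' + 1 * norm p ^ i)"
        unfolding prod_norm[symmetric]
      proof (intro prod_mono conjI)
        show "norm (x - p ^ i) \<le> R' + 1 * norm p ^ i" for i
          using norm_triangle_ineq4[of x "p ^ i"] x by (simp add: norm_power)
      qed auto
      also have "\<dots> \<le> R' ^ r * exp (1 / (R' * (1 - norm p)))"
        using norm_factor_bound[of 1 R' r] R' by simp
      finally show ?thesis .
    qed
    have "norm (a * x) \<le> K"
      using K(11) mult_left_mono[OF x, of "norm a"] by (simp add: norm_mult)
    from norm_mult_power_le[OF this, of "Suc r"]
    have 2: "norm (qinf (a * p ^ Suc r * x)) \<le> M"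
      unfolding M_def by (intro qinf_norm_le) (simp add: mult_ac)
    have 3: "norm (wp_factor a b r * wp_factor a c r * wp_factor a d r * wp_factor a e r) \<le> M ^ 2 * M ^ 2 * M ^ 2 * M ^ 2"
      using K unfolding M_def by (intro norm_prod4_le wp_factor_bound) auto
    have 4: "norm (vwp a r) \<le> (1 + K) * M ^ 2"
      using vwp_bound[OF K(2,1)] by (simp add: M_def)
    have "norm (reg_series_inv_term a b c d e r x) = norm u ^ r * norm (vwp a r) *
        norm (wp_factor a b r * wp_factor a c r * wp_factor a d r * wp_factor a e r) * (norm (\<Prod>i<r. x - p ^ i) * norm (qinf (a * p ^ Suc r * x)))"
      unfolding reg_series_inv_term_def u_def[symmetric] by (simp only: norm_mult norm_power)
    also have "\<dots> \<le> norm u ^ r * ((1 + K) * M ^ 2) * (M ^ 2 * M ^ 2 * M ^ 2 * M ^ 2) *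
        ((R' ^ r * exp (1 / (R' * (1 - norm p)))) * M)"
      using 1 2 3 4 K(1) R' by (intro mult_mono) (auto simp: M_def)
    also have "\<dots> = C * (norm u * R') ^ r"
      by (simp add: C_def power_mult_distrib mult_ac)
    finally show ?thesis .
  qed
  have "norm u * R' < 1"
    using R(2) mult_strict_left_mono[OF R'(2) u] by (simp add: u_def)
  moreover have "cball w \<delta> \<subseteq> ball 0 R"
  proof
    fix x assume "x \<in> cball w \<delta>"
    hence "norm (x - w) \<le> \<delta>" by (simp add: dist_norm norm_minus_commute)
    hence "norm x \<le> norm w + \<delta>" using norm_triangle_sub[of x w] by simp
    thus "x \<in> ball 0 R" using w by (simp add: \<delta>_def field_simps)
  qed
  ultimately show "\<exists>\<delta> C \<rho>. 0 < \<delta> \<and> cball w \<delta> \<subseteq> ball 0 R \<and> 0 \<le> \<rho> \<and> \<rho> < 1 \<and>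
      (\<forall>x\<in>cball w \<delta>. \<forall>r. norm (reg_series_inv_term a b c d e r x) \<le> C * \<rho> ^ r)"
    using bound \<delta> R' u by (intro exI[of _ \<delta>] exI[of _ C] exI[of _ "norm u * R'"]) auto
qed auto

text \<open>The usual rewriting of (p^(-n);p)_r as (p;p)_n / (p;p)_(n-r), up to sign and powers of
  \<open>p\<close>, in the form in which it arises at \<open>w = p ^ n\<close>.\<close>

lemma prod_power_diff:
  assumes "r \<le> n"
  shows "p ^ r * (\<Prod>i<r. p ^ n - p ^ i) * qpoch p p (n - r) = (- 1) ^ r * tri r * qpoch p p n"
  using assms
proof (induction r)
  case 0
  show ?case by (simp add: tri_0)
next
  case (Suc r)
  then obtain m where n: "n = Suc (r + m)" using le_Suc_ex[of "Suc r" n] by auto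
  have *: "qpoch p p (n - r) = qpoch p p (n - Suc r) * (1 - p ^ (n - r))"
    by (simp add: n qpoch_Suc)
  have "p ^ Suc r * (\<Prod>i<Suc r. p ^ n - p ^ i) * qpoch p p (n - Suc r) =
      - (p ^ Suc r) * (p ^ r * (\<Prod>i<r. p ^ n - p ^ i) * qpoch p p (n - r))"
    unfolding * by (simp add: n power_add algebra_simps)
  also have "\<dots> = (- 1) ^ Suc r * tri (Suc r) * qpoch p p n"
    using Suc by (simp add: tri_Suc)
  finally show ?case .
qed

text \<open>The point \<open>w = p ^ n\<close> means f = p^(-n). The series stops at
  \<open>n\<close> and, by \<open>prod_node_diff\<close>, is a divided difference of two pairs;
  \<open>ddiff_two_pairs\<close> turns it into the sum on the right, a balanced 4phi3.\<close>

lemma reg_series_inv_power: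
  assumes g: "nonres a" "nonres (a / b)" "nonres (a / c)" "nonres (a / d)" "nonres (a / e)"
  shows "reg_series_inv a b c d e (p ^ n) = qinf a * qinf p * qpoch p p n *
    (qinf (a * p / b) * qinf (a * p / c) * qinf (a * p / d * p ^ n) * qinf (a * p / e * p ^ n)) *
    (\<Sum>k\<le>n. qpoch (a * p / (b * c)) p k * qpoch d p k * qpoch e p k * (a * p / (d * e)) ^ k *
       qpoch (a * p / (d * e)) p (n - k) /
       (qpoch p p k * qpoch p p (n - k) * qpoch (a * p / b) p k * qpoch (a * p / c) p k))"
    (is "_ = ?A * ?B * ?\<Sigma>")
proof -
  have nz: "a \<noteq> 0" "b \<noteq> 0" "c \<noteq> 0" "d \<noteq> 0" "e \<noteq> 0" using g by (auto simp: nonres_def)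
  let ?g = "\<lambda>r. vwp_pair a b c r * vwp_pair a d e r"
  define C where "C = qinf a * qinf p * qpoch p p n * (qinf (a * p / b) * qinf (a * p / c) * qinf (a * p / d) * qinf (a * p / e))"
  have wp_factor: "wp_factor a x r = qinf (a * p / x) * (qpoch x p r / qpoch (a * p / x) p r)" if "nonres (a / x)" for x r
    using qinf_split[of "a * p / x" r] nonres_qpoch[OF nonres_mult[OF that], of r] by (simp add: wp_factor_def mult_ac)
  have summand: "reg_series_inv_term a b c d e r (p ^ n) * ((- a) ^ n * tri n) =
      C * (?g r / (\<Prod>k\<in>{..n} - {r}. node a r - node a k))" if "r \<le> n" for r
  proof -
    have a2: "1 - a * p ^ (2 * r) \<noteq> 0" using nonres_neq_1[OF g(1), of "2 * r"] by simp
    have q1: "qinf p = qpoch p p r * qinf (p ^ Suc r)" using qinf_split[of p r] by simp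
    have q2: "qinf a = qpoch a p r * qpoch (a * p ^ r) p (Suc n) * qinf (a * p ^ Suc r * p ^ n)"
      using qinf_split[of a r] qinf_split[of "a * p ^ r" "Suc n"] by (simp add: mult_ac)
    have q3: "qpoch (a * p ^ r) p (Suc n) \<noteq> 0" using nonres_qpoch[OF nonres_mult_power[OF g(1)]] .
    have q4: "(- 1 :: complex) ^ r * (- 1) ^ r = 1" by (simp flip: power_mult_distrib)
    define PP where "PP = (\<Prod>k\<in>{..n} - {r}. node a r - node a k)"
    have PP: "PP * ((- a) ^ n * tri n * tri r * (- 1) ^ r * (1 - a * p ^ (2 * r))) =
      p ^ r * qpoch p p r * qpoch p p (n - r) * qpoch (a * p ^ r) p (Suc n)"
      unfolding PP_def by (rule prod_node_diff[OF g(1) that])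
    have PP0: "PP \<noteq> 0" using inj_node[OF g(1)] by (auto simp: PP_def dest: injD)
    \<comment> \<open>The factors free of \<open>b\<close>, \<open>c\<close>, \<open>d\<close>,
      \<open>e\<close>. Nonzero products are multiplied in so that \<open>PP\<close>,
      \<open>prod_power_diff\<close> and the splittings \<open>q1\<close> and \<open>q2\<close>
      apply without quotients; they are cancelled in \<open>W\<close>.\<close>
    have "vwp a r * ((\<Prod>i<r. p ^ n - p ^ i) * qinf (a * p ^ Suc r * p ^ n)) * ((- a) ^ n * tri n) * PP *
        (p ^ r * qpoch p p (n - r)) * (tri r * (- 1) ^ r) * qpoch p p r * qpoch (a * p ^ r) p (Suc n) =
      (PP * ((- a) ^ n * tri n * tri r * (- 1) ^ r * (1 - a * p ^ (2 * r)))) *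
        (p ^ r * (\<Prod>i<r. p ^ n - p ^ i) * qpoch p p (n - r)) *
        (qpoch p p r * qinf (p ^ Suc r)) * (qpoch a p r * qpoch (a * p ^ r) p (Suc n) * qinf (a * p ^ Suc r * p ^ n))"
      unfolding vwp_def by (simp only: mult_ac)
    also have "\<dots> = (p ^ r * qpoch p p r * qpoch p p (n - r) * qpoch (a * p ^ r) p (Suc n)) *
        ((- 1) ^ r * tri r * qpoch p p n) * qinf p * qinf a"
      unfolding PP prod_power_diff[OF that] q1[symmetric] q2[symmetric] ..
    finally have W: "vwp a r * ((\<Prod>i<r. p ^ n - p ^ i) * qinf (a * p ^ Suc r * p ^ n)) * ((- a) ^ n * tri n) * PP =
        qpoch p p n * qinf p * qinf a"
      using tri_nz[of r] q3 qpoch_p_nz p_nz by (simp add: mult_ac)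
    have pw: "(p ^ 2 * a ^ 2 / (b * c * d * e)) ^ r = (a * p / (b * c)) ^ r * (a * p / (d * e)) ^ r"
      by (simp add: power_mult_distrib[symmetric] power2_eq_square mult_ac)
    have "reg_series_inv_term a b c d e r (p ^ n) * ((- a) ^ n * tri n) * PP =
       (p ^ 2 * a ^ 2 / (b * c * d * e)) ^ r * (wp_factor a b r * wp_factor a c r * wp_factor a d r * wp_factor a e r) *
       (vwp a r * ((\<Prod>i<r. p ^ n - p ^ i) * qinf (a * p ^ Suc r * p ^ n)) * ((- a) ^ n * tri n) * PP)"
      unfolding reg_series_inv_term_def by (simp only: mult_ac)
    also have "\<dots> = C * ?g r"
      unfolding W wp_factor[OF g(2)] wp_factor[OF g(3)] wp_factor[OF g(4)] wp_factor[OF g(5)] pw C_def vwp_pair_def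
      by (simp add: mult_ac)
    finally show ?thesis using PP0 by (simp add: PP_def field_simps)
  qed
  have zero: "reg_series_inv_term a b c d e r (p ^ n) = 0" if "r \<notin> {..n}" for r
  proof -
    have "(\<Prod>i<r. p ^ n - p ^ i) = 0" using that by (auto intro: bexI[of _ n])
    thus ?thesis by (simp add: reg_series_inv_term_def)
  qed
  have "reg_series_inv a b c d e (p ^ n) * ((- a) ^ n * tri n) = (\<Sum>r\<le>n. reg_series_inv_term a b c d e r (p ^ n) * ((- a) ^ n * tri n))"
    unfolding reg_series_inv_def using zero by (subst suminf_finite[of "{..n}"]) (auto simp: sum_distrib_right)
  also have "\<dots> = C * ddiff (node a) ?g {0..n}"
    unfolding ddiff_def sum_distrib_left atLeast0AtMost using summand by (intro sum.cong) auto
  finally have VC: "reg_series_inv a b c d e (p ^ n) * ((- a) ^ n * tri n) = C * ddiff (node a) ?g {0..n}" .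
  have sp: "qinf (a * p / x) = qpoch (a * p / x) p n * qinf (a * p / x * p ^ n)" for x
    by (rule qinf_split)
  have "reg_series_inv a b c d e (p ^ n) * ((- a) ^ n * tri n) =
     ?A * ?B * (ddiff (node a) ?g {0..n} * (qpoch (a * p / d) p n * qpoch (a * p / e) p n))"
    unfolding VC C_def sp[of d] sp[of e] by (simp only: mult_ac)
  also have "\<dots> = ?A * ?B * ?\<Sigma> * ((- a) ^ n * tri n)"
    unfolding ddiff_two_pairs[OF g] by (simp only: mult_ac)
  finally show ?thesis using nz tri_nz[of n] by simp
qed

text \<open>Ismail's argument: both sides are holomorphic in \<open>w = 1 / f\<close>, and they agree at the points
  \<open>w = p\<^sup>n\<close>, where the series terminate and which accumulate at \<open>0\<close>.\<close>

lemma reg_series_inv_transformation: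
  fixes a b c d e w :: complex
  defines "l \<equiv> p * a ^ 2 / (b * c * d)"
  assumes g: "nonres a" "nonres l" "nonres (a / b)" "nonres (a / c)" "nonres (a / d)" "nonres (a / e)" "nonres (l / e)"
    and w: "norm (l * p / e * w) < 1" "norm (a * p / e * w) < 1"
  shows "qinf l * qinf (l * p / e * w) * reg_series_inv a b c d e w =
    qinf a * qinf (a * p / e * w) * reg_series_inv l (l * b / a) (l * c / a) (l * d / a) e w"
proof -
  have nz: "a \<noteq> 0" "b \<noteq> 0" "c \<noteq> 0" "d \<noteq> 0" "e \<noteq> 0" "l \<noteq> 0" using g by (auto simp: nonres_def)
  \<comment> \<open>The two series in \<open>w\<close> have the ratios \<open>l * p / e\<close> and
    \<open>a * p / e\<close>, identified in \<open>u\<close> and \<open>u'\<close>; \<open>R\<close>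
    is the smaller of the two radii.\<close>
  define m where "m = max (norm (l * p / e)) (norm (a * p / e))"
  have m: "m > 0" using nz p_nz by (simp add: m_def less_max_iff_disj)
  define R where "R = 1 / m"
  have R: "R > 0" using m by (simp add: R_def)
  have "norm w * m < 1"
  proof -
    have "norm w * norm y < 1" if "norm (y * w) < 1" for y
      using that by (simp only: norm_mult mult.commute)
    from this[OF w(1)] this[OF w(2)] show ?thesis unfolding m_def max_def by simp
  qed
  hence wR: "w \<in> ball 0 R" using m by (simp add: R_def field_simps)
  have u: "p ^ 2 * a ^ 2 / (b * c * d * e) = l * p / e"
    using nz by (simp add: l_def power2_eq_square)
  have u': "p ^ 2 * l ^ 2 / ((l * b / a) * (l * c / a) * (l * d / a) * e) = a * p / e"
  proof -
    have "l * (b * c * d) = p * a ^ 2" using nz by (simp add: l_def)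
    hence "a ^ 2 * p ^ 2 / (l * (b * c * d) * e) = p / e" using nz p_nz by (simp add: power2_eq_square)
    thus ?thesis using nz by (simp add: field_simps power2_eq_square)
  qed
  let ?D = "\<lambda>w. qinf l * qinf (l * p / e * w) * reg_series_inv a b c d e w -
    qinf a * qinf (a * p / e * w) * reg_series_inv l (l * b / a) (l * c / a) (l * d / a) e w"
  have "?D w = 0"
  proof (rule analytic_continuation[of ?D "ball 0 R" "{p ^ n |n. p ^ n \<in> ball 0 R}" 0])
    have "norm (l * p / e) * R \<le> 1" "norm (a * p / e) * R \<le> 1"
      using m by (simp_all add: R_def field_simps m_def max_def)
    hence "reg_series_inv a b c d e holomorphic_on ball 0 R" "reg_series_inv l (l * b / a) (l * c / a) (l * d / a) e holomorphic_on ball 0 R"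
      using nz R reg_series_inv_holomorphic[of a b c d e R, unfolded u]
        reg_series_inv_holomorphic[of l "l * b / a" "l * c / a" "l * d / a" e R, unfolded u'] by simp_all
    thus "?D holomorphic_on ball 0 R" by (intro holomorphic_intros)
    have lim: "(\<lambda>n. p ^ n) \<longlonglongrightarrow> 0" using p_norm by (intro LIMSEQ_power_zero)
    then obtain n0 where n0: "\<And>n. n \<ge> n0 \<Longrightarrow> p ^ n \<in> ball 0 R"
      using R by (metis (no_types, lifting) LIMSEQ_D diff_zero mem_ball_0)
    show "0 islimpt {p ^ n |n. p ^ n \<in> ball 0 R}"
      unfolding islimpt_sequential
    proof (intro exI conjI allI)
      show "p ^ (n + n0) \<in> {p ^ n |n. p ^ n \<in> ball 0 R} - {0}" for n
        using n0[of "n + n0"] p_nz by auto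
      show "(\<lambda>n. p ^ (n + n0)) \<longlonglongrightarrow> 0" using LIMSEQ_ignore_initial_segment[OF lim] .
    qed
    fix z assume "z \<in> {p ^ n |n. p ^ n \<in> ball 0 R}"
    then obtain n where z: "z = p ^ n" by blast
    have r: "l / (l * x / a) = a / x" "l * p / (l * x / a) = a * p / x" for x using nz by simp_all
    \<comment> \<open>Passing from \<open>a\<close> to \<open>l\<close> exchanges \<open>d\<close>
      with \<open>a * p / (b * c)\<close> and preserves \<open>e\<close>,
      \<open>a * p / (d * e)\<close>, \<open>a * p / b\<close> and \<open>a * p / c\<close>. The
      balanced sum of \<open>reg_series_inv_power\<close> is symmetric under this exchange, so both
      sides contain the same sum.\<close>
    have r2: "l * p / (l * b / a * (l * c / a)) = d" "l * p / (l * d / a * e) = a * p / (d * e)"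
      "l * d / a = a * p / (b * c)"
      using nz p_nz by (simp_all add: l_def power2_eq_square)
    have g': "nonres (l / (l * x / a))" if "nonres (a / x)" for x using that unfolding r .
    show "?D z = 0"
      unfolding z reg_series_inv_power[OF g(1,3,4,5,6)] reg_series_inv_power[OF g(2) g'[OF g(3)] g'[OF g(4)] g'[OF g(5)] g(7)]
      by (simp only: r r2(1,2), simp only: r2(3)) (simp add: mult_ac)
  qed (use R wR in auto)
  thus ?thesis by simp
qed

lemma norm_series_transformation_nondegenerate:
  fixes a b c d e f :: complex
  defines "l \<equiv> p * a ^ 2 / (b * c * d)"
  assumes g: "nonres a" "nonres l" "nonres (a / b)" "nonres (a / c)" "nonres (a / d)" "nonres (a / e)" "nonres (l / e)" and "f \<noteq> 0"
    and u: "norm (p ^ 2 * a ^ 2 / (b * c * d * e * f)) < 1" "norm (a * p / (e * f)) < 1"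
  shows "norm_series a b c d e f = norm_series l (l * b / a) (l * c / a) (l * d / a) e f"
proof -
  have nz: "a \<noteq> 0" "b \<noteq> 0" "c \<noteq> 0" "d \<noteq> 0" "e \<noteq> 0" "l \<noteq> 0" using g by (auto simp: nonres_def)
  have u1: "p ^ 2 * a ^ 2 / (b * c * d * e * f) = l * p / e * (1 / f)"
    using nz by (simp add: l_def power2_eq_square)
  have u2: "p ^ 2 * l ^ 2 / ((l * b / a) * (l * c / a) * (l * d / a) * e * f) = a * p / e * (1 / f)"
  proof -
    have "l * (b * c * d) = p * a ^ 2" using nz by (simp add: l_def)
    hence "a ^ 2 * p ^ 2 / (l * (b * c * d) * e * f) = p / e / f" using nz p_nz by (simp add: power2_eq_square)
    thus ?thesis using nz \<open>f \<noteq> 0\<close> by (simp add: field_simps power2_eq_square)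
  qed
  have "qinf l * qinf (l * p / e * (1 / f)) * reg_series_inv a b c d e (1 / f) =
    qinf a * qinf (a * p / e * (1 / f)) * reg_series_inv l (l * b / a) (l * c / a) (l * d / a) e (1 / f)"
    unfolding l_def by (rule reg_series_inv_transformation) (use g u u1 in \<open>auto simp: l_def\<close>)
  thus ?thesis
    unfolding norm_series_def u1 u2 reg_series_inv_eq_reg_series[OF \<open>f \<noteq> 0\<close>] using nonres_qinf[OF g(1)] nonres_qinf[OF g(2)]
    by (simp add: field_simps)
qed


lemma norm_series_permute:
  "norm_series a b c d e f = norm_series a b e f c d" "norm_series a b c d e f = norm_series a b f e d c"
  by (simp_all add: norm_series_def reg_series_def reg_series_term_def mult_ac)

lemma reg_series_term_bound:
  assumes "1 \<le> K" "\<And>x. x \<in> {a, b, c, d, e, f, a / b, a / c, a / d, a / e, a / f} \<Longrightarrow> norm x \<le> K"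
  shows "norm (reg_series_term a b c d e f r) \<le> (1 + K) * exp (K / (1 - norm p)) ^ 2 * (exp (K / (1 - norm p)) ^ 2) ^ 5 *
    norm (p ^ 2 * a ^ 2 / (b * c * d * e * f)) ^ r"
proof -
  define M where "M = exp (K / (1 - norm p))"
  have "norm (wp_factor a b r * wp_factor a c r * wp_factor a d r * wp_factor a e r) * norm (wp_factor a f r) \<le> (M ^ 2 * M ^ 2 * M ^ 2 * M ^ 2) * M ^ 2"
    unfolding M_def by (intro mult_mono norm_prod4_le wp_factor_bound assms(2)) auto
  hence "norm (wp_factor a b r * wp_factor a c r * wp_factor a d r * wp_factor a e r * wp_factor a f r) \<le> (M ^ 2) ^ 5"
    by (simp add: norm_mult eval_nat_numeral mult_ac)
  moreover have "norm (vwp a r) \<le> (1 + K) * M ^ 2"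
    unfolding M_def by (intro vwp_bound assms) auto
  ultimately have "norm (vwp a r) * norm (wp_factor a b r * wp_factor a c r * wp_factor a d r * wp_factor a e r * wp_factor a f r) \<le>
      (1 + K) * M ^ 2 * (M ^ 2) ^ 5"
    using assms(1) by (intro mult_mono) (auto simp: M_def)
  from mult_left_mono[OF this, of "norm (p ^ 2 * a ^ 2 / (b * c * d * e * f)) ^ r"]
  show ?thesis
    unfolding M_def[symmetric] reg_series_term_def by (simp only: norm_mult norm_power mult_ac zero_le_power norm_ge_zero)
qed

lemma reg_series_term_summable:
  assumes "norm (p ^ 2 * a ^ 2 / (b * c * d * e * f)) < 1"
  shows "summable (reg_series_term a b c d e f)"
proof -
  define S where "S = {a, b, c, d, e, f, a / b, a / c, a / d, a / e, a / f}"
  have "finite (norm ` S)" by (simp add: S_def)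
  define K where "K = max 1 (Max (norm ` S))"
  have K: "1 \<le> K" by (simp add: K_def)
  have K': "norm x \<le> K" if "x \<in> S" for x
  proof -
    have "norm x \<le> Max (norm ` S)" by (rule Max_ge[OF \<open>finite (norm ` S)\<close> imageI[OF that]])
    thus ?thesis unfolding K_def by linarith
  qed
  define C where "C = (1 + K) * exp (K / (1 - norm p)) ^ 2 * (exp (K / (1 - norm p)) ^ 2) ^ 5"
  have "norm (reg_series_term a b c d e f r) \<le> C * norm (p ^ 2 * a ^ 2 / (b * c * d * e * f)) ^ r" for r
    unfolding C_def
  proof (rule reg_series_term_bound)
    show "1 \<le> K" by (rule K)
  next
    fix x assume "x \<in> {a, b, c, d, e, f, a / b, a / c, a / d, a / e, a / f}"
    hence "x \<in> S" unfolding S_def .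
    thus "norm x \<le> K" by (rule K')
  qed
  moreover have "summable (\<lambda>r. C * norm (p ^ 2 * a ^ 2 / (b * c * d * e * f)) ^ r)"
    by (intro summable_mult summable_geometric) (use assms in \<open>simp only: real_norm_def abs_norm_cancel\<close>)
  ultimately show ?thesis
    by (rule summable_comparison_test'[where N = 0, rotated])
qed

text \<open>The ratio of the geometric majorant is the argument of the series; it must stay away
  from 1 while the parameters move, hence the uniform \<rho>. Everything else is bounded on small
  closed discs by continuity.\<close>

lemma reg_series_holomorphic:
  assumes S: "open S"
    and hol: "A holomorphic_on S" "B holomorphic_on S" "C holomorphic_on S" "D holomorphic_on S"
      "E holomorphic_on S" "F holomorphic_on S"
    and nz: "\<And>t. t \<in> S \<Longrightarrow> B t \<noteq> 0 \<and> C t \<noteq> 0 \<and> D t \<noteq> 0 \<and> E t \<noteq> 0 \<and> F t \<noteq> 0"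
    and \<rho>: "\<And>t. t \<in> S \<Longrightarrow> norm (p ^ 2 * A t ^ 2 / (B t * C t * D t * E t * F t)) \<le> \<rho>" "\<rho> < 1"
  shows "(\<lambda>t. reg_series (A t) (B t) (C t) (D t) (E t) (F t)) holomorphic_on S"
  unfolding reg_series_def
proof (rule holomorphic_on_suminf_geometric[OF S])
  show "(\<lambda>t. reg_series_term (A t) (B t) (C t) (D t) (E t) (F t) r) holomorphic_on S" for r
    unfolding reg_series_term_def vwp_def wp_factor_def qpoch_def
    by (intro holomorphic_intros hol) (use nz in auto)
  fix w assume w: "w \<in> S"
  then obtain \<delta> where \<delta>: "\<delta> > 0" "cball w \<delta> \<subseteq> S" using S open_contains_cball by blast
  \<comment> \<open>One continuous function dominating 1, all parameters and all quotients; its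
    bound on the compact disc is the single constant required by
    \<open>reg_series_term_bound\<close>.\<close>
  define h where "h t = (1::real) + (norm (A t) + norm (B t) + norm (C t) + norm (D t) + norm (E t) + norm (F t) +
     norm (A t / B t) + norm (A t / C t) + norm (A t / D t) + norm (A t / E t) + norm (A t / F t))" for t
  have "continuous_on (cball w \<delta>) h"
    unfolding h_def
    by (intro continuous_intros continuous_on_subset[OF holomorphic_on_imp_continuous_on \<delta>(2)] hol) (use nz \<delta>(2) in auto)
  hence "bounded (h ` cball w \<delta>)"
    by (intro compact_imp_bounded compact_continuous_image compact_cball)
  then obtain K where K: "\<And>t. t \<in> cball w \<delta> \<Longrightarrow> norm (h t) \<le> K"
    unfolding bounded_iff by blast
  define M where "M = (1 + K) * exp (K / (1 - norm p)) ^ 2 * (exp (K / (1 - norm p)) ^ 2) ^ 5"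
  have bound: "norm (reg_series_term (A t) (B t) (C t) (D t) (E t) (F t) r) \<le> M * \<rho> ^ r" if t: "t \<in> cball w \<delta>" for t r
  proof -
    have hK: "h t \<le> K" using K[OF t] by (simp add: h_def)
    define n1 n2 n3 n4 n5 n6 n7 n8 n9 n10 n11 where "n1 = norm (A t)" "n2 = norm (B t)" "n3 = norm (C t)" "n4 = norm (D t)" "n5 = norm (E t)" "n6 = norm (F t)"
      "n7 = norm (A t / B t)" "n8 = norm (A t / C t)" "n9 = norm (A t / D t)" "n10 = norm (A t / E t)" "n11 = norm (A t / F t)"
    note ns = this
    have pos: "n1 \<ge> 0" "n2 \<ge> 0" "n3 \<ge> 0" "n4 \<ge> 0" "n5 \<ge> 0" "n6 \<ge> 0" "n7 \<ge> 0" "n8 \<ge> 0" "n9 \<ge> 0" "n10 \<ge> 0" "n11 \<ge> 0"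
      unfolding ns by (rule norm_ge_zero)+
    have sum: "1 + (n1 + n2 + n3 + n4 + n5 + n6 + n7 + n8 + n9 + n10 + n11) \<le> K"
      using hK unfolding h_def ns .
    have K1: "1 \<le> K" using pos sum by linarith
    have "n1 \<le> K" "n2 \<le> K" "n3 \<le> K" "n4 \<le> K" "n5 \<le> K" "n6 \<le> K" "n7 \<le> K" "n8 \<le> K" "n9 \<le> K" "n10 \<le> K" "n11 \<le> K"
      using pos sum by linarith+
    hence KS: "norm x \<le> K" if "x \<in> {A t, B t, C t, D t, E t, F t, A t / B t, A t / C t, A t / D t, A t / E t, A t / F t}" for x
      using that unfolding ns by blast
    have "norm (reg_series_term (A t) (B t) (C t) (D t) (E t) (F t) r) \<le>
        M * norm (p ^ 2 * A t ^ 2 / (B t * C t * D t * E t * F t)) ^ r"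
      unfolding M_def by (rule reg_series_term_bound[OF K1 KS])
    also have "\<dots> \<le> M * \<rho> ^ r"
      using \<rho>(1)[of t] t \<delta>(2) K1 by (intro mult_left_mono power_mono) (auto simp: M_def)
    finally show ?thesis .
  qed
  have "0 \<le> \<rho>" using \<rho>(1)[OF w] norm_ge_zero order_trans by blast
  thus "\<exists>\<delta> C' \<rho>. 0 < \<delta> \<and> cball w \<delta> \<subseteq> S \<and> 0 \<le> \<rho> \<and> \<rho> < 1 \<and>
      (\<forall>t\<in>cball w \<delta>. \<forall>r. norm (reg_series_term (A t) (B t) (C t) (D t) (E t) (F t) r) \<le> C' * \<rho> ^ r)"
    using bound \<delta> \<rho>(2) by blast
qed

section \<open>Removing nondegeneracy conditions by perturbation\<close>

lemma theta1_nz_imp_nonres: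
  assumes "x \<noteq> 0" "theta1 x \<noteq> 0"
  shows "nonres x"
  unfolding nonres_def
proof (intro conjI allI notI)
  fix k :: int assume x: "x = p powi k"
  show False
  proof (cases "k \<le> 0")
    case True
    hence "x * p ^ nat (- k) = 1" using x p_nz by (simp add: power_int_def power_inverse)
    hence "qinf x = 0" by (auto simp: qinf_eq_0_iff)
    with assms show False by (simp add: theta1_def)
  next
    case False
    define m where "m = nat (k - 1)"
    have "nat k = Suc m" using False by (simp add: m_def Suc_nat_eq_nat_zadd1)
    hence "x = p ^ Suc m" using False x by (simp add: power_int_def)
    hence "p / x * p ^ m = 1" using p_nz by simp
    hence "qinf (p / x) = 0" unfolding qinf_eq_0_iff by blast
    with assms show False by (simp add: theta1_def)
  qed
qed (use assms in simp)

lemma theta1_holomorphic [holomorphic_intros]: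
  assumes "f holomorphic_on A" "\<And>x. x \<in> A \<Longrightarrow> f x \<noteq> 0"
  shows "(\<lambda>x. theta1 (f x)) holomorphic_on A"
  unfolding theta1_def using assms by (intro holomorphic_intros) auto

text \<open>The nonzero points failing \<open>nonres\<close> are zeros of \<open>theta1\<close>,
  which is holomorphic on the connected punctured plane and not identically zero; its zeros are
  therefore isolated.\<close>

lemma eventually_nonres_at:
  assumes "y \<noteq> 0"
  shows "\<forall>\<^sub>F x in at y. nonres x"
proof (cases "theta1 y = 0")
  case False
  have "isCont theta1 y"
  proof -
    have "theta1 holomorphic_on - {0}" by (rule theta1_holomorphic) auto
    hence "continuous_on (- {0}) theta1" by (rule holomorphic_on_imp_continuous_on)
    thus ?thesis using assms by (simp add: continuous_on_eq_continuous_at open_Compl)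
  qed
  hence "\<forall>\<^sub>F x in at y. theta1 x \<noteq> 0" using False by (simp add: isCont_def tendsto_imp_eventually_ne)
  moreover have "\<forall>\<^sub>F x in at y. x \<noteq> 0" using assms by (intro tendsto_imp_eventually_ne[OF tendsto_ident_at])
  ultimately show ?thesis by eventually_elim (rule theta1_nz_imp_nonres)
next
  case True
  \<comment> \<open>The witness against vanishing identically is -1: a zero there would need -p^i =
    1, which fails in modulus for positive i and in sign for i = 0.\<close>
  have "norm (p ^ Suc i) < 1" for i
    using p_norm norm_mult_power_le[OF order_refl, of p i] by simp
  hence pow: "- (p ^ Suc i) \<noteq> 1" for i by (metis norm_minus_cancel norm_one less_irrefl)
  have "- 1 * p ^ i \<noteq> 1" for i using pow[of "i - 1"] by (cases i) auto
  moreover have "- p * p ^ i \<noteq> 1" for i using pow[of i] by simp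
  ultimately have "theta1 (- 1) \<noteq> 0" by (simp add: theta1_def qinf_eq_0_iff)
  have "\<exists>r>0. ball y r \<subseteq> - {0} \<and> (\<forall>z\<in>ball y r - {y}. theta1 z \<noteq> 0)"
    by (rule isolated_zeros[of theta1 "- {0}" y "- 1"])
      (use True assms \<open>theta1 (- 1) \<noteq> 0\<close> connected_punctured_universe[of "0 :: complex"] in
        \<open>auto intro!: theta1_holomorphic holomorphic_on_ident simp: open_Compl\<close>)
  then obtain r where r: "r > 0" "ball y r \<subseteq> - {0}" "\<And>z. z \<in> ball y r - {y} \<Longrightarrow> theta1 z \<noteq> 0" by blast
  hence "nonres x" if "x \<noteq> y" "dist x y < r" for x
    using that by (intro theta1_nz_imp_nonres) (auto simp: dist_commute)
  thus ?thesis using r(1) unfolding eventually_at by blast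
qed

lemma eventually_nonres:
  assumes "y \<noteq> 0" "k \<noteq> (0::nat)"
  shows "\<forall>\<^sub>F t in at 1. nonres (y * t ^ k)"
proof -
  have lim: "((\<lambda>t. y * t ^ k) \<longlongrightarrow> y * 1 ^ k) (at (1::complex))" by (intro tendsto_intros)
  have "\<forall>\<^sub>F t in at (1::complex). t ^ k \<noteq> 1"
  proof -
    have "finite {t::complex. t ^ k = 1}" using assms(2) by (intro finite_roots_unity) auto
    hence "\<not> 1 islimpt {t::complex. t ^ k = 1}" by (rule islimpt_finite)
    thus ?thesis by (simp add: islimpt_iff_eventually)
  qed
  hence "\<forall>\<^sub>F t in at 1. y * t ^ k \<noteq> y" using assms(1) by (simp add: mult_cancel_left1)
  hence "filterlim (\<lambda>t. y * t ^ k) (at y) (at 1)" using lim by (simp add: filterlim_at)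
  from eventually_compose_filterlim[OF eventually_nonres_at[OF assms(1)] this] show ?thesis .
qed

text \<open>The nondegeneracy of \<open>a / b\<close> and its kin is removed by moving \<open>(b, c, d, e)\<close> to
  \<open>(b t, c t, d / t\<^sup>2, e t)\<close>, which fixes \<open>l\<close>, and letting \<open>t\<close> tend to \<open>1\<close>.\<close>

lemma norm_series_transformation:
  fixes a b c d e f :: complex
  defines "l \<equiv> p * a ^ 2 / (b * c * d)"
  assumes g: "nonres a" "nonres l" and nz: "b \<noteq> 0" "c \<noteq> 0" "d \<noteq> 0" "e \<noteq> 0" "f \<noteq> 0"
    and u: "norm (p ^ 2 * a ^ 2 / (b * c * d * e * f)) < 1" "norm (a * p / (e * f)) < 1"
  shows "norm_series a b c d e f = norm_series l (l * b / a) (l * c / a) (l * d / a) e f"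
proof -
  have a: "a \<noteq> 0" "l \<noteq> 0" using g by (auto simp: nonres_def)
  have lb: "l * (b * c * d) = p * a ^ 2" using nz by (simp add: l_def)
  define u1 where "u1 = p ^ 2 * a ^ 2 / (b * c * d * e * f)"
  define u2 where "u2 = a * p / (e * f)"
  \<comment> \<open>Difference of the two sides along the perturbation, cleared of
    \<open>qinf a\<close> and \<open>qinf l\<close>, which stay fixed. Both arguments are divided by
    \<open>t\<close>, see \<open>eq1\<close> and \<open>eq2\<close>.\<close>
  define G where "G t = qinf l * (qinf (u1 / t) * reg_series a (b * t) (c * t) (d / t ^ 2) (e * t) f) -
     qinf a * (qinf (u2 / t) * reg_series l (l * (b * t) / a) (l * (c * t) / a) (l * (d / t ^ 2) / a) (e * t) f)" for t
  have eq1: "p ^ 2 * a ^ 2 / ((b * t) * (c * t) * (d / t ^ 2) * (e * t) * f) = u1 / t" if "t \<noteq> 0" for t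
    using that by (simp add: u1_def power2_eq_square)
  have eq2: "p ^ 2 * l ^ 2 / ((l * (b * t) / a) * (l * (c * t) / a) * (l * (d / t ^ 2) / a) * (e * t) * f) = u2 / t" if "t \<noteq> 0" for t
  proof -
    have "a ^ 2 * p ^ 2 / (l * (b * c * d) * e * f) = p / e / f" unfolding lb using a p_nz by (simp add: power2_eq_square)
    thus ?thesis using a nz that by (simp add: u2_def field_simps power2_eq_square)
  qed
  have eq3: "p * a ^ 2 / ((b * t) * (c * t) * (d / t ^ 2)) = l" if "t \<noteq> 0" for t
    using that by (simp add: l_def power2_eq_square)
  define m where "m = max (norm u1) (norm u2)"
  have m: "0 \<le> m" "m < 1" using u by (auto simp: m_def u1_def u2_def max_def)
  \<comment> \<open>Any value strictly between \<open>m\<close> and 1 would do. Then |t| > m /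
    \<rho> is a neighbourhood of 1 on which both arguments have modulus at most \<rho>, as
    \<open>reg_series_holomorphic\<close> requires.\<close>
  define \<rho> where "\<rho> = (1 + m) / 2"
  have \<rho>: "m < \<rho>" "\<rho> < 1" "0 < \<rho>" using m by (auto simp: \<rho>_def)
  define S where "S = {t :: complex. norm t > m / \<rho>}"
  have "m / \<rho> < 1" using \<rho> m by (simp add: divide_simps)
  hence S1: "1 \<in> S" by (simp add: S_def)
  have "open S" unfolding S_def by (intro open_Collect_less continuous_intros)
  have S0: "t \<noteq> 0" if "t \<in> S" for t using that m \<rho> by (auto simp: S_def divide_less_0_iff)
  have Su: "norm (u1 / t) \<le> \<rho>" "norm (u2 / t) \<le> \<rho>" if "t \<in> S" for t
  proof -
    have "m / \<rho> < norm t" using that by (simp add: S_def)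
    hence "m < \<rho> * norm t" using \<rho> by (simp add: divide_simps mult.commute)
    thus "norm (u1 / t) \<le> \<rho>" "norm (u2 / t) \<le> \<rho>"
      using S0[OF that] by (auto simp: norm_divide divide_simps m_def)
  qed
  have "G holomorphic_on S"
    unfolding G_def
    by (intro holomorphic_intros reg_series_holomorphic[OF \<open>open S\<close>, where \<rho> = \<rho>])
      (use S0 a nz Su \<rho>(2) eq1 eq2 in \<open>auto\<close>)
  hence "isCont G 1"
    using holomorphic_on_imp_continuous_on continuous_on_eq_continuous_at[OF \<open>open S\<close>] S1 by blast
  have "\<forall>\<^sub>F t in at 1. t \<in> S \<and> t \<noteq> 1"
    using \<open>open S\<close> S1 by (auto simp: eventually_at_topological)
  moreover have "\<forall>\<^sub>F t in at 1. nonres (y / t)" if "y \<noteq> 0" for y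
  proof -
    have "\<forall>\<^sub>F t in at 1. nonres ((1 / y) * t ^ 1)" using that by (intro eventually_nonres) auto
    thus ?thesis
    proof eventually_elim
      case (elim t)
      from nonres_inverse[OF elim] show ?case by simp
    qed
  qed
  from this[of "a / b"] this[of "a / c"] this[of "a / e"] this[of "l / e"]
  have "\<forall>\<^sub>F t in at 1. nonres (a / b / t)" "\<forall>\<^sub>F t in at 1. nonres (a / c / t)" "\<forall>\<^sub>F t in at 1. nonres (a / e / t)"
     "\<forall>\<^sub>F t in at 1. nonres (l / e / t)" using a nz by simp_all
  moreover have "\<forall>\<^sub>F t in at 1. nonres ((a / d) * t ^ 2)" using a nz by (intro eventually_nonres) auto
  ultimately have "\<forall>\<^sub>F t in at 1. G t = 0"
  proof eventually_elim
    case (elim t)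
    hence t: "t \<in> S" "t \<noteq> 0" using S0 by auto
    have "norm_series a (b * t) (c * t) (d / t ^ 2) (e * t) f =
        norm_series l (l * (b * t) / a) (l * (c * t) / a) (l * (d / t ^ 2) / a) (e * t) f"
      unfolding eq3[OF t(2), symmetric]
    proof (rule norm_series_transformation_nondegenerate; (unfold eq1[OF t(2)] eq3[OF t(2)])?)
      show "norm (u1 / t) < 1" using Su(1)[OF t(1)] \<rho> by linarith
      have "norm (u2 / t) < 1" using Su(2)[OF t(1)] \<rho> by linarith
      thus "norm (a * p / (e * t * f)) < 1" by (simp add: u2_def mult_ac)
    qed (use g elim nz in \<open>simp_all add: mult_ac\<close>)
    thus ?case
      unfolding norm_series_def eq1[OF t(2)] eq2[OF t(2)] G_def using nonres_qinf[OF g(1)] nonres_qinf[OF g(2)]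
      by (simp add: field_simps)
  qed
  moreover have "(G \<longlongrightarrow> G 1) (at 1)" using \<open>isCont G 1\<close> by (simp add: isCont_def)
  ultimately have "((\<lambda>_. 0) \<longlongrightarrow> G 1) (at (1::complex))" by (rule Lim_transform_eventually[rotated])
  hence "G 1 = 0" by (simp add: tendsto_const_iff)
  thus ?thesis
    unfolding norm_series_def using eq1[of 1] eq2[of 1] nonres_qinf[OF g(1)] nonres_qinf[OF g(2)]
    by (simp add: G_def field_simps)
qed

text \<open>Two applications of \<open>norm_series_transformation\<close>, to the triples (b, c, d)
  and (l b / a, e, f). The effect is to exchange the argument \<open>u\<close> with the parameter
  \<open>b\<close>. The three norm conditions concern the arguments of the initial, intermediate and
  final series.\<close>

lemma norm_series_inversion:
  fixes a b c d e f :: complex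
  defines "l \<equiv> p * a ^ 2 / (b * c * d)" and "u \<equiv> p ^ 2 * a ^ 2 / (b * c * d * e * f)"
  assumes g: "nonres a" "nonres l" "nonres (u * a / b)" and nz': "b \<noteq> 0" "c \<noteq> 0" "d \<noteq> 0" "e \<noteq> 0" "f \<noteq> 0"
    and norms: "norm u < 1" "norm (a * p / (e * f)) < 1" "norm b < 1"
  shows "norm_series a b c d e f = norm_series (u * a / b) u (a * p / (b * c)) (a * p / (b * d)) (a * p / (b * e)) (a * p / (b * f))"
proof -
  have nz: "a \<noteq> 0" "b \<noteq> 0" "c \<noteq> 0" "d \<noteq> 0" "e \<noteq> 0" "l \<noteq> 0" "f \<noteq> 0" using g nz' by (auto simp: nonres_def)
  have l: "l * (b * c * d) = p * a ^ 2" using nz by (simp add: l_def)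
  have m: "p * l ^ 2 / ((l * b / a) * e * f) = u * a / b"
    using nz p_nz by (simp add: l_def u_def power2_eq_square mult_ac)
  have b: "l * p / ((l * c / a) * (l * d / a)) = b"
    using nz p_nz by (simp add: l_def power2_eq_square)
  have u': "p ^ 2 * l ^ 2 / ((l * b / a) * e * f * (l * c / a) * (l * d / a)) = a * p / (e * f)"
    using nz p_nz by (simp add: l_def power2_eq_square)
  have "norm_series a b c d e f = norm_series l (l * b / a) (l * c / a) (l * d / a) e f"
    unfolding l_def by (rule norm_series_transformation) (use g norms nz in \<open>auto simp: l_def u_def\<close>)
  also have "\<dots> = norm_series l (l * b / a) e f (l * c / a) (l * d / a)"
    by (rule norm_series_permute)
  also have "\<dots> = norm_series (u * a / b) ((u * a / b) * (l * b / a) / l) ((u * a / b) * e / l) ((u * a / b) * f / l) (l * c / a) (l * d / a)"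
    unfolding m[symmetric]
  proof (rule norm_series_transformation)
    show "nonres l" by (rule g)
    show "nonres (p * l\<^sup>2 / (l * b / a * e * f))" unfolding m by (rule g)
    show "l * b / a \<noteq> 0" "e \<noteq> 0" "f \<noteq> 0" "l * c / a \<noteq> 0" "l * d / a \<noteq> 0" using nz by simp_all
    show "norm (p ^ 2 * l ^ 2 / ((l * b / a) * e * f * (l * c / a) * (l * d / a))) < 1"
      unfolding u' by (rule norms)
    show "norm (l * p / ((l * c / a) * (l * d / a))) < 1" unfolding b by (rule norms)
  qed
  also have "\<dots> = norm_series (u * a / b) u (a * p / (b * c)) (a * p / (b * d)) (a * p / (b * e)) (a * p / (b * f))"
  proof -
    have "(u * a / b) * (l * b / a) / l = u" using nz by simp
    moreover have "(u * a / b) * e / l = a * p / (b * f)" "(u * a / b) * f / l = a * p / (b * e)"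
      "l * c / a = a * p / (b * d)" "l * d / a = a * p / (b * c)"
      using nz p_nz by (simp_all add: u_def l_def power2_eq_square mult_ac)
    ultimately show ?thesis by (simp only: norm_series_permute(2))
  qed
  finally show ?thesis .
qed


section \<open>The three-term relation\<close>

text \<open>The bound is uniform in the truncation \<open>n\<close> and in the summation index
  \<open>r\<close>, as dominated convergence in \<open>partial_term_tendsto\<close>
  requires.\<close>

definition bdd_family :: "(nat \<Rightarrow> nat \<Rightarrow> complex) \<Rightarrow> bool"
  where "bdd_family f \<longleftrightarrow> (\<exists>C. \<forall>n r. norm (f n r) \<le> C)"

lemma bdd_family_mult:
  assumes "bdd_family f" "bdd_family g"
  shows "bdd_family (\<lambda>n r. f n r * g n r)"
proof -
  obtain C D where "\<And>n r. norm (f n r) \<le> C" "\<And>n r. norm (g n r) \<le> D"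
    using assms by (auto simp: bdd_family_def)
  hence "norm (f n r * g n r) \<le> C * D" for n r
    unfolding norm_mult by (meson mult_mono norm_ge_zero order_trans)
  thus ?thesis by (auto simp: bdd_family_def)
qed

lemma bdd_family_qpoch_shift: "bdd_family (\<lambda>n r. qpoch (x * p ^ h n r) p (k n r))"
  unfolding bdd_family_def
  by (intro exI[of _ "exp (norm x / (1 - norm p))"] allI qpoch_norm_le norm_mult_power_le order_refl)

lemma bdd_family_qpoch: "bdd_family (\<lambda>n r. qpoch x p (k n r))"
  using bdd_family_qpoch_shift[of x "\<lambda>_ _. 0"] by simp

lemma bdd_family_inverse_qpoch:
  assumes "qinf x \<noteq> 0"
  shows "bdd_family (\<lambda>n r. inverse (qpoch x p (k n r)))"
  using qpoch_inverse_bounded[OF assms] unfolding bdd_family_def by metis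

lemma bdd_family_inverse_qpoch_shift:
  assumes "qinf x \<noteq> 0"
  shows "bdd_family (\<lambda>n r. inverse (qpoch (x * p ^ h n r) p (k n r)))"
proof -
  have "inverse (qpoch (x * p ^ h n r) p (k n r)) = qpoch x p (h n r) * inverse (qpoch x p (h n r + k n r))" for n r
    using qpoch_nz[OF assms] by (simp add: qpoch_add)
  thus ?thesis using bdd_family_mult[OF bdd_family_qpoch bdd_family_inverse_qpoch[OF assms]] by simp
qed

lemma bdd_family_vwp_factor: "bdd_family (\<lambda>n r. 1 - x * p ^ h n r)"
proof -
  have "norm (1 - x * p ^ m) \<le> 1 + norm x" for m
    using norm_triangle_ineq4[of 1 "x * p ^ m"] norm_mult_power_le[OF order_refl, of x m] by simp
  thus ?thesis by (auto simp: bdd_family_def)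
qed

lemma tendsto_qpoch_minus: "(\<lambda>n. qpoch x p (n - r)) \<longlonglongrightarrow> qinf x"
  by (rule LIMSEQ_offset[of _ r]) (simp add: qpoch_tendsto_qinf)

lemma tendsto_qpoch_Suc_minus: "(\<lambda>n. qpoch x p (Suc n - r)) \<longlonglongrightarrow> qinf x"
  by (rule LIMSEQ_offset[of _ r]) (simp add: LIMSEQ_Suc[OF qpoch_tendsto_qinf] Suc_diff_le)

text \<open>What one family of linear numerator factors contributes at the r-th node once signs,
  powers and \<open>tri r\<close> are split off; \<open>den_factor\<close> is the same for the nodes
  of one foreign progression. Both are extracted in \<open>family_term\<close>.\<close>

definition num_factor :: "complex \<Rightarrow> complex \<Rightarrow> nat \<Rightarrow> nat \<Rightarrow> complex"
  where "num_factor A c n r = qpoch (A * p / c * p ^ r) p n * qpoch c p r * qpoch (p / c) p (n - r)"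

definition den_factor :: "complex \<Rightarrow> complex \<Rightarrow> nat \<Rightarrow> nat \<Rightarrow> complex"
  where "den_factor A b n r = qpoch (b * p ^ r) p (Suc n) * qpoch (A * p / b) p r * qpoch (b / A) p (Suc n - r)"

text \<open>A very-well-poised term whose infinite products are cut at finite order. The cuts at
  \<open>n\<close> and \<open>Suc n\<close> are exactly those that divided differences produce, so
  \<open>partial_three_term\<close> holds without a remainder.\<close>

definition partial_term ::
    "complex \<Rightarrow> complex \<Rightarrow> complex \<Rightarrow> complex \<Rightarrow> complex \<Rightarrow> complex \<Rightarrow> nat \<Rightarrow> nat \<Rightarrow> complex"
  where "partial_term A b b' c1 c2 c3 n r =
    (p ^ 2 * A ^ 2 / (b * b' * c1 * c2 * c3)) ^ r * ((1 - A * p ^ (2 * r)) *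
     (num_factor A c1 n r * num_factor A c2 n r * num_factor A c3 n r) *
     inverse (qpoch p p r) * inverse (qpoch p p (n - r)) * inverse (qpoch (A * p ^ r) p (Suc n)) *
     inverse (den_factor A b n r) * inverse (den_factor A b' n r))"

definition partial_limit :: "complex \<Rightarrow> complex \<Rightarrow> complex \<Rightarrow> complex \<Rightarrow> complex \<Rightarrow> complex \<Rightarrow> complex"
  where "partial_limit A b b' c1 c2 c3 =
    qinf (p / c1) * qinf (p / c2) * qinf (p / c3) /
      (qinf b * qinf b' * theta1 (b / A) * theta1 (b' / A)) * (reg_series A b b' c1 c2 c3 / qinf A)"

text \<open>Tannery's theorem: for fixed \<open>r\<close> each cut product tends to its infinite
  product, and the uniform bound on all factors leaves a geometric majorant in the argument of the
  series.\<close>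

lemma partial_term_tendsto:
  assumes g: "nonres A" "nonres b" "nonres b'" "nonres (b / A)" "nonres (b' / A)"
    and nz: "c1 \<noteq> 0" "c2 \<noteq> 0" "c3 \<noteq> 0"
    and u: "norm (p ^ 2 * A ^ 2 / (b * b' * c1 * c2 * c3)) < 1"
  shows "(\<lambda>n. \<Sum>r\<le>n. partial_term A b b' c1 c2 c3 n r) \<longlonglongrightarrow> partial_limit A b b' c1 c2 c3 / qinf p ^ 2"
proof -
  define u where "u = p ^ 2 * A ^ 2 / (b * b' * c1 * c2 * c3)"
  define G where "G n r = (1 - A * p ^ (2 * r)) *
     (num_factor A c1 n r * num_factor A c2 n r * num_factor A c3 n r) *
     inverse (qpoch p p r) * inverse (qpoch p p (n - r)) * inverse (qpoch (A * p ^ r) p (Suc n)) *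
     inverse (den_factor A b n r) * inverse (den_factor A b' n r)" for n r
  have num: "bdd_family (num_factor A c)" for c
    unfolding num_factor_def by (intro bdd_family_mult bdd_family_qpoch bdd_family_qpoch_shift)
  have g': "nonres (A * p / b)" "nonres (A * p / b')"
    using nonres_p_over[OF g(4)] nonres_p_over[OF g(5)] by (simp_all add: mult.commute)
  have den: "bdd_family (\<lambda>n r. inverse (den_factor A x n r))" if "nonres x" "nonres (x / A)" "nonres (A * p / x)" for x
    unfolding den_factor_def inverse_mult_distrib
    by (intro bdd_family_mult bdd_family_inverse_qpoch bdd_family_inverse_qpoch_shift nonres_qinf that)
  have "bdd_family G"
    unfolding G_def
    by (intro bdd_family_mult num den g g' bdd_family_vwp_factor bdd_family_inverse_qpoch bdd_family_inverse_qpoch_shift nonres_qinf qinf_p_nz)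
  then obtain C where C: "\<And>n r. norm (G n r) \<le> C" by (auto simp: bdd_family_def)
  define L where "L r = u ^ r * ((1 - A * p ^ (2 * r)) *
     ((qinf (A * p / c1 * p ^ r) * qpoch c1 p r * qinf (p / c1)) *
      (qinf (A * p / c2 * p ^ r) * qpoch c2 p r * qinf (p / c2)) *
      (qinf (A * p / c3 * p ^ r) * qpoch c3 p r * qinf (p / c3))) *
     inverse (qpoch p p r) * inverse (qinf p) * inverse (qinf (A * p ^ r)) *
     inverse (qinf (b * p ^ r) * qpoch (A * p / b) p r * qinf (b / A)) *
     inverse (qinf (b' * p ^ r) * qpoch (A * p / b') p r * qinf (b' / A)))" for r
  have dennz: "qinf (x * p ^ r) * qpoch (A * p / x) p r * qinf (x / A) \<noteq> 0"
    if "nonres x" "nonres (x / A)" "nonres (A * p / x)" for x r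
    using nonres_qinf[OF nonres_mult_power[OF that(1)]] nonres_qpoch[OF that(3)] nonres_qinf[OF that(2)] by simp
  have lim: "(\<lambda>n. if r \<le> n then u ^ r * G n r else 0) \<longlonglongrightarrow> L r" for r
  proof (rule Lim_transform_eventually)
    show "(\<lambda>n. u ^ r * G n r) \<longlonglongrightarrow> L r"
      unfolding G_def L_def num_factor_def den_factor_def
      by (intro tendsto_intros qpoch_tendsto_qinf tendsto_qpoch_minus tendsto_qpoch_Suc_minus
          LIMSEQ_Suc[OF qpoch_tendsto_qinf] qinf_p_nz nonres_qinf nonres_mult_power g dennz g')
    show "\<forall>\<^sub>F n in sequentially. u ^ r * G n r = (if r \<le> n then u ^ r * G n r else 0)"
      using eventually_ge_at_top[of r] by eventually_elim simp
  qed
  have "(\<lambda>n. \<Sum>r. if r \<le> n then u ^ r * G n r else 0) \<longlonglongrightarrow> (\<Sum>r. L r)"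
  proof (rule tannerys_theorem[where M = "\<lambda>r. C * norm u ^ r", THEN conjunct2, THEN conjunct2])
    show "summable (\<lambda>r. C * norm u ^ r)"
      using u by (intro summable_mult summable_geometric) (simp add: u_def)
    have "0 \<le> C" using C[of 0 0] norm_ge_zero order_trans by blast
    hence "norm (if r \<le> n then u ^ r * G n r else 0) \<le> C * norm u ^ r" for r n
      using mult_left_mono[OF C[of n r], of "norm u ^ r"] by (simp add: norm_mult norm_power mult.commute)
    thus "\<forall>\<^sub>F (r, n) in at_top \<times>\<^sub>F sequentially. norm (if r \<le> n then u ^ r * G n r else 0) \<le> C * norm u ^ r"
      by (intro always_eventually) auto
  qed (use lim in auto)
  moreover have "(\<Sum>r. if r \<le> n then u ^ r * G n r else 0) = (\<Sum>r\<le>n. partial_term A b b' c1 c2 c3 n r)" for n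
    by (subst suminf_finite[of "{..n}"]) (auto simp: partial_term_def G_def u_def intro!: sum.cong)
  moreover have "(\<Sum>r. L r) = partial_limit A b b' c1 c2 c3 / qinf p ^ 2"
  proof -
    define \<kappa> where "\<kappa> = qinf (p / c1) * qinf (p / c2) * qinf (p / c3) /
      (qinf b * qinf b' * theta1 (b / A) * theta1 (b' / A) * qinf A * qinf p ^ 2)"
    have "L r = \<kappa> * reg_series_term A b b' c1 c2 c3 r" for r
    proof -
      have A: "qinf x = qpoch x p r * qinf (x * p ^ r)" "qpoch x p r \<noteq> 0" "qinf (x * p ^ r) \<noteq> 0" if "nonres x" for x
        using qinf_split[of x r] nonres_qpoch[OF that] nonres_qinf[OF nonres_mult_power[OF that]] by auto
      have theta1: "theta1 (x / A) = qinf (x / A) * (qpoch (A * p / x) p r * qinf (A * p / x * p ^ r))" if "nonres (A * p / x)" for x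
        unfolding theta1_def A(1)[OF that, symmetric] by (simp add: mult.commute)
      have P: "qinf p = qpoch p p r * qinf (p ^ Suc r)" "qpoch p p r \<noteq> 0" "qinf (p ^ Suc r) \<noteq> 0"
        using qinf_split[of p r] qinf_p_nz qpoch_p_nz by auto
      show ?thesis
        unfolding L_def \<kappa>_def reg_series_term_def vwp_def wp_factor_def u_def theta1[OF g'(1)] theta1[OF g'(2)]
          A(1)[OF g(1)] A(1)[OF g(2)] A(1)[OF g(3)] power2_eq_square[of "qinf p"]
        apply (subst (2) P(1))
        using A(2,3)[OF g(1)] A(2,3)[OF g(2)] A(2,3)[OF g(3)] A(2,3)[OF g'(1)] A(2,3)[OF g'(2)] P(2,3) qinf_p_nz
          nonres_qinf[OF g(4)] nonres_qinf[OF g(5)]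
        by (simp add: divide_inverse inverse_mult_distrib mult_ac) (simp add: field_simps)
    qed
    moreover have "summable (reg_series_term A b b' c1 c2 c3)"
      using u by (rule reg_series_term_summable)
    ultimately have "(\<Sum>r. L r) = \<kappa> * reg_series A b b' c1 c2 c3"
      unfolding reg_series_def by (simp add: suminf_mult)
    thus ?thesis by (simp add: \<kappa>_def partial_limit_def)
  qed
  ultimately show ?thesis by simp
qed

text \<open>One summand of the divided difference, at a node of the progression \<open>x\<close>.
  Seen from there the base parameter is \<open>x ^ 2 / a\<close>: the own progression gives
  differences of \<open>node\<close>, a foreign one gives \<open>den_factor\<close>. A numerator
  factor vanishes where \<sigma> = w + 1/(a w) with w = p^(k+1)/c, so it splits into two factors as
  a node difference does and gives \<open>num_factor\<close>.\<close>

lemma family_term: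
  fixes a x y y' c1 c2 c3 :: complex
  defines "\<sigma> \<equiv> (\<lambda>(x, k). x * p ^ k / a + 1 / (x * p ^ k))"
  assumes g: "nonres (x ^ 2 / a)" and nz: "a \<noteq> 0" "x \<noteq> 0" "y \<noteq> 0" "y' \<noteq> 0" "c1 \<noteq> 0" "c2 \<noteq> 0" "c3 \<noteq> 0" and r: "r \<le> n"
    and num_nz: "(\<Prod>k\<in>{..n} - {r}. \<sigma> (x, r) - \<sigma> (x, k)) \<noteq> 0"
      "(\<Prod>k\<le>n. \<sigma> (x, r) - \<sigma> (y, k)) \<noteq> 0" "(\<Prod>k\<le>n. \<sigma> (x, r) - \<sigma> (y', k)) \<noteq> 0"
  shows "(\<Prod>k<n. (1 + a * (p ^ Suc k / c1) ^ 2) + (- (a * p ^ Suc k / c1)) * \<sigma> (x, r)) *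
      (\<Prod>k<n. (1 + a * (p ^ Suc k / c2) ^ 2) + (- (a * p ^ Suc k / c2)) * \<sigma> (x, r)) *
      (\<Prod>k<n. (1 + a * (p ^ Suc k / c3) ^ 2) + (- (a * p ^ Suc k / c3)) * \<sigma> (x, r)) /
      ((\<Prod>k\<in>{..n} - {r}. \<sigma> (x, r) - \<sigma> (x, k)) * (\<Prod>k\<le>n. \<sigma> (x, r) - \<sigma> (y, k)) * (\<Prod>k\<le>n. \<sigma> (x, r) - \<sigma> (y', k))) =
    ((- x) ^ n * (- y) ^ Suc n * (- y') ^ Suc n * tri n ^ 3) *
    partial_term (x ^ 2 / a) (x * y / a) (x * y' / a) (x * c1 / a) (x * c2 / a) (x * c3 / a) n r"
proof -
  define A where "A = x ^ 2 / a"
  have A: "A \<noteq> 0" using nz by (simp add: A_def)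
  define t where "t = tri r"
  have t: "t \<noteq> 0" by (simp add: t_def tri_nz)
  define s :: complex where "s = (- 1) ^ r"
  have s: "s * s = 1" "s \<noteq> 0" by (simp_all add: s_def flip: power_mult_distrib)
  define D where "D = (\<Prod>k\<in>{..n} - {r}. \<sigma> (x, r) - \<sigma> (x, k))"
  define E where "E = (\<lambda>y. \<Prod>k\<le>n. \<sigma> (x, r) - \<sigma> (y, k))"
  define H where "H = (\<lambda>c. \<Prod>k<n. (1 + a * (p ^ Suc k / c) ^ 2) + (- (a * p ^ Suc k / c)) * \<sigma> (x, r))"
  have D: "D * ((- x) ^ n * tri n * t * s * (1 - A * p ^ (2 * r))) =
      p ^ r * qpoch p p r * qpoch p p (n - r) * qpoch (A * p ^ r) p (Suc n)"
  proof -
    have "D = (\<Prod>k\<in>{..n} - {r}. x / a * (node A r - node A k))"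
      unfolding D_def using nz p_nz
      by (intro prod.cong refl) (simp add: \<sigma>_def node_def A_def power2_eq_square field_simps)
    also have "\<dots> = (x / a) ^ n * (\<Prod>k\<in>{..n} - {r}. node A r - node A k)"
      using r by (simp only: prod.distrib prod_constant) simp
    finally have *: "D = (x / a) ^ n * (\<Prod>k\<in>{..n} - {r}. node A r - node A k)" .
    have "(x / a) ^ n * (- x) ^ n = (- A) ^ n"
      by (simp add: A_def power2_eq_square flip: power_mult_distrib)
    hence "D * ((- x) ^ n * tri n * t * s * (1 - A * p ^ (2 * r))) =
        (\<Prod>k\<in>{..n} - {r}. node A r - node A k) * ((- A) ^ n * tri n * tri r * (- 1) ^ r * (1 - A * p ^ (2 * r)))"
      unfolding * t_def s_def by (simp add: mult_ac)
    also have "\<dots> = p ^ r * qpoch p p r * qpoch p p (n - r) * qpoch (A * p ^ r) p (Suc n)"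
      by (rule prod_node_diff[OF g[folded A_def] r])
    finally show ?thesis .
  qed
  have E: "E y * ((- y) ^ Suc n * tri n) = (y / x) ^ r * s / t * den_factor A (x * y / a) n r" if "y \<noteq> 0" for y
  proof -
    have T: "(- y) ^ Suc n * tri n = (\<Prod>k\<le>n. - y * p ^ k)"
      by (simp only: prod.distrib tri_def power_sum) simp
    have "E y * ((- y) ^ Suc n * tri n) = (\<Prod>k\<le>n. (1 - x * y / a * p ^ r * p ^ k) * (1 - y / x * p ^ k / p ^ r))"
      unfolding T E_def prod.distrib[symmetric] using nz p_nz that
      by (intro prod.cong refl) (simp add: \<sigma>_def divide_simps, algebra)
    also have "\<dots> = qpoch (x * y / a * p ^ r) p (Suc n) * (\<Prod>k<Suc n. 1 - y / x * p ^ k / p ^ r)"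
      by (simp only: prod.distrib qpoch_def lessThan_Suc_atMost)
    also have "(\<Prod>k<Suc n. 1 - y / x * p ^ k / p ^ r) =
        (- (y / x)) ^ r / tri r * qpoch (p / (y / x)) p r * qpoch (y / x) p (Suc n - r)"
      using nz that r by (intro prod_power_quotient_upto) auto
    also have "(- (y / x)) ^ r = (y / x) ^ r * s"
      unfolding s_def by (metis mult.commute mult_minus1 power_mult_distrib)
    also have "p / (y / x) = A * p / (x * y / a)" using nz that by (simp add: A_def power2_eq_square)
    also have "y / x = (x * y / a) / A" using nz by (simp add: A_def power2_eq_square)
    finally show ?thesis using nz by (simp add: den_factor_def t_def A_def power2_eq_square mult_ac)
  qed
  have H: "H c = (p * a / (x * c)) ^ r * s / t * num_factor A (x * c / a) n r" if "c \<noteq> 0" for c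
  proof -
    have "H c = (\<Prod>k<n. (1 - A * p / (x * c / a) * p ^ r * p ^ k) * (1 - p / (x * c / a) * p ^ k / p ^ r))"
      unfolding H_def using nz p_nz that
      by (intro prod.cong refl) (simp add: \<sigma>_def A_def divide_simps power2_eq_square, algebra)
    also have "\<dots> = qpoch (A * p / (x * c / a) * p ^ r) p n * (\<Prod>k<n. 1 - p / (x * c / a) * p ^ k / p ^ r)"
      by (simp only: prod.distrib qpoch_def)
    also have "(\<Prod>k<n. 1 - p / (x * c / a) * p ^ k / p ^ r) =
        (- (p / (x * c / a))) ^ r / tri r * qpoch (p / (p / (x * c / a))) p r * qpoch (p / (x * c / a)) p (n - r)"
      using nz p_nz that r by (intro prod_power_quotient_upto) auto
    also have "(- (p / (x * c / a))) ^ r = (p * a / (x * c)) ^ r * s"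
      unfolding s_def by (metis mult.commute mult_minus1 power_mult_distrib divide_divide_eq_right)
    also have "p / (p / (x * c / a)) = x * c / a" using p_nz by simp
    finally show ?thesis by (simp add: num_factor_def t_def mult_ac)
  qed
  let ?X = "(- x) ^ n * (- y) ^ Suc n * (- y') ^ Suc n * tri n ^ 3"
  have a2: "1 - A * p ^ (2 * r) \<noteq> 0" using nonres_neq_1[OF g[folded A_def], of "2 * r"] by simp
  define den where "den = qpoch p p r * qpoch p p (n - r) * qpoch (A * p ^ r) p (Suc n) *
     den_factor A (x * y / a) n r * den_factor A (x * y' / a) n r"
  define num where "num = (1 - A * p ^ (2 * r)) *
     (num_factor A (x * c1 / a) n r * num_factor A (x * c2 / a) n r * num_factor A (x * c3 / a) n r)"
  have DE: "D * E y * E y' * (?X * t ^ 3 * s * (1 - A * p ^ (2 * r))) = p ^ r * (y * y' / x ^ 2) ^ r * den"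
  proof -
    have "D * E y * E y' * (?X * t ^ 3 * s * (1 - A * p ^ (2 * r))) =
        (D * ((- x) ^ n * tri n * t * s * (1 - A * p ^ (2 * r)))) *
        (E y * ((- y) ^ Suc n * tri n)) * (E y' * ((- y') ^ Suc n * tri n)) * t ^ 2"
      by (simp add: power3_eq_cube power2_eq_square mult_ac)
    also have "\<dots> = p ^ r * ((y / x) ^ r * (y' / x) ^ r) * (s * s) * den"
      unfolding D E[OF nz(3)] E[OF nz(4)] den_def using t by (simp add: power2_eq_square mult_ac)
    also have "(y / x) ^ r * (y' / x) ^ r = (y * y' / x ^ 2) ^ r"
      by (simp add: power2_eq_square flip: power_mult_distrib)
    finally show ?thesis using s by simp
  qed
  have H3: "H c1 * H c2 * H c3 * (t ^ 3 * s * (1 - A * p ^ (2 * r))) = ((p * a / x) ^ 3 / (c1 * c2 * c3)) ^ r * num"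
  proof -
    have "H c1 * H c2 * H c3 * (t ^ 3 * s * (1 - A * p ^ (2 * r))) =
       ((p * a / (x * c1)) ^ r * (p * a / (x * c2)) ^ r * (p * a / (x * c3)) ^ r) * (s * s) * (s * s) * num"
      unfolding H[OF nz(5)] H[OF nz(6)] H[OF nz(7)] num_def using t by (simp add: power3_eq_cube mult_ac)
    also have "(p * a / (x * c1)) ^ r * (p * a / (x * c2)) ^ r * (p * a / (x * c3)) ^ r = ((p * a / x) ^ 3 / (c1 * c2 * c3)) ^ r"
      by (simp add: power3_eq_cube mult_ac flip: power_mult_distrib)
    finally show ?thesis using s by simp
  qed
  have u: "p ^ 2 * A ^ 2 / ((x * y / a) * (x * y' / a) * (x * c1 / a) * (x * c2 / a) * (x * c3 / a)) * (p * (y * y' / x ^ 2)) =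
      (p * a / x) ^ 3 / (c1 * c2 * c3)"
    using nz p_nz by (simp add: A_def power2_eq_square power3_eq_cube field_simps)
  have pt: "partial_term A (x * y / a) (x * y' / a) (x * c1 / a) (x * c2 / a) (x * c3 / a) n r =
      (p ^ 2 * A ^ 2 / ((x * y / a) * (x * y' / a) * (x * c1 / a) * (x * c2 / a) * (x * c3 / a))) ^ r * (num / den)"
    by (simp add: partial_term_def num_def den_def divide_inverse mult_ac)
  \<comment> \<open>Three numerator products and three denominator products carry the same power of
    \<open>tri r\<close> and the same sign, so \<open>w\<close> is common to \<open>H3\<close> and
    \<open>DE\<close> and cancels.\<close>
  define w where "w = t ^ 3 * s * (1 - A * p ^ (2 * r))"
  have w: "w \<noteq> 0" using t s a2 by (simp add: w_def)
  have X: "?X \<noteq> 0" using nz tri_nz by simp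
  have dd: "D * E y * E y' \<noteq> 0" using num_nz by (simp add: D_def E_def)
  have DE': "D * E y * E y' * ?X * w = p ^ r * (y * y' / x ^ 2) ^ r * den"
    using DE by (simp add: w_def mult_ac)
  hence den0: "den \<noteq> 0" using dd X w by auto
  have "(H c1 * H c2 * H c3) * w * den = (?X * partial_term A (x * y / a) (x * y' / a) (x * c1 / a) (x * c2 / a) (x * c3 / a) n r * (D * E y * E y')) * w * den"
  proof -
    define B where "B = p ^ 2 * A ^ 2 / ((x * y / a) * (x * y' / a) * (x * c1 / a) * (x * c2 / a) * (x * c3 / a))"
    have e: "((p * a / x) ^ 3 / (c1 * c2 * c3)) ^ r = B ^ r * (p ^ r * (y * y' / x ^ 2) ^ r)"
      unfolding u[symmetric] B_def[symmetric] by (simp only: power_mult_distrib)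
    have "(H c1 * H c2 * H c3) * w * den = B ^ r * num * (p ^ r * (y * y' / x ^ 2) ^ r * den)"
      using H3 unfolding w_def[symmetric] e by (simp only: mult_ac)
    also have "\<dots> = (?X * partial_term A (x * y / a) (x * y' / a) (x * c1 / a) (x * c2 / a) (x * c3 / a) n r * (D * E y * E y')) * w * den"
      unfolding DE'[symmetric] pt B_def[symmetric] using den0 by (simp add: mult_ac)
    finally show ?thesis .
  qed
  hence "H c1 * H c2 * H c3 / (D * E y * E y') = ?X * partial_term A (x * y / a) (x * y' / a) (x * c1 / a) (x * c2 / a) (x * c3 / a) n r"
    using w den0 dd by (simp add: field_simps)
  thus ?thesis by (simp only: H_def D_def E_def A_def)
qed

text \<open>A divided difference of a polynomial of low degree vanishes. The nodes are the values of
  \<open>t + 1 / (a t)\<close> at three geometric progressions, one for each term of the relation.\<close>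

lemma partial_three_term:
  fixes a b1 b2 c1 c2 c3 :: complex
  assumes g: "nonres a" "nonres (b1 ^ 2 / a)" "nonres (b2 ^ 2 / a)" "nonres b1" "nonres b2" "nonres (b1 / a)" "nonres (b2 / a)" "nonres (b1 * b2 / a)" "nonres (b2 / b1)"
    and nz: "c1 \<noteq> 0" "c2 \<noteq> 0" "c3 \<noteq> 0"
  shows "1 / a * (\<Sum>r\<le>n. partial_term a b1 b2 c1 c2 c3 n r) +
    1 / b1 * (\<Sum>r\<le>n. partial_term (b1 ^ 2 / a) b1 (b1 * b2 / a) (b1 * c1 / a) (b1 * c2 / a) (b1 * c3 / a) n r) +
    1 / b2 * (\<Sum>r\<le>n. partial_term (b2 ^ 2 / a) b2 (b1 * b2 / a) (b2 * c1 / a) (b2 * c2 / a) (b2 * c3 / a) n r) = 0"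
proof -
  have nz': "a \<noteq> 0" "b1 \<noteq> 0" "b2 \<noteq> 0" using g by (auto simp: nonres_def)
  define \<sigma> :: "complex \<times> nat \<Rightarrow> complex" where "\<sigma> = (\<lambda>(x, k). x * p ^ k / a + 1 / (x * p ^ k))"
  \<comment> \<open>Base points of the three progressions; for \<open>x = a\<close> the nodes are
    those of \<open>node a\<close>.\<close>
  define F where "F = {a, b1, b2}"
  define I where "I = F \<times> {..n}"
  have ne: "x \<noteq> y" if "nonres (y / x)" for x y
    using nonres_neq_1[OF that, of 0] that by (auto simp: nonres_def)
  have dist: "a \<noteq> b1" "a \<noteq> b2" "b1 \<noteq> b2" using g ne by auto
  have F0: "x \<noteq> 0" if "x \<in> F" for x using that nz' by (auto simp: F_def)
  have gF: "nonres (x * y / a)" if "x \<in> F" "y \<in> F" for x y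
    using that g nz' by (auto simp: F_def power2_eq_square mult.commute)
  have gQ: "nonres (y / x)" if "x \<in> F" "y \<in> F" "x \<noteq> y" for x y
    using that g(6,7,9) g(6,7,9)[THEN nonres_inverse] by (auto simp: F_def)
  have \<sigma>_diff: "\<sigma> (x, r) - \<sigma> (y, k) = - ((1 - x * y / a * p ^ (r + k)) * (1 - y / x * p ^ k / p ^ r)) / (y * p ^ k)"
    if "x \<in> F" "y \<in> F" for x y r k
    using F0[OF that(1)] F0[OF that(2)] nz' p_nz by (simp add: \<sigma>_def power_add divide_simps) algebra
  have inj: "inj_on \<sigma> I"
  proof (rule inj_onI, clarify)
    fix x r y k assume xy: "(x, r) \<in> I" "(y, k) \<in> I" and eq: "\<sigma> (x, r) = \<sigma> (y, k)"
    hence F: "x \<in> F" "y \<in> F" by (auto simp: I_def)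
    have "(1 - x * y / a * p ^ (r + k)) * (1 - y / x * p ^ k / p ^ r) = 0"
      using \<sigma>_diff[OF F, of r k] eq F0[OF F(2)] p_nz by simp
    hence *: "y / x * p ^ k / p ^ r = 1" using nonres_neq_1[OF gF[OF F], of "r + k"]
      by (metis eq_iff_diff_eq_0 mult_eq_0_iff)
    have "x = y"
    proof (rule ccontr)
      assume "x \<noteq> y"
      from nonres_mult_powi[OF gQ[OF F this], of "int k - int r"] show False
        using * p_nz by (auto simp: nonres_def power_int_diff dest: spec[of _ 0])
    qed
    with * F0[OF F(1)] p_nz have "p ^ k = p ^ r" by simp
    with \<open>x = y\<close> show "x = y \<and> r = k" by (auto dest: p_power_inj)
  qed
  define cc :: "nat \<Rightarrow> complex" where "cc j = (if j = 0 then c1 else if j = 1 then c2 else c3)" for j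
  define \<alpha> where "\<alpha> = (\<lambda>(j, k). 1 + a * (p ^ Suc k / cc j) ^ 2)"
  define \<beta> where "\<beta> = (\<lambda>(j, k). - (a * p ^ Suc k / cc j))"
  define B where "B = {..<3::nat} \<times> {..<n}"
  define g where "g i = (\<Prod>k\<in>B. \<alpha> k + \<beta> k * \<sigma> i)" for i
  have "ddiff \<sigma> g I = 0"
    unfolding g_def
  proof (rule ddiff_prod_linear_eq_0[OF _ inj])
    \<comment> \<open>There are 3n linear factors and 3n + 3 nodes, one node more than the vanishing
      needs.\<close>
    have "card F = 3" using dist by (simp add: F_def)
    thus "card B + 2 \<le> card I" by (simp add: B_def I_def card_cartesian_product)
  qed (auto simp: I_def F_def B_def)
  define M where "M = (a * b1 * b2) ^ Suc n * tri n ^ 3 * (- 1) ^ n"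
  \<comment> \<open>The prefactor of \<open>family_term\<close> is \<open>M\<close> divided by the
    base point, with \<open>M\<close> symmetric in all three; so one statement covers the three
    choices of \<open>x\<close>, and \<open>M\<close> can be cancelled at the end.\<close>
  have fam: "(\<Sum>r\<le>n. g (x, r) / (\<Prod>k\<in>I - {(x, r)}. \<sigma> (x, r) - \<sigma> k)) =
      M * (1 / x * (\<Sum>r\<le>n. partial_term (x ^ 2 / a) (x * y / a) (x * y' / a) (x * c1 / a) (x * c2 / a) (x * c3 / a) n r))"
    if F: "F = {x, y, y'}" and d: "x \<noteq> y" "x \<noteq> y'" "y \<noteq> y'" for x y y'
  proof -
    have prodF: "a * b1 * b2 = x * y * y'"
    proof -
      have "\<Prod>F = a * b1 * b2" using dist by (simp add: F_def)
      moreover have "\<Prod>F = x * y * y'" using d by (simp add: F)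
      ultimately show ?thesis by simp
    qed
    have x0: "x \<noteq> 0" "y \<noteq> 0" "y' \<noteq> 0" using F0 F by auto
    have M: "(- x) ^ n * (- y) ^ Suc n * (- y') ^ Suc n * tri n ^ 3 = M * (1 / x)"
    proof -
      have "(- x) ^ n * (- y) ^ Suc n * (- y') ^ Suc n = ((- 1) ^ n * (- 1) ^ Suc n * (- 1) ^ Suc n) * (x ^ n * y ^ Suc n * y' ^ Suc n)"
        by (simp only: power_minus[of x] power_minus[of y] power_minus[of y'] mult_ac)
      also have "(- 1) ^ n * (- 1) ^ Suc n * (- 1) ^ Suc n = (- 1 :: complex) ^ n"
        by (simp flip: power_mult_distrib)
      finally show ?thesis using x0 unfolding M_def prodF by (simp add: power_mult_distrib mult_ac)
    qed
    have "g (x, r) / (\<Prod>k\<in>I - {(x, r)}. \<sigma> (x, r) - \<sigma> k) =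
      M * (1 / x) * partial_term (x ^ 2 / a) (x * y / a) (x * y' / a) (x * c1 / a) (x * c2 / a) (x * c3 / a) n r"
      if r: "r \<le> n" for r
    proof -
      have split: "I - {(x, r)} = (\<lambda>k. (x, k)) ` ({..n} - {r}) \<union> ((\<lambda>k. (y, k)) ` {..n} \<union> (\<lambda>k. (y', k)) ` {..n})"
        using d by (auto simp: I_def F)
      have "(\<Prod>k\<in>I - {(x, r)}. \<sigma> (x, r) - \<sigma> k) =
          (\<Prod>k\<in>(\<lambda>k. (x, k)) ` ({..n} - {r}). \<sigma> (x, r) - \<sigma> k) *
          ((\<Prod>k\<in>(\<lambda>k. (y, k)) ` {..n}. \<sigma> (x, r) - \<sigma> k) * (\<Prod>k\<in>(\<lambda>k. (y', k)) ` {..n}. \<sigma> (x, r) - \<sigma> k))"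
        unfolding split using d by (subst prod.union_disjoint; (subst prod.union_disjoint)?) auto
      also have "\<dots> = (\<Prod>k\<in>{..n} - {r}. \<sigma> (x, r) - \<sigma> (x, k)) * (\<Prod>k\<le>n. \<sigma> (x, r) - \<sigma> (y, k)) * (\<Prod>k\<le>n. \<sigma> (x, r) - \<sigma> (y', k))"
        by (subst (1 2 3) prod.reindex) (auto simp: inj_on_def mult_ac)
      finally have den: "(\<Prod>k\<in>I - {(x, r)}. \<sigma> (x, r) - \<sigma> k) = \<dots>" .
      moreover have "(\<Prod>k\<in>I - {(x, r)}. \<sigma> (x, r) - \<sigma> k) \<noteq> 0"
        using inj F r by (auto simp: I_def inj_on_def)
      ultimately have den_nz: "(\<Prod>k\<in>{..n} - {r}. \<sigma> (x, r) - \<sigma> (x, k)) \<noteq> 0"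
        "(\<Prod>k\<le>n. \<sigma> (x, r) - \<sigma> (y, k)) \<noteq> 0" "(\<Prod>k\<le>n. \<sigma> (x, r) - \<sigma> (y', k)) \<noteq> 0" by simp_all
      have "g (x, r) = (\<Prod>j<3. \<Prod>k<n. \<alpha> (j, k) + \<beta> (j, k) * \<sigma> (x, r))"
        unfolding g_def B_def by (simp add: prod.cartesian_product)
      also have "\<dots> = (\<Prod>k<n. \<alpha> (0, k) + \<beta> (0, k) * \<sigma> (x, r)) * (\<Prod>k<n. \<alpha> (1, k) + \<beta> (1, k) * \<sigma> (x, r)) *
          (\<Prod>k<n. \<alpha> (2, k) + \<beta> (2, k) * \<sigma> (x, r))"
        by (simp add: eval_nat_numeral)
      also have "\<dots> = (\<Prod>k<n. (1 + a * (p ^ Suc k / c1) ^ 2) + (- (a * p ^ Suc k / c1)) * \<sigma> (x, r)) *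
          (\<Prod>k<n. (1 + a * (p ^ Suc k / c2) ^ 2) + (- (a * p ^ Suc k / c2)) * \<sigma> (x, r)) *
          (\<Prod>k<n. (1 + a * (p ^ Suc k / c3) ^ 2) + (- (a * p ^ Suc k / c3)) * \<sigma> (x, r))"
        by (simp add: \<alpha>_def \<beta>_def cc_def)
      finally have num: "g (x, r) = \<dots>" .
      have "x \<in> F" using F by simp
      from gF[OF this this] have "nonres (x ^ 2 / a)" by (simp add: power2_eq_square)
      from family_term[OF this nz'(1) x0 nz r den_nz[unfolded \<sigma>_def], folded \<sigma>_def, unfolded M]
      show ?thesis unfolding num den .
    qed
    hence "(\<Sum>r\<le>n. g (x, r) / (\<Prod>k\<in>I - {(x, r)}. \<sigma> (x, r) - \<sigma> k)) =
      (\<Sum>r\<le>n. M * (1 / x) * partial_term (x ^ 2 / a) (x * y / a) (x * y' / a) (x * c1 / a) (x * c2 / a) (x * c3 / a) n r)"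
      by (intro sum.cong) auto
    thus ?thesis by (simp add: sum_distrib_left mult.assoc)
  qed
  have "0 = (\<Sum>x\<in>F. \<Sum>r\<le>n. g (x, r) / (\<Prod>k\<in>I - {(x, r)}. \<sigma> (x, r) - \<sigma> k))"
    using \<open>ddiff \<sigma> g I = 0\<close> unfolding ddiff_def I_def by (simp add: sum.cartesian_product case_prod_unfold)
  also have "\<dots> = (\<Sum>r\<le>n. g (a, r) / (\<Prod>k\<in>I - {(a, r)}. \<sigma> (a, r) - \<sigma> k)) +
     (\<Sum>r\<le>n. g (b1, r) / (\<Prod>k\<in>I - {(b1, r)}. \<sigma> (b1, r) - \<sigma> k)) +
     (\<Sum>r\<le>n. g (b2, r) / (\<Prod>k\<in>I - {(b2, r)}. \<sigma> (b2, r) - \<sigma> k))"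
    unfolding F_def using dist by simp
  finally have "M * (1 / a * (\<Sum>r\<le>n. partial_term a b1 b2 c1 c2 c3 n r) +
    1 / b1 * (\<Sum>r\<le>n. partial_term (b1 ^ 2 / a) b1 (b1 * b2 / a) (b1 * c1 / a) (b1 * c2 / a) (b1 * c3 / a) n r) +
    1 / b2 * (\<Sum>r\<le>n. partial_term (b2 ^ 2 / a) b2 (b1 * b2 / a) (b2 * c1 / a) (b2 * c2 / a) (b2 * c3 / a) n r)) = 0"
    using fam[of a b1 b2] fam[of b1 a b2] fam[of b2 a b1] dist nz'
    by (simp add: F_def insert_commute power2_eq_square algebra_simps)
  moreover have "M \<noteq> 0" using nz' tri_nz by (simp add: M_def)
  ultimately show ?thesis by simp
qed

text \<open>The coefficient of \<open>reg_series A b b' c1 c2 c3 / qinf A\<close> in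
  \<open>partial_limit\<close>. For Askey-Wilson parameters it turns into the
  \<open>c\<close>-function.\<close>

definition connection_coeff ::
    "complex \<Rightarrow> complex \<Rightarrow> complex \<Rightarrow> complex \<Rightarrow> complex \<Rightarrow> complex \<Rightarrow> complex"
  where "connection_coeff A b b' c1 c2 c3 =
    qinf (p / c1) * qinf (p / c2) * qinf (p / c3) / (qinf b * qinf b' * theta1 (b / A) * theta1 (b' / A))"

text \<open>The limit of \<open>partial_three_term\<close>. All three series have the same argument
  \<open>u\<close>, so a single norm condition suffices and multiplication by \<open>qinf u\<close>
  completes each of them to \<open>norm_series\<close>.\<close>

lemma norm_series_three_term:
  fixes a b1 b2 c1 c2 c3 :: complex
  assumes g: "nonres a" "nonres (b1 ^ 2 / a)" "nonres (b2 ^ 2 / a)" "nonres b1" "nonres b2" "nonres (b1 / a)" "nonres (b2 / a)" "nonres (b1 * b2 / a)" "nonres (b2 / b1)"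
    and nz: "c1 \<noteq> 0" "c2 \<noteq> 0" "c3 \<noteq> 0"
    and u: "norm (p ^ 2 * a ^ 2 / (b1 * b2 * c1 * c2 * c3)) < 1"
  shows "1 / a * (connection_coeff a b1 b2 c1 c2 c3 * norm_series a b1 b2 c1 c2 c3) +
    1 / b1 * (connection_coeff (b1 ^ 2 / a) b1 (b1 * b2 / a) (b1 * c1 / a) (b1 * c2 / a) (b1 * c3 / a) *
      norm_series (b1 ^ 2 / a) b1 (b1 * b2 / a) (b1 * c1 / a) (b1 * c2 / a) (b1 * c3 / a)) +
    1 / b2 * (connection_coeff (b2 ^ 2 / a) b2 (b1 * b2 / a) (b2 * c1 / a) (b2 * c2 / a) (b2 * c3 / a) *
      norm_series (b2 ^ 2 / a) b2 (b1 * b2 / a) (b2 * c1 / a) (b2 * c2 / a) (b2 * c3 / a)) = 0"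
proof -
  have nz': "a \<noteq> 0" "b1 \<noteq> 0" "b2 \<noteq> 0" using g by (auto simp: nonres_def)
  define u where "u = p ^ 2 * a ^ 2 / (b1 * b2 * c1 * c2 * c3)"
  have u1: "p ^ 2 * (x ^ 2 / a) ^ 2 / (x * (b1 * b2 / a) * (x * c1 / a) * (x * c2 / a) * (x * c3 / a)) = u"
    if "x \<noteq> 0" for x
    using that nz nz' by (simp add: u_def power2_eq_square field_simps)
  define S0 where "S0 n = (\<Sum>r\<le>n. partial_term a b1 b2 c1 c2 c3 n r)" for n
  define S where "S x n = (\<Sum>r\<le>n. partial_term (x ^ 2 / a) x (b1 * b2 / a) (x * c1 / a) (x * c2 / a) (x * c3 / a) n r)" for x n
  have *: "b1 / (b1 ^ 2 / a) = 1 / (b1 / a)" "b1 * b2 / a / (b1 ^ 2 / a) = b2 / b1"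
     "b2 / (b2 ^ 2 / a) = 1 / (b2 / a)" "b1 * b2 / a / (b2 ^ 2 / a) = 1 / (b2 / b1)"
    using nz' by (simp_all add: power2_eq_square)
  have gi: "nonres (a / b1)" "nonres (a / b2)" "nonres (b1 / b2)"
    using nonres_inverse[OF g(6)] nonres_inverse[OF g(7)] nonres_inverse[OF g(9)] by simp_all
  have "(\<lambda>n. 1 / a * S0 n + 1 / b1 * S b1 n + 1 / b2 * S b2 n) \<longlonglongrightarrow>
    1 / a * (partial_limit a b1 b2 c1 c2 c3 / qinf p ^ 2) +
    1 / b1 * (partial_limit (b1 ^ 2 / a) b1 (b1 * b2 / a) (b1 * c1 / a) (b1 * c2 / a) (b1 * c3 / a) / qinf p ^ 2) +
    1 / b2 * (partial_limit (b2 ^ 2 / a) b2 (b1 * b2 / a) (b2 * c1 / a) (b2 * c2 / a) (b2 * c3 / a) / qinf p ^ 2)"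
    unfolding S0_def S_def using nz nz' u
    by (intro tendsto_intros partial_term_tendsto g; (unfold * u1[OF nz'(2)] u1[OF nz'(3)])?)
       (auto simp: u_def intro: g gi)
  moreover have "1 / a * S0 n + 1 / b1 * S b1 n + 1 / b2 * S b2 n = 0" for n
    using partial_three_term[OF g nz, of n] by (simp add: S0_def S_def)
  ultimately have "1 / a * (partial_limit a b1 b2 c1 c2 c3 / qinf p ^ 2) +
    1 / b1 * (partial_limit (b1 ^ 2 / a) b1 (b1 * b2 / a) (b1 * c1 / a) (b1 * c2 / a) (b1 * c3 / a) / qinf p ^ 2) +
    1 / b2 * (partial_limit (b2 ^ 2 / a) b2 (b1 * b2 / a) (b2 * c1 / a) (b2 * c2 / a) (b2 * c3 / a) / qinf p ^ 2) = 0"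
    (is "?L = 0") by (simp add: LIMSEQ_const_iff)
  hence z: "qinf u * qinf p ^ 2 * ?L = 0" by simp
  have "partial_limit A b b' c1 c2 c3 * qinf u = connection_coeff A b b' c1 c2 c3 * norm_series A b b' c1 c2 c3"
    if "p ^ 2 * A ^ 2 / (b * b' * c1 * c2 * c3) = u" for A b b' c1 c2 c3
    using that by (simp add: partial_limit_def connection_coeff_def norm_series_def)
  from this[OF u_def[symmetric]] this[OF u1[OF nz'(2)]] this[OF u1[OF nz'(3)]]
  have e: "qinf u * qinf p ^ 2 * ?L = 1 / a * (connection_coeff a b1 b2 c1 c2 c3 * norm_series a b1 b2 c1 c2 c3) +
    1 / b1 * (connection_coeff (b1 ^ 2 / a) b1 (b1 * b2 / a) (b1 * c1 / a) (b1 * c2 / a) (b1 * c3 / a) *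
      norm_series (b1 ^ 2 / a) b1 (b1 * b2 / a) (b1 * c1 / a) (b1 * c2 / a) (b1 * c3 / a)) +
    1 / b2 * (connection_coeff (b2 ^ 2 / a) b2 (b1 * b2 / a) (b2 * c1 / a) (b2 * c2 / a) (b2 * c3 / a) *
      norm_series (b2 ^ 2 / a) b2 (b1 * b2 / a) (b2 * c1 / a) (b2 * c2 / a) (b2 * c3 / a))"
  proof -
    have alg: "v * P ^ 2 * (1 / x * (X / P ^ 2) + 1 / y * (Y / P ^ 2) + 1 / z * (Z / P ^ 2)) =
        1 / x * X' + 1 / y * Y' + 1 / z * Z'"
      if "X * v = X'" "Y * v = Y'" "Z * v = Z'" "P \<noteq> 0" for v P x y z X Y Z X' Y' Z' :: complex
      unfolding that(1-3)[symmetric] using that(4) by (simp add: distrib_left mult_ac)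
    show ?thesis
      by (rule alg) (fact, fact, fact, rule qinf_p_nz)
  qed
  show ?thesis by (rule trans[OF e[symmetric] z])
qed


section \<open>Askey-Wilson parameters and duality\<close>

lemma reg_series_eq_W87:
  assumes nz: "a \<noteq> 0" "a \<noteq> 1"
    and q: "\<And>x. x \<in> {b, c, d, e, f} \<Longrightarrow> qinf (p * a / x) \<noteq> 0"
    and u: "norm (p ^ 2 * a ^ 2 / (b * c * d * e * f)) < 1"
  shows "reg_series a b c d e f = (1 - a) * qinf p * (qinf (p * a / b) * qinf (p * a / c) * qinf (p * a / d) * qinf (p * a / e) * qinf (p * a / f)) *
    W87 a [b, c, d, e, f] p (p ^ 2 * a ^ 2 / (b * c * d * e * f))"
proof -
  define C where "C = (1 - a) * qinf p * (qinf (p * a / b) * qinf (p * a / c) * qinf (p * a / d) * qinf (p * a / e) * qinf (p * a / f))"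
  define u where "u = p ^ 2 * a ^ 2 / (b * c * d * e * f)"
  define w where "w r = (1 - a * p ^ (2 * r)) / (1 - a) * u ^ r *
         (\<Prod>\<alpha>\<leftarrow>[a, b, c, d, e, f]. qpoch \<alpha> p r / qpoch (p * a / \<alpha>) p r)" for r
  have C: "C \<noteq> 0" using nz q qinf_p_nz by (simp add: C_def)
  have wp_factor: "wp_factor a x r = qinf (p * a / x) * (qpoch x p r / qpoch (p * a / x) p r)" if "x \<in> {b, c, d, e, f}" for x r
  proof -
    have "qinf (p * a / x) = qpoch (p * a / x) p r * qinf (p * a / x * p ^ r)" by (rule qinf_split)
    thus ?thesis using qpoch_nz[OF q[OF that], of r] by (simp add: wp_factor_def mult_ac)
  qed
  have vps: "wp_factor a b r = qinf (p * a / b) * (qpoch b p r / qpoch (p * a / b) p r)"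
    "wp_factor a c r = qinf (p * a / c) * (qpoch c p r / qpoch (p * a / c) p r)"
    "wp_factor a d r = qinf (p * a / d) * (qpoch d p r / qpoch (p * a / d) p r)"
    "wp_factor a e r = qinf (p * a / e) * (qpoch e p r / qpoch (p * a / e) p r)"
    "wp_factor a f r = qinf (p * a / f) * (qpoch f p r / qpoch (p * a / f) p r)" for r
    by (simp_all add: wp_factor)
  have summand: "reg_series_term a b c d e f r = C * w r" for r
  proof -
    have "qinf (p ^ Suc r) = qinf p / qpoch p p r"
      using qinf_split[of p r] qpoch_p_nz[of r] by simp
    thus ?thesis
      unfolding reg_series_term_def vwp_def vps w_def C_def u_def using nz by (simp add: mult_ac)
  qed
  have "summable (\<lambda>r. C * w r)" using reg_series_term_summable[OF u] by (simp add: summand[symmetric])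
  hence "summable w" using C by (simp add: summable_cmult_iff)
  hence "reg_series a b c d e f = C * (\<Sum>r. w r)" unfolding reg_series_def summand by (rule suminf_mult)
  thus ?thesis by (simp add: C_def w_def W87_def u_def)
qed

text \<open>Every argument that has to avoid the powers of \<open>p\<close> below is
  a real multiple of one of these monomials in \<open>X\<close> and \<open>Z\<close>.\<close>

definition generic :: "complex \<Rightarrow> complex \<Rightarrow> bool"
  where "generic X Z \<longleftrightarrow> X \<noteq> 0 \<and> Z \<noteq> 0 \<and> (\<forall>r m n. r \<in> \<real> \<longrightarrow> r \<noteq> 0 \<longrightarrow> \<bar>m\<bar> \<le> 2 \<longrightarrow> \<bar>n\<bar> \<le> 2 \<longrightarrow>
    m \<noteq> 0 \<or> n \<noteq> 0 \<longrightarrow> nonres (r * X powi m * Z powi n))"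

lemma generic_nonres:
  assumes "generic X Z" "y = r * X powi m * Z powi n" "r \<in> \<real>" "r \<noteq> 0" "\<bar>m\<bar> \<le> 2" "\<bar>n\<bar> \<le> 2" "m \<noteq> 0 \<or> n \<noteq> 0"
  shows "nonres y"
  using assms by (simp add: generic_def)

lemma generic_swap: "generic X Z \<Longrightarrow> generic Z X"
  unfolding generic_def by (metis mult.assoc mult.commute)

lemma generic_inverse:
  assumes "generic X Z"
  shows "generic X (1 / Z)"
proof -
  have "nonres (r * X powi m * (1 / Z) powi n)"
    if "r \<in> \<real>" "r \<noteq> 0" "\<bar>m\<bar> \<le> 2" "\<bar>n\<bar> \<le> 2" "m \<noteq> 0 \<or> n \<noteq> 0" for r m n
    by (rule generic_nonres[OF assms, of _ r m "- n"])
      (use that in \<open>auto simp: power_int_minus power_int_divide_distrib field_simps\<close>)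
  with assms show ?thesis by (auto simp: generic_def)
qed

end

text \<open>The relations among the Askey-Wilson parameters that the argument uses. They are
  self-dual by \<open>swap\<close>, so a second interpretation gives the dual of every result.
  Below, \<open>X\<close> and \<open>Z\<close> stand for q^x and q^z.\<close>

locale dual_parameters = q_base +
  fixes a b c d a' b' c' d' :: complex
  assumes real: "a \<in> \<real>" "b \<in> \<real>" "c \<in> \<real>" "d \<in> \<real>" "a' \<in> \<real>"
    and nonzero: "a \<noteq> 0" "b \<noteq> 0" "c \<noteq> 0" "d \<noteq> 0" "a' \<noteq> 0"
    and dual: "b' = a * b / a'" "c' = a * c / a'" "d' = a * d / a'" "p = a * b * c * d / a' ^ 2"
begin

lemma swap: "dual_parameters p a' b' c' d' a b c d"
proof unfold_locales
  show "p = a' * b' * c' * d' / a ^ 2"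
    using nonzero by (simp add: dual power2_eq_square)
qed (use real nonzero in \<open>auto simp: dual\<close>)

text \<open>The transform of the defining series of \<open>Psi\<close> for which the three-term relation yields the
  \<open>c\<close>-function.\<close>

definition Psi1 :: "complex \<Rightarrow> complex \<Rightarrow> complex"
  where "Psi1 X Z = norm_series (d * X * Z ^ 2) (d * X) (a' * Z) (d' * Z) (p * Z / b') (p * Z / c')"

text \<open>The nonterminating Askey-Wilson function, up to a factor.\<close>

definition EAW :: "complex \<Rightarrow> complex \<Rightarrow> complex"
  where "EAW X Z = norm_series (a' ^ 2 / (d * X)) (a' * Z) (a' / Z) (a / X) (c / X) (b / X)"

definition StX :: "complex \<Rightarrow> complex"
  where "StX X = qinf (p * X / a) * qinf (p * X / b) * qinf (p * X / c) * qinf (p * X / d)"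

definition StZ :: "complex \<Rightarrow> complex"
  where "StZ Z = qinf (p * Z / a') * qinf (p * Z / b') * qinf (p * Z / c') * qinf (p * Z / d')"

text \<open>The \<open>c\<close>-function without the factor 1/W, which is not a function of q^x and
  q^z.\<close>

definition cXZ :: "complex \<Rightarrow> complex \<Rightarrow> complex"
  where "cXZ X Z = theta1 (a' / Z) * theta1 (b' / Z) * theta1 (c' / Z) * theta1 (d * X / (a' * Z)) / (theta1 (1 / Z ^ 2) * theta1 (d * X))"

text \<open>Invariant under duality with \<open>X\<close> and \<open>Z\<close> exchanged, so it
  cancels when the two expansions are equated.\<close>

definition EAW_factor :: "complex \<Rightarrow> complex \<Rightarrow> complex"
  where "EAW_factor X Z = qinf (p / (d' * Z)) * qinf (p * Z / d') * qinf (p / (d * X)) * qinf (p * X / d)"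

lemma EAW_expansion:
  assumes "generic X Z" and u: "norm (p * X / d) < 1"
  shows "EAW X Z = EAW_factor X Z *
    (cXZ X Z / (StX X * StZ Z) * Psi1 X Z + cXZ X (1 / Z) / (StX X * StZ (1 / Z)) * Psi1 X (1 / Z))"
proof -
  have X: "X \<noteq> 0" and Z: "Z \<noteq> 0" using assms by (auto simp: generic_def)
  note G = generic_nonres[OF assms(1)]
  note nz = nonzero X Z
  have real': "b' \<in> \<real>" "c' \<in> \<real>" "d' \<in> \<real>" "p \<in> \<real>" "b' \<noteq> 0" "c' \<noteq> 0" "d' \<noteq> 0"
    using real nonzero by (simp_all add: dual)
  note S = field_simps power_int_minus power2_eq_square
  \<comment> \<open>With these base points the three series of the relation are
    \<open>Psi1 X Z\<close>, its image under Z -> 1/Z, and \<open>EAW X Z\<close>; see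
    \<open>NN\<close>.\<close>
  let ?a = "d * X * Z ^ 2" and ?b1 = "d * X" and ?b2 = "a' * Z" and ?c1 = "d' * Z" and ?c2 = "p * Z / b'" and ?c3 = "p * Z / c'"
  have r1: "?b1 ^ 2 / ?a = d * X * (1 / Z) ^ 2" "?b1 * ?b2 / ?a = a' * (1 / Z)" "?b1 * ?c1 / ?a = d' * (1 / Z)"
    "?b1 * ?c2 / ?a = p * (1 / Z) / b'" "?b1 * ?c3 / ?a = p * (1 / Z) / c'"
    using nz real' by (simp_all add: power2_eq_square)
  have r2: "?b2 ^ 2 / ?a = a' ^ 2 / (d * X)" "?b2 * ?c1 / ?a = a / X" "?b2 * ?c2 / ?a = c / X" "?b2 * ?c3 / ?a = b / X"
    using nz p_nz real' by (simp_all add: dual power2_eq_square)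
  have three: "1 / ?a * (connection_coeff ?a ?b1 ?b2 ?c1 ?c2 ?c3 * norm_series ?a ?b1 ?b2 ?c1 ?c2 ?c3) +
    1 / ?b1 * (connection_coeff (?b1 ^ 2 / ?a) ?b1 (?b1 * ?b2 / ?a) (?b1 * ?c1 / ?a) (?b1 * ?c2 / ?a) (?b1 * ?c3 / ?a) *
      norm_series (?b1 ^ 2 / ?a) ?b1 (?b1 * ?b2 / ?a) (?b1 * ?c1 / ?a) (?b1 * ?c2 / ?a) (?b1 * ?c3 / ?a)) +
    1 / ?b2 * (connection_coeff (?b2 ^ 2 / ?a) ?b2 (?b1 * ?b2 / ?a) (?b2 * ?c1 / ?a) (?b2 * ?c2 / ?a) (?b2 * ?c3 / ?a) *
      norm_series (?b2 ^ 2 / ?a) ?b2 (?b1 * ?b2 / ?a) (?b2 * ?c1 / ?a) (?b2 * ?c2 / ?a) (?b2 * ?c3 / ?a)) = 0"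
  proof (rule norm_series_three_term)
    show "nonres ?a" by (rule G[of _ d 1 2]) (use nz real in \<open>simp_all\<close>)
    show "nonres (?b1 ^ 2 / ?a)" by (rule G[of _ d 1 "-2"]) (use nz real in \<open>simp_all add: S\<close>)
    show "nonres (?b2 ^ 2 / ?a)" by (rule G[of _ "a' ^ 2 / d" "-1" 0]) (use nz real in \<open>simp_all add: S\<close>)
    show "nonres ?b1" by (rule G[of _ d 1 0]) (use nz real in \<open>simp_all\<close>)
    show "nonres ?b2" by (rule G[of _ a' 0 1]) (use nz real in \<open>simp_all\<close>)
    show "nonres (?b1 / ?a)" by (rule G[of _ 1 0 "-2"]) (use nz real in \<open>simp_all add: S\<close>)
    show "nonres (?b2 / ?a)" by (rule G[of _ "a' / d" "-1" "-1"]) (use nz real in \<open>simp_all add: S\<close>)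
    show "nonres (?b1 * ?b2 / ?a)" by (rule G[of _ "a'" 0 "-1"]) (use nz real in \<open>simp_all add: S\<close>)
    show "nonres (?b2 / ?b1)" by (rule G[of _ "a' / d" "-1" 1]) (use nz real in \<open>simp_all add: S\<close>)
    have "p ^ 2 * ?a ^ 2 / (?b1 * ?b2 * ?c1 * ?c2 * ?c3) = p * X / d"
      using nz p_nz real' by (simp add: dual power2_eq_square)
    thus "norm (p ^ 2 * ?a ^ 2 / (?b1 * ?b2 * ?c1 * ?c2 * ?c3)) < 1" using u by simp
  qed (use nz p_nz real' in auto)
  \<comment> \<open>The coefficients of the two \<open>Psi1\<close> series contain
    \<open>theta1\<close> at 1/y1 and 1/y2. Inverting it gives the minus sign that moves them to the
    other side of the relation, and a factor that equalizes the prefactors.\<close>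
  define y1 where "y1 = d * X * Z / a'"
  define y2 where "y2 = d * X / (a' * Z)"
  have cc0: "connection_coeff ?a ?b1 ?b2 ?c1 ?c2 ?c3 = qinf (p / (d' * Z)) * qinf (b' / Z) * qinf (c' / Z) /
      (qinf (d * X) * qinf (a' * Z) * theta1 (1 / Z ^ 2) * (- theta1 y1 / y1))"
  proof -
    have "p / ?c2 = b' / Z" "p / ?c3 = c' / Z" "?b1 / ?a = 1 / Z ^ 2" "?b2 / ?a = 1 / y1"
      using nz p_nz real' by (simp_all add: y1_def power2_eq_square)
    moreover have "theta1 (1 / y1) = - theta1 y1 / y1" using nz by (intro theta1_inverse) (simp add: y1_def)
    ultimately show ?thesis unfolding connection_coeff_def by (simp only:)
  qed
  have cc1: "connection_coeff (?b1 ^ 2 / ?a) ?b1 (?b1 * ?b2 / ?a) (?b1 * ?c1 / ?a) (?b1 * ?c2 / ?a) (?b1 * ?c3 / ?a) =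
      qinf (p * Z / d') * qinf (b' * Z) * qinf (c' * Z) / (qinf (d * X) * qinf (a' / Z) * theta1 (Z ^ 2) * (- theta1 y2 / y2))"
  proof -
    have "p / (?b1 * ?c1 / ?a) = p * Z / d'" "p / (?b1 * ?c2 / ?a) = b' * Z" "p / (?b1 * ?c3 / ?a) = c' * Z"
      "?b1 / (?b1 ^ 2 / ?a) = Z ^ 2" "?b1 * ?b2 / ?a / (?b1 ^ 2 / ?a) = 1 / y2" "?b1 * ?b2 / ?a = a' / Z"
      using nz p_nz real' by (simp_all add: y2_def power2_eq_square)
    moreover have "theta1 (1 / y2) = - theta1 y2 / y2" using nz by (intro theta1_inverse) (simp add: y2_def)
    ultimately show ?thesis unfolding connection_coeff_def by (simp only:)
  qed
  have cc2: "connection_coeff (?b2 ^ 2 / ?a) ?b2 (?b1 * ?b2 / ?a) (?b2 * ?c1 / ?a) (?b2 * ?c2 / ?a) (?b2 * ?c3 / ?a) =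
      qinf (p * X / a) * qinf (p * X / c) * qinf (p * X / b) / (qinf (a' * Z) * qinf (a' / Z) * theta1 y1 * theta1 y2)"
  proof -
    have "?b2 / (?b2 ^ 2 / ?a) = y1" "?b1 * ?b2 / ?a / (?b2 ^ 2 / ?a) = y2" "?b1 * ?b2 / ?a = a' / Z"
      using nz p_nz real' by (simp_all add: y1_def y2_def power2_eq_square)
    moreover have "p / (a / X) = p * X / a" "p / (c / X) = p * X / c" "p / (b / X) = p * X / b" by simp_all
    ultimately show ?thesis unfolding connection_coeff_def r2 by (simp only:)
  qed
  have NN: "norm_series ?a ?b1 ?b2 ?c1 ?c2 ?c3 = Psi1 X Z"
    "norm_series (?b1 ^ 2 / ?a) ?b1 (?b1 * ?b2 / ?a) (?b1 * ?c1 / ?a) (?b1 * ?c2 / ?a) (?b1 * ?c3 / ?a) = Psi1 X (1 / Z)"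
    "norm_series (?b2 ^ 2 / ?a) ?b2 (?b1 * ?b2 / ?a) (?b2 * ?c1 / ?a) (?b2 * ?c2 / ?a) (?b2 * ?c3 / ?a) = EAW X Z"
    unfolding Psi1_def EAW_def r2 unfolding r1 by simp_all
  have q: "qinf y \<noteq> 0" if "y = r * X powi m * Z powi n" "r \<in> \<real>" "r \<noteq> 0" "\<bar>m\<bar> \<le> 2" "\<bar>n\<bar> \<le> 2" "m \<noteq> 0 \<or> n \<noteq> 0" for y r m n
    using nonres_qinf[OF G[OF that]] .
  have Q: "qinf (p / (d' * Z)) \<noteq> 0" "qinf (p * Z / d') \<noteq> 0" "qinf (p / (d * X)) \<noteq> 0" "qinf (p * X / d) \<noteq> 0"
    "qinf (d * X) \<noteq> 0" "qinf (a' * Z) \<noteq> 0" "qinf (a' / Z) \<noteq> 0"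
    "qinf (p * X / a) \<noteq> 0" "qinf (p * X / b) \<noteq> 0" "qinf (p * X / c) \<noteq> 0"
    "qinf (p * Z / a') \<noteq> 0" "qinf (p * Z / b') \<noteq> 0" "qinf (p * Z / c') \<noteq> 0"
    "qinf (p / (a' * Z)) \<noteq> 0" "qinf (p / (b' * Z)) \<noteq> 0" "qinf (p / (c' * Z)) \<noteq> 0"
    subgoal by (rule q[of _ "p / d'" 0 "-1"]) (use nz p_nz real' in \<open>simp_all add: S\<close>)
    subgoal by (rule q[of _ "p / d'" 0 "1"]) (use nz p_nz real' in \<open>simp_all add: S\<close>)
    subgoal by (rule q[of _ "p / d" "-1" 0]) (use nz p_nz real real' in \<open>simp_all add: S\<close>)
    subgoal by (rule q[of _ "p / d" "1" 0]) (use nz p_nz real real' in \<open>simp_all add: S\<close>)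
    subgoal by (rule q[of _ "d" "1" 0]) (use nz p_nz real real' in \<open>simp_all add: S\<close>)
    subgoal by (rule q[of _ "a'" "0" 1]) (use nz p_nz real real' in \<open>simp_all add: S\<close>)
    subgoal by (rule q[of _ "a'" "0" "-1"]) (use nz p_nz real real' in \<open>simp_all add: S\<close>)
    subgoal by (rule q[of _ "p / a" "1" 0]) (use nz p_nz real real' in \<open>simp_all add: S\<close>)
    subgoal by (rule q[of _ "p / b" "1" 0]) (use nz p_nz real real' in \<open>simp_all add: S\<close>)
    subgoal by (rule q[of _ "p / c" "1" 0]) (use nz p_nz real real' in \<open>simp_all add: S\<close>)
    subgoal by (rule q[of _ "p / a'" 0 "1"]) (use nz p_nz real real' in \<open>simp_all add: S\<close>)
    subgoal by (rule q[of _ "p / b'" 0 "1"]) (use nz p_nz real real' in \<open>simp_all add: S\<close>)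
    subgoal by (rule q[of _ "p / c'" 0 "1"]) (use nz p_nz real real' in \<open>simp_all add: S\<close>)
    subgoal by (rule q[of _ "p / a'" 0 "-1"]) (use nz p_nz real real' in \<open>simp_all add: S\<close>)
    subgoal by (rule q[of _ "p / b'" 0 "-1"]) (use nz p_nz real real' in \<open>simp_all add: S\<close>)
    subgoal by (rule q[of _ "p / c'" 0 "-1"]) (use nz p_nz real real' in \<open>simp_all add: S\<close>)
    done
  have T: "theta1 y1 \<noteq> 0" "theta1 y2 \<noteq> 0" "theta1 (1 / Z ^ 2) \<noteq> 0" "theta1 (Z ^ 2) \<noteq> 0"
    unfolding y1_def y2_def
    subgoal by (intro nonres_theta1 G[of _ "d / a'" 1 1]) (use nz p_nz real real' in \<open>simp_all add: S\<close>)
    subgoal by (intro nonres_theta1 G[of _ "d / a'" 1 "-1"]) (use nz p_nz real real' in \<open>simp_all add: S\<close>)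
    subgoal by (intro nonres_theta1 G[of _ 1 0 "-2"]) (use nz p_nz real real' in \<open>simp_all add: S\<close>)
    subgoal by (intro nonres_theta1 G[of _ 1 0 "2"]) (use nz p_nz real real' in \<open>simp_all add: S\<close>)
    done
  have rew: "a' / (1 / Z) = a' * Z" "b' / (1 / Z) = b' * Z" "c' / (1 / Z) = c' * Z" "d * X / (a' * (1 / Z)) = y1"
     "1 / (1 / Z) ^ 2 = Z ^ 2" "p * (1 / Z) / a' = p / (a' * Z)" "p * (1 / Z) / b' = p / (b' * Z)"
     "p * (1 / Z) / c' = p / (c' * Z)" "p * (1 / Z) / d' = p / (d' * Z)"
    using nz by (simp_all add: y1_def power2_eq_square mult.commute)
  have thr: "theta1 (a' / Z) = qinf (a' / Z) * qinf (p * Z / a')" "theta1 (b' / Z) = qinf (b' / Z) * qinf (p * Z / b')"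
    "theta1 (c' / Z) = qinf (c' / Z) * qinf (p * Z / c')" "theta1 (d * X) = qinf (d * X) * qinf (p / (d * X))"
    "theta1 (a' * Z) = qinf (a' * Z) * qinf (p / (a' * Z))" "theta1 (b' * Z) = qinf (b' * Z) * qinf (p / (b' * Z))"
    "theta1 (c' * Z) = qinf (c' * Z) * qinf (p / (c' * Z))"
    by (simp_all add: theta1_def)
  \<comment> \<open>Field arithmetic, with all products as free variables. The conditions on
    \<open>x1\<close> and \<open>x2\<close> stand for \<open>y1 * ?b2 = ?a\<close> and
    \<open>y2 * ?b2 = ?b1\<close>, by which the three prefactors reduce to the last one.\<close>
  have alg: "E = q1 * q2 * D' * Sd * ((A1 * Pa) * (B1 * Pb) * (C1 * Pc) * t2 / (s1 * (D * D')) / ((Sa * Sb * Sc * Sd) * (Pa * Pb * Pc * q2)) * \<psi> +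
      (A2 * Ra) * (B2 * Rb) * (C2 * Rc) * t1 / (s2 * (D * D')) / ((Sa * Sb * Sc * Sd) * (Ra * Rb * Rc * q1)) * \<psi>')"
    if e: "1 / \<alpha> * (q1 * B1 * C1 / (D * A2 * s1 * (- t1 / x1)) * \<psi>) +
       1 / \<beta> * (q2 * B2 * C2 / (D * A1 * s2 * (- t2 / x2)) * \<psi>') +
       1 / \<gamma> * (Sa * Sc * Sb / (A2 * A1 * t1 * t2) * E) = 0"
     and x: "x1 * \<gamma> = \<alpha>" "x2 * \<gamma> = \<beta>"
     and n: "q1 \<noteq> 0" "q2 \<noteq> 0" "D' \<noteq> 0" "Sd \<noteq> 0" "D \<noteq> 0" "A2 \<noteq> 0" "A1 \<noteq> 0" "Sa \<noteq> 0" "Sb \<noteq> 0" "Sc \<noteq> 0" "Pa \<noteq> 0" "Pb \<noteq> 0" "Pc \<noteq> 0" "Ra \<noteq> 0" "Rb \<noteq> 0" "Rc \<noteq> 0"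
       "t1 \<noteq> 0" "t2 \<noteq> 0" "s1 \<noteq> 0" "s2 \<noteq> 0" "\<gamma> \<noteq> 0" "x1 \<noteq> 0" "x2 \<noteq> 0"
    for E q1 q2 D' Sd A1 Pa B1 Pb C1 Pc t2 s1 D Sa Sb Sc \<psi> A2 Ra B2 Rb C2 Rc t1 s2 \<psi>' \<alpha> \<beta> \<gamma> x1 x2 :: complex
  proof -
    have "1 / \<alpha> * (q1 * B1 * C1 / (D * A2 * s1 * (- t1 / x1)) * \<psi>) = - (q1 * B1 * C1 / (D * A2 * s1 * t1) * \<psi>) / \<gamma>"
      unfolding x(1)[symmetric] using n by (simp add: mult_ac)
    moreover have "1 / \<beta> * (q2 * B2 * C2 / (D * A1 * s2 * (- t2 / x2)) * \<psi>') = - (q2 * B2 * C2 / (D * A1 * s2 * t2) * \<psi>') / \<gamma>"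
      unfolding x(2)[symmetric] using n by (simp add: mult_ac)
    ultimately have "(- (q1 * B1 * C1 / (D * A2 * s1 * t1) * \<psi>) - (q2 * B2 * C2 / (D * A1 * s2 * t2) * \<psi>') +
       Sa * Sc * Sb / (A2 * A1 * t1 * t2) * E) / \<gamma> = 0"
      using e by (simp add: add_divide_distrib diff_divide_distrib mult_ac)
    moreover have "v = x + y" if "(- x - y + v) / \<gamma> = 0" for x y v
    proof -
      from that n(21) have "- x - y + v = 0" by simp
      thus ?thesis by algebra
    qed
    ultimately have "Sa * Sc * Sb / (A2 * A1 * t1 * t2) * E = q1 * B1 * C1 / (D * A2 * s1 * t1) * \<psi> + q2 * B2 * C2 / (D * A1 * s2 * t2) * \<psi>'"
      by blast
    moreover have "y = r * t / s'" if "s' / t * y = r" "s' \<noteq> 0" "t \<noteq> 0" for s' t y r :: complex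
      using that by (simp add: field_simps)
    ultimately have "E = (q1 * B1 * C1 / (D * A2 * s1 * t1) * \<psi> + q2 * B2 * C2 / (D * A1 * s2 * t2) * \<psi>') * (A2 * A1 * t1 * t2) / (Sa * Sc * Sb)"
      using n by (metis (no_types, lifting) no_zero_divisors)
    also have "\<dots> = q1 * B1 * C1 * A1 * t2 / (D * s1 * (Sa * Sc * Sb)) * \<psi> + q2 * B2 * C2 * A2 * t1 / (D * s2 * (Sa * Sc * Sb)) * \<psi>'"
      using n by (simp only: distrib_right add_divide_distrib) (simp add: mult_ac)
    also have "\<dots> = q1 * q2 * D' * Sd * ((A1 * Pa) * (B1 * Pb) * (C1 * Pc) * t2 / (s1 * (D * D')) / ((Sa * Sb * Sc * Sd) * (Pa * Pb * Pc * q2)) * \<psi> +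
      (A2 * Ra) * (B2 * Rb) * (C2 * Rc) * t1 / (s2 * (D * D')) / ((Sa * Sb * Sc * Sd) * (Ra * Rb * Rc * q1)) * \<psi>')"
      using n by (simp add: distrib_left mult_ac)
    finally show ?thesis .
  qed
  show ?thesis
    unfolding EAW_factor_def cXZ_def StX_def StZ_def rew thr y2_def[symmetric]
    by (rule alg[OF three[unfolded cc0 cc1 cc2 NN]])
      (use Q T nz in \<open>simp_all add: y1_def y2_def power2_eq_square\<close>)
qed

text \<open>One two-term transformation, with the triple (a' Z, b / X, c / X): it carries the base
  a'^2 / (d X) to a^2 / (d' Z), the base of the dual function. The two norm conditions concern the
  arguments of the two series.\<close>

lemma EAW_dual:
  assumes "generic X Z" and u: "norm (p * X / d) < 1" "norm (p * Z / d') < 1"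
  shows "EAW X Z = dual_parameters.EAW p a' b' c' d' a Z X"
proof -
  interpret D: dual_parameters p a' b' c' d' a b c d by (rule swap)
  have X: "X \<noteq> 0" and Z: "Z \<noteq> 0" using assms by (auto simp: generic_def)
  note G = generic_nonres[OF assms(1)]
  note nz = nonzero X Z
  have real': "b' \<in> \<real>" "c' \<in> \<real>" "d' \<in> \<real>" "p \<in> \<real>" "b' \<noteq> 0" "c' \<noteq> 0" "d' \<noteq> 0"
    using real nonzero by (simp_all add: dual)
  note S = field_simps power_int_minus power2_eq_square
  let ?a = "a' ^ 2 / (d * X)"
  define l where "l = a ^ 2 / (d' * Z)"
  have l: "p * ?a ^ 2 / ((a' * Z) * (b / X) * (c / X)) = l"
    using nz by (simp add: l_def dual power2_eq_square)
  have "EAW X Z = norm_series ?a (a' * Z) (b / X) (c / X) (a' / Z) (a / X)"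
    unfolding EAW_def by (simp add: norm_series_def reg_series_def reg_series_term_def mult_ac)
  also have "\<dots> = norm_series l (l * (a' * Z) / ?a) (l * (b / X) / ?a) (l * (c / X) / ?a) (a' / Z) (a / X)"
    unfolding l[symmetric]
  proof (rule norm_series_transformation)
    show "nonres ?a" by (rule G[of _ "a' ^ 2 / d" "-1" 0]) (use nz real in \<open>simp_all add: S\<close>)
    show "nonres (p * ?a ^ 2 / ((a' * Z) * (b / X) * (c / X)))"
      unfolding l l_def by (rule G[of _ "a ^ 2 / d'" 0 "-1"]) (use nz real real' in \<open>simp_all add: S\<close>)
    show "a' * Z \<noteq> 0" "b / X \<noteq> 0" "c / X \<noteq> 0" "a' / Z \<noteq> 0" "a / X \<noteq> 0" using nz by simp_all
    have "p ^ 2 * ?a ^ 2 / (a' * Z * (b / X) * (c / X) * (a' / Z) * (a / X)) = p * X / d"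
      using nz by (simp add: dual power2_eq_square)
    thus "norm (p ^ 2 * ?a ^ 2 / (a' * Z * (b / X) * (c / X) * (a' / Z) * (a / X))) < 1" using u by simp
    have "?a * p / ((a' / Z) * (a / X)) = p * Z / d'" using nz by (simp add: dual power2_eq_square)
    thus "norm (?a * p / ((a' / Z) * (a / X))) < 1" using u by simp
  qed
  also have "\<dots> = D.EAW Z X"
  proof -
    have "l * (a' * Z) / ?a = a * X" "l * (b / X) / ?a = b' / Z" "l * (c / X) / ?a = c' / Z"
      using nz by (simp_all add: l_def dual power2_eq_square)
    thus ?thesis unfolding D.EAW_def by (simp add: l_def norm_series_def reg_series_def reg_series_term_def mult_ac)
  qed
  finally show ?thesis .
qed


section \<open>The defining series of \<open>Psi\<close> and its two transforms\<close>

definition Psi0 :: "complex \<Rightarrow> complex \<Rightarrow> complex"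
  where "Psi0 X Z = norm_series (p * X * Z ^ 2 / d) (p * Z / a') (p * Z / d') (b' * Z) (c' * Z) (p * X / d)"

lemma real_dual: "b' \<in> \<real>" "c' \<in> \<real>" "d' \<in> \<real>" "p \<in> \<real>" "b' \<noteq> 0" "c' \<noteq> 0" "d' \<noteq> 0"
  using real nonzero by (simp_all add: dual)

lemma qpoch_inf_eq: "qpoch_inf [y] p = qinf y"
  by (simp add: qpoch_inf_def qinf_def)

lemma qpoch_inf_Cons: "qpoch_inf (y # ys) p = qinf y * qpoch_inf ys p"
  by (simp add: qpoch_inf_def qinf_def)

lemma qpoch_inf_Nil: "qpoch_inf [] p = 1"
  by (simp add: qpoch_inf_def)

lemma theta_Nil: "theta [] p = 1" and theta_Cons: "theta (y # ys) p = theta1 y * theta ys p"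
  by (simp_all add: theta_def theta1_def qpoch_inf_def qinf_def)

text \<open>At generic points the side conditions of \<open>is_Psi\<close> hold, and the prescribed
  formula can be rewritten in the normalization in which transformations are invariances.\<close>

lemma Psi0_series:
  assumes gXZ: "generic X Z" and u: "norm (d * X) < 1"
  defines "\<alpha>0 \<equiv> p * X * Z ^ 2 / d" and "\<alpha>s \<equiv> [p * Z / a', p * Z / d', b' * Z, c' * Z, p * X / d]"
  shows "qpoch_inf [p ^ 2 * X * Z ^ 2 / d] p \<noteq> 0" "W87_defined \<alpha>0 \<alpha>s p"
    "qpoch_inf [p * X * Z * a / a', p * X * Z * b / a', p * X * Z * c / a', p * X * Z * a' / d, p * Z ^ 2, d * X] p /
       qpoch_inf [p ^ 2 * X * Z ^ 2 / d] p * W87 \<alpha>0 \<alpha>s p (d * X) = Psi0 X Z / qinf p"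
proof -
  have X: "X \<noteq> 0" and Z: "Z \<noteq> 0" using gXZ by (auto simp: generic_def)
  note G = generic_nonres[OF gXZ]
  note nz = nonzero X Z p_nz
  note S = field_simps power_int_minus power2_eq_square
  have g: "nonres (p ^ 2 * X * Z ^ 2 / d)" "nonres \<alpha>0" "nonres (p * X * Z * a / a')" "nonres (p * X * Z * b / a')" "nonres (p * X * Z * c / a')"
     "nonres (p * X * Z * a' / d)" "nonres (p * Z ^ 2)" "nonres (d * X)"
    unfolding \<alpha>0_def
    subgoal by (rule G[of _ "p ^ 2 / d" 1 2]) (use nz real real_dual in \<open>simp_all\<close>)
    subgoal by (rule G[of _ "p / d" 1 2]) (use nz real real_dual in \<open>simp_all\<close>)
    subgoal by (rule G[of _ "p * a / a'" 1 1]) (use nz real real_dual in \<open>simp_all\<close>)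
    subgoal by (rule G[of _ "p * b / a'" 1 1]) (use nz real real_dual in \<open>simp_all\<close>)
    subgoal by (rule G[of _ "p * c / a'" 1 1]) (use nz real real_dual in \<open>simp_all\<close>)
    subgoal by (rule G[of _ "p * a' / d" 1 1]) (use nz real real_dual in \<open>simp_all\<close>)
    subgoal by (rule G[of _ "p" 0 2]) (use nz real real_dual in \<open>simp_all\<close>)
    subgoal by (rule G[of _ d 1 0]) (use nz real real_dual in \<open>simp_all\<close>)
    done
  note qg = g[THEN nonres_qinf]
  show q0: "qpoch_inf [p ^ 2 * X * Z ^ 2 / d] p \<noteq> 0" using qg by (simp add: qpoch_inf_eq)
  have r: "p * \<alpha>0 / (p * Z / a') = p * X * Z * a' / d" "p * \<alpha>0 / (p * Z / d') = p * X * Z * a / a'"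
     "p * \<alpha>0 / (b' * Z) = p * X * Z * c / a'" "p * \<alpha>0 / (c' * Z) = p * X * Z * b / a'"
     "p * \<alpha>0 / (p * X / d) = p * Z ^ 2" "p * \<alpha>0 = p ^ 2 * X * Z ^ 2 / d"
    using nz by (simp_all add: \<alpha>0_def dual power2_eq_square mult_ac)
  have q: "qinf (p * \<alpha>0 / x) \<noteq> 0" if "x \<in> {p * Z / a', p * Z / d', b' * Z, c' * Z, p * X / d}" for x
    using that qg by - (elim insertE emptyE; hypsubst; unfold r(1-5); assumption)
  have a1: "\<alpha>0 \<noteq> 0" "\<alpha>0 \<noteq> 1" using g(2) nonres_neq_1[OF g(2), of 0] by (auto simp: nonres_def)
  show "W87_defined \<alpha>0 \<alpha>s p"
    unfolding W87_defined_def
  proof (intro conjI ballI allI)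
    fix \<alpha> k assume \<alpha>: "\<alpha> \<in> set (\<alpha>0 # \<alpha>s)"
    show "\<alpha> \<noteq> 0" using \<alpha> a1 nz real_dual by (auto simp: \<alpha>s_def)
    show "qpoch (p * \<alpha>0 / \<alpha>) p k \<noteq> 0"
      using \<alpha> a1 q by (intro qpoch_nz) (auto simp: \<alpha>s_def qinf_p_nz)
  qed (use a1 in auto)
  have u': "p ^ 2 * \<alpha>0 ^ 2 / (p * Z / a' * (p * Z / d') * (b' * Z) * (c' * Z) * (p * X / d)) = d * X"
    using nz by (simp add: \<alpha>0_def dual power2_eq_square mult_ac)
  have "reg_series \<alpha>0 (p * Z / a') (p * Z / d') (b' * Z) (c' * Z) (p * X / d) =
     (1 - \<alpha>0) * qinf p * (qinf (p * X * Z * a' / d) * qinf (p * X * Z * a / a') * qinf (p * X * Z * c / a') *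
       qinf (p * X * Z * b / a') * qinf (p * Z ^ 2)) * W87 \<alpha>0 \<alpha>s p (d * X)"
    unfolding r(1-5)[symmetric] u'[symmetric] \<alpha>s_def by (rule reg_series_eq_W87[OF a1 q]) (simp_all only: u' u)
  moreover have "qinf \<alpha>0 = (1 - \<alpha>0) * qinf (p ^ 2 * X * Z ^ 2 / d)"
    using qinf_split[of \<alpha>0 1] r(6) by (simp add: qpoch_Suc mult.commute)
  ultimately show "qpoch_inf [p * X * Z * a / a', p * X * Z * b / a', p * X * Z * c / a', p * X * Z * a' / d, p * Z ^ 2, d * X] p /
       qpoch_inf [p ^ 2 * X * Z ^ 2 / d] p * W87 \<alpha>0 \<alpha>s p (d * X) = Psi0 X Z / qinf p"
    unfolding Psi0_def norm_series_def \<alpha>0_def[symmetric] u' qpoch_inf_Cons qpoch_inf_Nil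
    using a1 qg qinf_p_nz by simp
qed

text \<open>\<open>norm_series_inversion\<close> with p X / d as the distinguished parameter: it
  exchanges that with the argument d X. The intermediate series has argument a X. All conditions of
  smallness concern \<open>X\<close>, so \<open>Z\<close> may be replaced by 1/Z.\<close>

lemma Psi0_eq_Psi1:
  assumes gXZ: "generic X Z" and u: "norm (d * X) < 1" "norm (p * X / d) < 1" "norm (a * X) < 1"
  shows "Psi0 X Z = Psi1 X Z"
proof -
  have X: "X \<noteq> 0" and Z: "Z \<noteq> 0" using gXZ by (auto simp: generic_def)
  note G = generic_nonres[OF gXZ]
  note nz = nonzero X Z p_nz
  let ?a = "p * X * Z ^ 2 / d" and ?b = "p * X / d" and ?c = "b' * Z" and ?d = "c' * Z" and ?e = "p * Z / a'" and ?f = "p * Z / d'"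
  have l: "p * ?a ^ 2 / (?b * ?c * ?d) = p ^ 2 / (d * b' * c') * X * Z ^ 2"
    using nz real_dual by (simp add: power2_eq_square mult_ac)
  have u': "p ^ 2 * ?a ^ 2 / (?b * ?c * ?d * ?e * ?f) = d * X"
    using nz by (simp add: dual power2_eq_square mult_ac)
  have ua: "d * X * ?a / ?b = d * X * Z ^ 2" using nz by simp
  have "Psi0 X Z = norm_series ?a ?b ?c ?d ?e ?f"
    unfolding Psi0_def by (simp add: norm_series_def reg_series_def reg_series_term_def mult_ac)
  also have "\<dots> = norm_series (d * X * ?a / ?b) (d * X) (?a * p / (?b * ?c)) (?a * p / (?b * ?d)) (?a * p / (?b * ?e)) (?a * p / (?b * ?f))"
    unfolding u'[symmetric]
  proof (rule norm_series_inversion)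
    show "nonres ?a" by (rule G[of _ "p / d" 1 2]) (use nz real real_dual in simp_all)
    show "nonres (p * ?a ^ 2 / (?b * ?c * ?d))"
      unfolding l by (rule G[of _ "p ^ 2 / (d * b' * c')" 1 2]) (use nz real real_dual in simp_all)
    show "nonres (p ^ 2 * ?a ^ 2 / (?b * ?c * ?d * ?e * ?f) * ?a / ?b)"
      unfolding u' ua by (rule G[of _ d 1 2]) (use nz real real_dual in simp_all)
    show "norm (p ^ 2 * ?a ^ 2 / (?b * ?c * ?d * ?e * ?f)) < 1" unfolding u' by (rule u)
    have "?a * p / (?e * ?f) = a * X" using nz by (simp add: dual power2_eq_square mult_ac)
    thus "norm (?a * p / (?e * ?f)) < 1" using u by simp
  qed (use nz real_dual u in simp_all)
  also have "\<dots> = Psi1 X Z"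
  proof -
    have "?a * p / (?b * ?c) = p * Z / b'" "?a * p / (?b * ?d) = p * Z / c'" "?a * p / (?b * ?e) = a' * Z" "?a * p / (?b * ?f) = d' * Z"
      using nz real_dual by (simp_all add: power2_eq_square mult_ac)
    thus ?thesis unfolding ua Psi1_def by (simp add: norm_series_def reg_series_def reg_series_term_def mult_ac)
  qed
  finally show ?thesis .
qed

text \<open>The same inversion with p Z / d' as the distinguished parameter, which becomes the new
  argument; the intermediate argument is a' Z.\<close>

lemma Psi0_eq_dual_Psi1:
  assumes gXZ: "generic X Z" and u: "norm (d * X) < 1" "norm (p * Z / d') < 1" "norm (a' * Z) < 1"
  shows "Psi0 X Z = dual_parameters.Psi1 p d' a b c d Z X"
proof -
  interpret D: dual_parameters p a' b' c' d' a b c d by (rule swap)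
  have X: "X \<noteq> 0" and Z: "Z \<noteq> 0" using gXZ by (auto simp: generic_def)
  note G = generic_nonres[OF gXZ]
  note nz = nonzero X Z p_nz
  let ?a = "p * X * Z ^ 2 / d" and ?b = "p * Z / d'" and ?c = "b' * Z" and ?d = "c' * Z" and ?e = "p * Z / a'" and ?f = "p * X / d"
  have l: "p * ?a ^ 2 / (?b * ?c * ?d) = p ^ 2 * d' / (d ^ 2 * b' * c') * X ^ 2 * Z"
    using nz real_dual by (simp add: power2_eq_square mult_ac)
  have u': "p ^ 2 * ?a ^ 2 / (?b * ?c * ?d * ?e * ?f) = d * X"
    using nz by (simp add: dual power2_eq_square mult_ac)
  have ua: "d * X * ?a / ?b = d' * X ^ 2 * Z" using nz by (simp add: power2_eq_square mult_ac)
  have "Psi0 X Z = norm_series ?a ?b ?c ?d ?e ?f"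
    unfolding Psi0_def by (simp add: norm_series_def reg_series_def reg_series_term_def mult_ac)
  also have "\<dots> = norm_series (d * X * ?a / ?b) (d * X) (?a * p / (?b * ?c)) (?a * p / (?b * ?d)) (?a * p / (?b * ?e)) (?a * p / (?b * ?f))"
    unfolding u'[symmetric]
  proof (rule norm_series_inversion)
    show "nonres ?a" by (rule G[of _ "p / d" 1 2]) (use nz real real_dual in simp_all)
    show "nonres (p * ?a ^ 2 / (?b * ?c * ?d))"
      unfolding l by (rule G[of _ "p ^ 2 * d' / (d ^ 2 * b' * c')" 2 1]) (use nz real real_dual in simp_all)
    show "nonres (p ^ 2 * ?a ^ 2 / (?b * ?c * ?d * ?e * ?f) * ?a / ?b)"
      unfolding u' ua by (rule G[of _ d' 2 1]) (use nz real real_dual in simp_all)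
    show "norm (p ^ 2 * ?a ^ 2 / (?b * ?c * ?d * ?e * ?f)) < 1" unfolding u' by (rule u)
    have "?a * p / (?e * ?f) = a' * Z" using nz by (simp add: power2_eq_square mult_ac)
    thus "norm (?a * p / (?e * ?f)) < 1" using u by simp
  qed (use nz real_dual u in simp_all)
  also have "\<dots> = D.Psi1 Z X"
  proof -
    have "?a * p / (?b * ?c) = p * X / b" "?a * p / (?b * ?d) = p * X / c" "?a * p / (?b * ?e) = a * X" "?a * p / (?b * ?f) = d' * Z"
      using nz real_dual by (simp_all add: dual power2_eq_square mult_ac)
    thus ?thesis unfolding ua D.Psi1_def by (simp add: norm_series_def reg_series_def reg_series_term_def mult_ac)
  qed
  finally show ?thesis .
qed

text \<open>The series of the dual \<open>Psi1\<close> has argument \<open>p Z / d'\<close>, so for fixed small \<open>Z\<close> it converges for every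
  \<open>X\<close> and reaches the values of \<open>Psi\<close> at \<open>- x\<close>.\<close>

lemma dual_Psi1_continuation:
  assumes hol: "f holomorphic_on UNIV" and O: "open S" "S \<noteq> {}"
    and eq: "\<And>x. x \<in> S \<Longrightarrow> f x = dual_parameters.Psi1 p d' a b c d Z (exp (\<kappa> * x)) \<and> qinf (d' * Z * exp (\<kappa> * x) ^ 2) \<noteq> 0"
    and Z: "Z \<noteq> 0" "norm (p * Z / d') < 1" and nz: "qinf (d' * Z * exp (\<kappa> * x) ^ 2) \<noteq> 0"
  shows "f x = dual_parameters.Psi1 p d' a b c d Z (exp (\<kappa> * x))"
proof -
  interpret D: dual_parameters p a' b' c' d' a b c d by (rule swap)
  define X where "X = (\<lambda>x. exp (\<kappa> * x))"
  have X0: "X x \<noteq> 0" for x by (simp add: X_def)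
  have Xh: "X holomorphic_on UNIV" unfolding X_def by (intro holomorphic_intros)
  have u: "p ^ 2 * (d' * Z * X x ^ 2) ^ 2 / (d' * Z * (a * X x) * (d * X x) * (p * X x / b) * (p * X x / c)) = p * Z / d'" for x
    using nonzero Z p_nz X0 by (simp add: dual power2_eq_square mult_ac)
  define U' where "U' = (\<lambda>x. reg_series (d' * Z * X x ^ 2) (d' * Z) (a * X x) (d * X x) (p * X x / b) (p * X x / c))"
  have "U' holomorphic_on UNIV"
    unfolding U'_def
    by (rule reg_series_holomorphic[where \<rho> = "norm (p * Z / d')"])
      (use Xh X0 nonzero real_dual Z p_nz u in \<open>auto intro!: holomorphic_intros\<close>)
  hence hol2: "(\<lambda>x. qinf (p * Z / d') * U' x) holomorphic_on UNIV" by (intro holomorphic_intros)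
  \<comment> \<open>The denominator \<open>qinf (d' * Z * X x ^ 2)\<close> of
    \<open>norm_series\<close> is cleared, so that both sides are entire in x and can be compared
    from the open set \<open>S\<close>.\<close>
  have hol1: "(\<lambda>x. f x * qinf (d' * Z * X x ^ 2)) holomorphic_on UNIV"
    using hol Xh by (intro holomorphic_intros)
  have norm_series: "D.Psi1 Z (X x) = qinf (p * Z / d') * U' x / qinf (d' * Z * X x ^ 2)" for x
    unfolding D.Psi1_def norm_series_def u U'_def ..
  have "f x * qinf (d' * Z * X x ^ 2) = qinf (p * Z / d') * U' x"
  proof (rule analytic_continuation_open[OF O(1) open_UNIV O(2) connected_UNIV subset_UNIV hol1 hol2])
    fix z assume "z \<in> S"
    with eq[of z] show "f z * qinf (d' * Z * X z ^ 2) = qinf (p * Z / d') * U' z"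
      unfolding X_def[symmetric, THEN fun_cong] norm_series by simp
  qed simp
  thus ?thesis using nz unfolding X_def[symmetric, THEN fun_cong] norm_series by (simp add: field_simps)
qed

text \<open>Both sides are \<open>EAW X Z\<close> divided by the symmetric
  \<open>EAW_factor\<close>: the left by \<open>EAW_expansion\<close>, the right by its dual
  together with \<open>EAW_dual\<close>.\<close>

lemma connection_formula:
  assumes gXZ: "generic X Z" and u: "norm (p * X / d) < 1" "norm (p * Z / d') < 1"
  shows "cXZ X Z / (StX X * StZ Z) * Psi1 X Z + cXZ X (1 / Z) / (StX X * StZ (1 / Z)) * Psi1 X (1 / Z) =
    dual_parameters.cXZ p d' a b c Z X / (StZ Z * StX X) * dual_parameters.Psi1 p d' a b c d Z X +
    dual_parameters.cXZ p d' a b c Z (1 / X) / (StZ Z * StX (1 / X)) * dual_parameters.Psi1 p d' a b c d Z (1 / X)"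
proof -
  interpret D: dual_parameters p a' b' c' d' a b c d by (rule swap)
  have XZ: "X \<noteq> 0" "Z \<noteq> 0" using gXZ by (auto simp: generic_def)
  note G = generic_nonres[OF gXZ]
  note nz = nonzero XZ p_nz real real_dual
  have "nonres (d' * Z)" by (rule G[of _ d' 0 1]) (use nz in simp_all)
  moreover have "nonres (d * X)" by (rule G[of _ d 1 0]) (use nz in simp_all)
  moreover have "nonres (p * Z / d')" by (rule G[of _ "p / d'" 0 1]) (use nz in simp_all)
  moreover have "nonres (p * X / d)" by (rule G[of _ "p / d" 1 0]) (use nz in simp_all)
  ultimately have K: "EAW_factor X Z \<noteq> 0"
    by (simp add: EAW_factor_def nonres_qinf nonres_p_over)
  have K': "D.EAW_factor Z X = EAW_factor X Z"
    by (simp add: EAW_factor_def D.EAW_factor_def mult_ac)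
  have St: "D.StX = StZ" "D.StZ = StX"
    by (intro ext, simp add: StX_def StZ_def D.StX_def D.StZ_def)+
  have "EAW_factor X Z * (cXZ X Z / (StX X * StZ Z) * Psi1 X Z + cXZ X (1 / Z) / (StX X * StZ (1 / Z)) * Psi1 X (1 / Z)) =
     EAW_factor X Z * (D.cXZ Z X / (StZ Z * StX X) * D.Psi1 Z X + D.cXZ Z (1 / X) / (StZ Z * StX (1 / X)) * D.Psi1 Z (1 / X))"
    using EAW_expansion[OF gXZ u(1)] D.EAW_expansion[OF generic_swap[OF gXZ] u(2)] EAW_dual[OF gXZ u]
    unfolding K' St by metis
  thus ?thesis using K mult_left_cancel by blast
qed

end

section \<open>Meromorphic functions of two variables\<close>

abbreviation entire2 :: "(complex \<times> complex \<Rightarrow> complex) \<Rightarrow> bool"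
  where "entire2 f \<equiv> holomorphic2_on f UNIV"

lemma entire2I:
  assumes "\<And>w. \<exists>a b. (f has_derivative (\<lambda>h. a * fst h + b * snd h)) (at w)"
  shows "entire2 f"
  using assms by (simp add: holomorphic2_on_def)

lemma entire2E:
  assumes "entire2 f"
  obtains a b where "(f has_derivative (\<lambda>h. a * fst h + b * snd h)) (at w)"
  using assms unfolding holomorphic2_on_def by blast

lemma entire2_const: "entire2 (\<lambda>v. c)"
  by (rule entire2I, rule exI[of _ 0], rule exI[of _ 0]) simp

lemma entire2_fst: "entire2 fst" and entire2_snd: "entire2 snd"
proof -
  show "entire2 fst"
    by (rule entire2I, rule exI[of _ 1], rule exI[of _ 0]) (auto intro!: derivative_eq_intros)
  show "entire2 snd"
    by (rule entire2I, rule exI[of _ 0], rule exI[of _ 1]) (auto intro!: derivative_eq_intros)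
qed

lemma entire2_add:
  assumes "entire2 f" "entire2 g"
  shows "entire2 (\<lambda>v. f v + g v)"
proof (rule entire2I)
  fix w
  obtain a b where f: "(f has_derivative (\<lambda>h. a * fst h + b * snd h)) (at w)" using assms(1) by (rule entire2E)
  obtain c d where g: "(g has_derivative (\<lambda>h. c * fst h + d * snd h)) (at w)" using assms(2) by (rule entire2E)
  show "\<exists>a b. ((\<lambda>v. f v + g v) has_derivative (\<lambda>h. a * fst h + b * snd h)) (at w)"
    by (rule exI[of _ "a + c"], rule exI[of _ "b + d"], rule has_derivative_eq_rhs[OF has_derivative_add[OF f g]])
      (auto simp: algebra_simps)
qed

lemma entire2_mult:
  assumes "entire2 f" "entire2 g"
  shows "entire2 (\<lambda>v. f v * g v)"
proof (rule entire2I)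
  fix w
  obtain a b where f: "(f has_derivative (\<lambda>h. a * fst h + b * snd h)) (at w)" using assms(1) by (rule entire2E)
  obtain c d where g: "(g has_derivative (\<lambda>h. c * fst h + d * snd h)) (at w)" using assms(2) by (rule entire2E)
  show "\<exists>a b. ((\<lambda>v. f v * g v) has_derivative (\<lambda>h. a * fst h + b * snd h)) (at w)"
    by (rule exI[of _ "f w * c + a * g w"], rule exI[of _ "f w * d + b * g w"],
        rule has_derivative_eq_rhs[OF has_derivative_mult[OF f g]])
      (auto simp: algebra_simps)
qed

lemma entire2_compose:
  assumes "entire2 g" "\<And>w. f field_differentiable (at (g w))"
  shows "entire2 (\<lambda>v. f (g v))"
proof (rule entire2I)
  fix w
  obtain a b where g: "(g has_derivative (\<lambda>h. a * fst h + b * snd h)) (at w)" using assms(1) by (rule entire2E)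
  obtain D where "(f has_field_derivative D) (at (g w))" using assms(2)[of w] unfolding field_differentiable_def by blast
  hence f: "(f has_derivative (*) D) (at (g w))" by (simp add: has_field_derivative_def)
  show "\<exists>a b. ((\<lambda>v. f (g v)) has_derivative (\<lambda>h. a * fst h + b * snd h)) (at w)"
    by (rule exI[of _ "D * a"], rule exI[of _ "D * b"],
        rule has_derivative_eq_rhs[OF has_derivative_compose[OF g f]])
      (auto simp: algebra_simps)
qed

lemma entire2_compose_entire:
  assumes "f holomorphic_on UNIV" "entire2 g"
  shows "entire2 (\<lambda>v. f (g v))"
proof (rule entire2_compose[OF assms(2)])
  show "f field_differentiable (at (g w))" for w using assms(1) by (simp add: holomorphic_on_def)
qed

lemma entire2_uminus: "entire2 f \<Longrightarrow> entire2 (\<lambda>v. - f v)"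
  using entire2_mult[OF entire2_const[of "- 1"], of f] by simp

lemma entire2_diff: "entire2 f \<Longrightarrow> entire2 g \<Longrightarrow> entire2 (\<lambda>v. f v - g v)"
  using entire2_add[OF _ entire2_uminus, of f g] by simp

lemma entire2_divide:
  assumes "entire2 f" "entire2 g" "\<And>v. g v \<noteq> 0"
  shows "entire2 (\<lambda>v. f v / g v)"
proof -
  have "entire2 (\<lambda>v. inverse (g v))"
    using assms by (intro entire2_compose[of g inverse]) (auto intro!: field_differentiable_inverse field_differentiable_ident)
  from entire2_mult[OF assms(1) this] show ?thesis by (simp add: divide_inverse)
qed

lemma entire2_scale:
  assumes "entire2 f"
  shows "entire2 (\<lambda>v. f (\<alpha> * fst v, \<beta> * snd v))"
proof (rule entire2I)
  fix w :: "complex \<times> complex"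
  obtain a b where f: "(f has_derivative (\<lambda>h. a * fst h + b * snd h)) (at (\<alpha> * fst w, \<beta> * snd w))"
    using assms(1) by (rule entire2E)
  have g: "((\<lambda>v :: complex \<times> complex. (\<alpha> * fst v, \<beta> * snd v)) has_derivative (\<lambda>h. (\<alpha> * fst h, \<beta> * snd h))) (at w)"
    by (auto intro!: derivative_eq_intros)
  show "\<exists>a b. ((\<lambda>v. f (\<alpha> * fst v, \<beta> * snd v)) has_derivative (\<lambda>h. a * fst h + b * snd h)) (at w)"
    by (rule exI[of _ "a * \<alpha>"], rule exI[of _ "b * \<beta>"],
        rule has_derivative_eq_rhs[OF has_derivative_compose[OF g f]])
      (auto simp: algebra_simps)
qed

lemma entire2_line:
  assumes "entire2 f"
  shows "(\<lambda>t. f (x + t * x', z + t * z')) holomorphic_on UNIV"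
proof -
  have "(\<lambda>t. f (x + t * x', z + t * z')) field_differentiable (at t)" for t
  proof -
    obtain a b where f: "(f has_derivative (\<lambda>h. a * fst h + b * snd h)) (at (x + t * x', z + t * z'))"
      using assms(1) by (rule entire2E)
    have g: "((\<lambda>t. (x + t * x', z + t * z')) has_derivative (\<lambda>h. (h * x', h * z'))) (at t)"
      by (auto intro!: derivative_eq_intros)
    have "((\<lambda>t. f (x + t * x', z + t * z')) has_derivative (*) (a * x' + b * z')) (at t)"
      by (rule has_derivative_eq_rhs[OF has_derivative_compose[OF g f]]) (auto simp: algebra_simps)
    thus ?thesis by (auto simp: field_differentiable_def has_field_derivative_def)
  qed
  thus ?thesis by (simp add: holomorphic_on_def)
qed

lemma entire2_continuous:
  assumes "entire2 f"
  shows "continuous_on UNIV f"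
proof (rule continuous_at_imp_continuous_on, rule ballI)
  fix w
  obtain a b where "(f has_derivative (\<lambda>h. a * fst h + b * snd h)) (at w)" using assms by (rule entire2E)
  from has_derivative_continuous[OF this] show "isCont f w" .
qed

text \<open>Restriction to the complex line through \<open>v\<close> and a point of \<open>S\<close>
  reduces this to the identity theorem in one variable.\<close>

lemma entire2_identity:
  assumes f: "entire2 f" and S: "open S" "S \<noteq> {}" "\<And>v. v \<in> S \<Longrightarrow> f v = 0"
  shows "f v = 0"
proof -
  obtain w where w: "w \<in> S" using S by blast
  define \<gamma> where "\<gamma> = (\<lambda>t. (fst w + t * (fst v - fst w), snd w + t * (snd v - snd w)))"
  have "continuous_on UNIV \<gamma>" unfolding \<gamma>_def by (intro continuous_intros)
  hence op: "open (\<gamma> -` S)" using S(1) by (simp add: open_vimage)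
  have "0 \<in> \<gamma> -` S" using w by (simp add: \<gamma>_def)
  hence ne: "\<gamma> -` S \<noteq> {}" by blast
  have hol: "(\<lambda>t. f (\<gamma> t)) holomorphic_on UNIV" unfolding \<gamma>_def by (rule entire2_line[OF f])
  have "f (\<gamma> 1) = 0"
    by (rule analytic_continuation_open[OF op open_UNIV ne connected_UNIV subset_UNIV hol holomorphic_on_const])
      (use S(3) in simp_all)
  thus ?thesis by (simp add: \<gamma>_def)
qed

lemma entire2_nonzero_open: "entire2 f \<Longrightarrow> open {v. f v \<noteq> 0}"
  by (intro open_Collect_neq entire2_continuous continuous_on_const)

lemma entire2_nonzero_meets:
  assumes "entire2 f" "f v \<noteq> 0" "open S" "S \<noteq> {}"
  obtains w where "w \<in> S" "f w \<noteq> 0"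
  using entire2_identity[OF assms(1,3,4)] assms(2) by blast

lemma entire2_nonzero_dense:
  assumes "entire2 f" "f v \<noteq> 0"
  shows "closure {v. f v \<noteq> 0} = UNIV"
proof -
  have "- closure {v. f v \<noteq> 0} = {}"
  proof (rule ccontr)
    assume "- closure {v. f v \<noteq> 0} \<noteq> {}"
    then obtain w where "w \<in> - closure {v. f v \<noteq> 0}" "f w \<noteq> 0"
      using entire2_nonzero_meets[OF assms, of "- closure {v. f v \<noteq> 0}"] by blast
    thus False using closure_subset[of "{v. f v \<noteq> 0}"] by blast
  qed
  thus ?thesis by blast
qed

text \<open>Only global quotients of entire functions occur, and for these an equality of meromorphic
  functions is decided on any nonempty open set.\<close>

definition quotient2 :: "(complex \<times> complex \<Rightarrow> complex) \<Rightarrow> bool"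
  where "quotient2 f \<longleftrightarrow>
    (\<exists>g h. entire2 g \<and> entire2 h \<and> (\<exists>v. h v \<noteq> 0) \<and> (\<forall>v. h v \<noteq> 0 \<longrightarrow> f v = g v / h v))"

lemma entire2_mult_nonzero:
  assumes "entire2 f" "entire2 g" "f v \<noteq> 0" "g w \<noteq> 0"
  shows "\<exists>v. f v * g v \<noteq> 0"
  using entire2_nonzero_meets[OF assms(1,3) entire2_nonzero_open[OF assms(2)]] assms(4)
  by (metis (mono_tags, lifting) empty_iff mem_Collect_eq no_zero_divisors)

lemma quotient2_entire: "entire2 f \<Longrightarrow> quotient2 f"
  unfolding quotient2_def by (intro exI[of _ f] exI[of _ "\<lambda>_. 1"]) (simp add: entire2_const)

lemma quotient2_add:
  assumes "quotient2 f1" "quotient2 f2"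
  shows "quotient2 (\<lambda>v. f1 v + f2 v)"
proof -
  obtain g1 h1 v1 where 1: "entire2 g1" "entire2 h1" "h1 v1 \<noteq> 0" "\<And>v. h1 v \<noteq> 0 \<Longrightarrow> f1 v = g1 v / h1 v"
    using assms(1) by (auto simp: quotient2_def)
  obtain g2 h2 v2 where 2: "entire2 g2" "entire2 h2" "h2 v2 \<noteq> 0" "\<And>v. h2 v \<noteq> 0 \<Longrightarrow> f2 v = g2 v / h2 v"
    using assms(2) by (auto simp: quotient2_def)
  show ?thesis
    unfolding quotient2_def
    by (intro exI[of _ "\<lambda>v. g1 v * h2 v + g2 v * h1 v"] exI[of _ "\<lambda>v. h1 v * h2 v"] conjI
        entire2_add entire2_mult entire2_mult_nonzero[OF 1(2) 2(2) 1(3) 2(3)] 1(1,2) 2(1,2))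
      (auto simp: 1(4) 2(4) field_simps)
qed

lemma quotient2_mult:
  assumes "quotient2 f1" "quotient2 f2"
  shows "quotient2 (\<lambda>v. f1 v * f2 v)"
proof -
  obtain g1 h1 v1 where 1: "entire2 g1" "entire2 h1" "h1 v1 \<noteq> 0" "\<And>v. h1 v \<noteq> 0 \<Longrightarrow> f1 v = g1 v / h1 v"
    using assms(1) by (auto simp: quotient2_def)
  obtain g2 h2 v2 where 2: "entire2 g2" "entire2 h2" "h2 v2 \<noteq> 0" "\<And>v. h2 v \<noteq> 0 \<Longrightarrow> f2 v = g2 v / h2 v"
    using assms(2) by (auto simp: quotient2_def)
  show ?thesis
    unfolding quotient2_def
    by (intro exI[of _ "\<lambda>v. g1 v * g2 v"] exI[of _ "\<lambda>v. h1 v * h2 v"] conjI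
        entire2_mult entire2_mult_nonzero[OF 1(2) 2(2) 1(3) 2(3)] 1(1,2) 2(1,2))
      (auto simp: 1(4) 2(4))
qed

lemma quotient2_diff:
  assumes "quotient2 f1" "quotient2 f2"
  shows "quotient2 (\<lambda>v. f1 v - f2 v)"
  using quotient2_add[OF assms(1) quotient2_mult[OF quotient2_entire[OF entire2_const[of "- 1"]] assms(2)]] by simp

lemma quotient2_divide:
  assumes "quotient2 f1" "quotient2 f2" and S: "open S" "S \<noteq> {}" "\<And>v. v \<in> S \<Longrightarrow> f2 v \<noteq> 0"
  shows "quotient2 (\<lambda>v. f1 v / f2 v)"
proof -
  obtain g h v where 2: "entire2 g" "entire2 h" "h v \<noteq> 0" "\<And>v. h v \<noteq> 0 \<Longrightarrow> f2 v = g v / h v"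
    using assms(2) by (auto simp: quotient2_def)
  obtain w where w: "w \<in> S" "h w \<noteq> 0" using entire2_nonzero_meets[OF 2(2,3) S(1,2)] .
  hence "g w \<noteq> 0" using 2(4)[OF w(2)] S(3)[OF w(1)] by auto
  have "quotient2 (\<lambda>v. 1 / f2 v)"
    unfolding quotient2_def
    \<comment> \<open>The reciprocal of g / h is written as h^2 / (g h): where
      \<open>g v * h v\<close> is nonzero, \<open>h v\<close> is nonzero as well and the given
      representation of \<open>f2\<close> is valid.\<close>
    by (intro exI[of _ "\<lambda>v. h v * h v"] exI[of _ "\<lambda>v. g v * h v"] conjI
        entire2_mult entire2_mult_nonzero[OF 2(1,2) \<open>g w \<noteq> 0\<close> 2(3)] 2(1,2))
      (auto simp: 2(4))
  from quotient2_mult[OF assms(1) this] show ?thesis by simp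
qed

lemma quotient2_meromorphic2:
  assumes "quotient2 f"
  shows "meromorphic2 f"
proof -
  obtain g h v where 1: "entire2 g" "entire2 h" "h v \<noteq> 0" "\<And>v. h v \<noteq> 0 \<Longrightarrow> f v = g v / h v"
    using assms by (auto simp: quotient2_def)
  show ?thesis
    unfolding meromorphic2_def
    by (rule allI, rule exI[of _ UNIV], rule exI[of _ g], rule exI[of _ h])
      (use 1 entire2_nonzero_dense[OF 1(2,3)] in auto)
qed

text \<open>The cross-multiplied difference of the two quotients is entire and vanishes on an open
  part of \<open>S\<close>, hence everywhere; equality then holds on the dense open set where both
  denominators are nonzero.\<close>

lemma quotient2_eqI:
  assumes "quotient2 f1" "quotient2 f2" and S: "open S" "S \<noteq> {}" "\<And>v. v \<in> S \<Longrightarrow> f1 v = f2 v"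
  shows "meromorphic2_eq f1 f2"
proof -
  obtain g1 h1 v1 where 1: "entire2 g1" "entire2 h1" "h1 v1 \<noteq> 0" "\<And>v. h1 v \<noteq> 0 \<Longrightarrow> f1 v = g1 v / h1 v"
    using assms(1) by (auto simp: quotient2_def)
  obtain g2 h2 v2 where 2: "entire2 g2" "entire2 h2" "h2 v2 \<noteq> 0" "\<And>v. h2 v \<noteq> 0 \<Longrightarrow> f2 v = g2 v / h2 v"
    using assms(2) by (auto simp: quotient2_def)
  define h where "h v = h1 v * h2 v" for v
  have h: "entire2 h" unfolding h_def by (intro entire2_mult 1 2)
  obtain w where w: "h w \<noteq> 0" using entire2_mult_nonzero[OF 1(2) 2(2) 1(3) 2(3)] by (auto simp: h_def)
  define D where "D = {v. h v \<noteq> 0}"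
  have D: "open D" "closure D = UNIV"
    unfolding D_def by (rule entire2_nonzero_open[OF h], rule entire2_nonzero_dense[OF h w])
  have E: "entire2 (\<lambda>v. g1 v * h2 v - g2 v * h1 v)" by (intro entire2_diff entire2_mult 1 2)
  obtain w' where "w' \<in> S" "h w' \<noteq> 0" using entire2_nonzero_meets[OF h w S(1,2)] .
  hence ne: "S \<inter> D \<noteq> {}" by (auto simp: D_def)
  have zero: "g1 v * h2 v - g2 v * h1 v = 0" for v
  proof (rule entire2_identity[OF E _ ne])
    fix v assume "v \<in> S \<inter> D"
    thus "g1 v * h2 v - g2 v * h1 v = 0"
      using S(3)[of v] 1(4)[of v] 2(4)[of v] by (auto simp: D_def h_def field_simps)
  qed (use S D in auto)
  have "f1 v = f2 v" if "v \<in> D" for v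
    using that 1(4)[of v] 2(4)[of v] zero[of v] by (simp add: D_def h_def frac_eq_eq)
  thus ?thesis
    unfolding meromorphic2_eq_def using D quotient2_meromorphic2 assms by blast
qed

lemma qpow_add: "qpow \<tau> (x + y) = qpow \<tau> x * qpow \<tau> y"
  by (simp add: qpow_def exp_add ring_distribs)

lemma qpow_uminus: "qpow \<tau> (- x) = 1 / qpow \<tau> x"
  by (simp add: qpow_def exp_minus divide_inverse)

lemma qpow_diff: "qpow \<tau> (x - y) = qpow \<tau> x / qpow \<tau> y"
  using qpow_add[of \<tau> x "- y"] by (simp add: qpow_uminus)

lemma qpow_double: "qpow \<tau> (2 * x) = qpow \<tau> x ^ 2"
  using qpow_add[of \<tau> x x] by (simp add: power2_eq_square)

lemma qpow_nonzero: "qpow \<tau> x \<noteq> 0"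
  by (simp add: qpow_def)

lemma qpow_eq_exp:
  assumes "Re \<tau> = 0"
  shows "qpow \<tau> x = exp (- of_real (2 * pi * Im \<tau>) * x)"
proof -
  have "\<tau> = \<i> * of_real (Im \<tau>)" using assms by (simp add: complex_eq_iff)
  hence "2 * of_real pi * \<i> * \<tau> * x = 2 * of_real pi * \<i> * (\<i> * of_real (Im \<tau>)) * x" by simp
  also have "\<dots> = (\<i> * \<i>) * (of_real (2 * pi * Im \<tau>) * x)" by (simp only: of_real_mult of_real_numeral mult_ac)
  finally have e: "2 * of_real pi * \<i> * \<tau> * x = (\<i> * \<i>) * (of_real (2 * pi * Im \<tau>) * x)" .
  show ?thesis unfolding qpow_def e by simp
qed

section \<open>The connection formula\<close>

text \<open>Since \<open>p\<close> and \<open>r\<close> are real, it suffices that the monomial is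
  not real. Its argument is, up to sign, m \<alpha> + n \<beta> with \<alpha> in (1/10, 1/5) and
  \<beta> in (1/2, 1). For |m|, |n| \<le> 2, not both zero, this is nonzero because |m \<alpha>| <
  2/5 < 1/2, and below 12/5 < \<pi> in modulus.\<close>

lemma generic_sector:
  assumes q: "q_base p" and p: "p \<in> \<real>" and k: "k > 0"
    and x: "k * Im x \<in> {1/10<..<1/5}" and z: "k * Im z \<in> {1/2<..<1}"
  shows "q_base.generic p (exp (- of_real k * x)) (exp (- of_real k * z))"
proof -
  interpret q_base p by (rule q)
  have "nonres (r * exp (- of_real k * x) powi m * exp (- of_real k * z) powi n)"
    if r: "r \<in> \<real>" "r \<noteq> 0" and mn: "\<bar>m\<bar> \<le> 2" "\<bar>n\<bar> \<le> 2" "m \<noteq> 0 \<or> n \<noteq> 0" for r m n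
  proof -
    define \<alpha> \<beta> where "\<alpha> = k * Im x" and "\<beta> = k * Im z"
    have \<alpha>\<beta>: "1/10 < \<alpha>" "\<alpha> < 1/5" "1/2 < \<beta>" "\<beta> < 1" using x z by (auto simp: \<alpha>_def \<beta>_def)
    define w where "w = of_int m * (- of_real k * x) + of_int n * (- of_real k * z)"
    have e: "exp (- of_real k * x) powi m * exp (- of_real k * z) powi n = exp w"
      unfolding exp_power_int w_def by (rule exp_add[symmetric])
    have Imw: "Im w = - (real_of_int m * \<alpha> + real_of_int n * \<beta>)"
      by (simp add: w_def \<alpha>_def \<beta>_def)
    have "m \<in> {-2, -1, 0, 1, 2}" "n \<in> {-2, -1, 0, 1, 2}" using mn by auto
    hence "Im w \<noteq> 0 \<and> \<bar>Im w\<bar> < 3"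
      using \<alpha>\<beta> mn(3) unfolding Imw by (elim insertE emptyE) auto
    hence "sin (Im w) \<noteq> 0"
      using sin_zero_pi_iff[of "Im w"] pi_gt3 by auto
    hence "Im (exp w) \<noteq> 0" by (simp add: Im_exp)
    moreover obtain r' where "r = of_real r'" using r(1) by (rule Reals_cases)
    ultimately have "r * exp w \<notin> \<real>" using r(2) by (simp add: complex_is_Real_iff)
    moreover obtain p' where "p = of_real p'" using p by (rule Reals_cases)
    hence "p powi i \<in> \<real>" for i by (simp flip: of_real_power_int)
    ultimately have "nonres (r * exp w)" using r by (auto simp: nonres_def)
    thus ?thesis using e by (simp add: mult.assoc)
  qed
  thus ?thesis by (simp add: generic_def)
qed

theorem corollary2p6:
  fixes \<tau> :: complex and s \<kappa> lam \<upsilon> \<sigma> :: real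
    and Psi :: "complex \<Rightarrow> complex \<Rightarrow> complex"
  assumes "Re \<tau> = 0" and "Im \<tau> > 0"
    and "s \<in> \<rat>" and "s > 0"
    and "is_Psi \<tau> s \<kappa> lam \<upsilon> \<sigma> Psi"
  shows "meromorphic2_eq
    (\<lambda>(x, z). Phi Psi \<tau> s \<kappa> lam \<upsilon> \<sigma> (- x) z)
    (\<lambda>(x, z).
       (c_fun \<tau> s \<kappa> lam \<upsilon> \<sigma> x z - c_dual \<tau> s \<kappa> lam \<upsilon> \<sigma> z x)
         / c_dual \<tau> s \<kappa> lam \<upsilon> \<sigma> z (- x) * Phi Psi \<tau> s \<kappa> lam \<upsilon> \<sigma> x z
       + c_fun \<tau> s \<kappa> lam \<upsilon> \<sigma> x (- z)
         / c_dual \<tau> s \<kappa> lam \<upsilon> \<sigma> z (- x) * Phi Psi \<tau> s \<kappa> lam \<upsilon> \<sigma> x (- z))"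
proof -
  define k where "k = 2 * pi * Im \<tau>"
  have k: "k > 0" using assms(2) by (simp add: k_def)
  let ?q = "qpow \<tau>"
  have q: "?q x = exp (- of_real k * x)" for x
    unfolding k_def by (rule qpow_eq_exp[OF assms(1)])
  have qr: "?q (of_real r) = of_real (exp (- k * r))" for r
    unfolding q by (simp flip: exp_of_real)
  have qr_real: "?q (of_real r) \<in> \<real>" for r unfolding qr by simp
  define p where "p = ?q (of_real s)"
  define a where "a = AW_a \<tau> s \<kappa> lam \<upsilon> \<sigma>"
  define b where "b = AW_b \<tau> s \<kappa> lam \<upsilon> \<sigma>"
  define c where "c = AW_c \<tau> s \<kappa> lam \<upsilon> \<sigma>"
  define d where "d = AW_d \<tau> s \<kappa> lam \<upsilon> \<sigma>"
  define a' where "a' = AW_a \<tau> s \<kappa> \<upsilon> lam \<sigma>"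
  define b' where "b' = AW_b \<tau> s \<kappa> \<upsilon> lam \<sigma>"
  define c' where "c' = AW_c \<tau> s \<kappa> \<upsilon> lam \<sigma>"
  define d' where "d' = AW_d \<tau> s \<kappa> \<upsilon> lam \<sigma>"
  note AW = a_def b_def c_def d_def a'_def b'_def c'_def d'_def AW_a_def AW_b_def AW_c_def AW_d_def
  have pR: "p \<in> \<real>" unfolding p_def by (rule qr_real)
  have qb: "q_base p"
  proof
    show "p \<noteq> 0" by (simp add: p_def qpow_nonzero)
    have "exp (- k * s) < 1" using k assms(4) by simp
    thus "norm p < 1" unfolding p_def qr norm_of_real by simp
  qed
  \<comment> \<open>In exponents the last relation reads 2 \<kappa> + s + 2 \<upsilon> - 2 (\<kappa>
    + \<upsilon>) = s, the signs of \<open>b\<close> and \<open>d\<close> cancelling.\<close>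
  interpret L: dual_parameters p a b c d a' b' c' d'
  proof (rule dual_parameters.intro[OF qb], unfold_locales)
    have ab: "qpow \<tau> (of_real x) * qpow \<tau> (of_real y) = qpow \<tau> (of_real (x + y))"
      "qpow \<tau> (of_real x) / qpow \<tau> (of_real y) = qpow \<tau> (of_real (x - y))"
      "qpow \<tau> (of_real x) ^ 2 = qpow \<tau> (of_real (2 * x))" for x y
      by (simp_all add: qpow_add qpow_diff qpow_double)
    show "a \<in> \<real>" "b \<in> \<real>" "c \<in> \<real>" "d \<in> \<real>" "a' \<in> \<real>" unfolding AW by (rule qr_real | rule Reals_minus[OF qr_real])+
    show "a \<noteq> 0" "b \<noteq> 0" "c \<noteq> 0" "d \<noteq> 0" "a' \<noteq> 0" unfolding AW by (simp_all add: qpow_nonzero)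
    show "b' = a * b / a'" "c' = a * c / a'" "d' = a * d / a'"
      unfolding AW by (simp_all only: ab mult_minus_right minus_divide_left[symmetric]) (simp_all add: algebra_simps)
    show "p = a * b * c * d / a' ^ 2"
      unfolding AW p_def by (simp_all only: ab mult_minus_right mult_minus_left minus_minus) (simp_all add: algebra_simps)
  qed
  interpret D: dual_parameters p a' b' c' d' a b c d by (rule L.swap)
  note nz = L.nonzero L.p_nz L.real L.real_dual
  have DSt: "D.StX = L.StZ" "D.StZ = L.StX"
    by (intro ext, simp add: L.StX_def L.StZ_def D.StX_def D.StZ_def)+

  define W where "W x z = W_fun \<tau> s \<kappa> lam \<upsilon> \<sigma> x z" for x z
  have W0: "W x z \<noteq> 0" for x z by (simp add: W_def W_fun_def qpow_nonzero)
  have c_fun: "c_fun \<tau> s \<kappa> lam \<upsilon> \<sigma> x z = L.cXZ (?q x) (?q z) / W x z" for x z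
    unfolding c_fun_def Let_def p_def[symmetric] a'_def[symmetric] b'_def[symmetric] c'_def[symmetric] d_def[symmetric] W_def[symmetric]
    by (simp add: L.theta_Cons L.theta_Nil L.cXZ_def qpow_diff qpow_uminus qpow_double qpow_double[unfolded mult.commute[of 2]] mult_ac)
  have c_dual: "c_dual \<tau> s \<kappa> lam \<upsilon> \<sigma> z x = D.cXZ (?q z) (?q x) / W x z" for x z
  proof -
    have "W_fun \<tau> s \<kappa> \<upsilon> lam \<sigma> z x = W x z" by (simp add: W_def W_fun_def mult.commute)
    thus ?thesis
      unfolding c_dual_def c_fun_def Let_def p_def[symmetric] a_def[symmetric] b_def[symmetric] c_def[symmetric] d'_def[symmetric]
      by (simp add: L.theta_Cons L.theta_Nil D.cXZ_def qpow_diff qpow_uminus qpow_double qpow_double[unfolded mult.commute[of 2]] mult_ac)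
  qed
  have St: "St \<tau> s \<kappa> lam \<upsilon> \<sigma> x = L.StX (?q x)" for x
    unfolding St_def qpow_add p_def[symmetric] a_def[symmetric] b_def[symmetric] c_def[symmetric] d_def[symmetric]
    by (simp add: L.qpoch_inf_Cons L.qpoch_inf_Nil L.StX_def mult.assoc)
  have St_dual: "St_dual \<tau> s \<kappa> lam \<upsilon> \<sigma> z = L.StZ (?q z)" for z
    unfolding St_dual_def St_def qpow_add p_def[symmetric] a'_def[symmetric] b'_def[symmetric] c'_def[symmetric] d'_def[symmetric]
    by (simp add: L.qpoch_inf_Cons L.qpoch_inf_Nil L.StZ_def mult.assoc)
  have Phi: "Phi Psi \<tau> s \<kappa> lam \<upsilon> \<sigma> x z = W x z / (L.StX (?q x) * L.StZ (?q z)) * Psi x z" for x z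
    by (simp add: Phi_def St St_dual W_def)

  have hol: "entire2 (\<lambda>(x, z). Psi x z)" using assms(5) by (simp add: is_Psi_def)
  have Psi0: "L.qinf p * Psi x z = L.Psi0 (?q x) (?q z)"
    if g: "L.generic (?q x) (?q z)" and u: "norm (d * ?q x) < 1" for x z
  proof -
    have args: "?q (of_real s + x + 2 * z) / d = p * ?q x * ?q z ^ 2 / d" "?q (of_real s + z) / a' = p * ?q z / a'"
      "?q (of_real s + z) / d' = p * ?q z / d'" "?q (of_real s + x) / d = p * ?q x / d"
      "?q (2 * of_real s + x + 2 * z) / d = p ^ 2 * ?q x * ?q z ^ 2 / d"
      "?q (of_real s + x + z) * y = p * ?q x * ?q z * y" "?q (of_real s + 2 * z) = p * ?q z ^ 2" for y
      by (simp_all add: qpow_add qpow_double p_def)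
    note formula = assms(5)[unfolded is_Psi_def Let_def p_def[symmetric] a_def[symmetric] b_def[symmetric]
        c_def[symmetric] d_def[symmetric] a'_def[symmetric] b'_def[symmetric] c'_def[symmetric] d'_def[symmetric],
        THEN conjunct2, rule_format, of x z, unfolded args]
    have "Psi x z = L.Psi0 (?q x) (?q z) / L.qinf p"
      using formula[OF u L.Psi0_series(1,2)[OF g u]] unfolding L.Psi0_series(3)[OF g u] .
    thus ?thesis using L.qinf_p_nz by simp
  qed

  \<comment> \<open>\<open>C\<close> dominates the five coefficients that must be small when
    multiplied by q^x or q^z, and Re > \<open>M\<close> means C |q^x| < 1.\<close>
  define C where "C = 1 + norm d + norm (p / d) + norm a + norm (p / d') + norm a'"
  define M where "M = ln C / k"
  have C: "C \<ge> 1" by (simp add: C_def)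
  \<comment> \<open>The imaginary parts lie in the strips of \<open>generic_sector\<close>.\<close>
  define Sx where "Sx = {x. M < Re x \<and> 1/10 / k < Im x \<and> Im x < 1/5 / k}"
  define Sz where "Sz = {z. M < Re z \<and> 1/2 / k < Im z \<and> Im z < 1 / k}"
  have "open Sx" "open Sz"
    unfolding Sx_def Sz_def by (intro open_Collect_conj open_Collect_less continuous_intros)+
  moreover have "Complex (M + 1) (3/20 / k) \<in> Sx" "Complex (M + 1) (3/4 / k) \<in> Sz"
    using k by (simp_all add: Sx_def Sz_def) (simp_all add: field_simps)
  ultimately have S: "open Sx" "Sx \<noteq> {}" "open Sz" "Sz \<noteq> {}" "open (Sx \<times> Sz)" "Sx \<times> Sz \<noteq> {}"
    by (auto intro: open_Times)
  have nonres: "L.generic (?q x) (?q z)" if "x \<in> Sx" "z \<in> Sz" for x z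
    unfolding q using that k by (intro generic_sector[OF qb pR k]) (auto simp: Sx_def Sz_def field_simps)
  have small: "norm (y * ?q x) < 1" if "M < Re x" "norm y \<le> C" for x y
  proof -
    have "ln C < k * Re x" using that k by (simp add: M_def field_simps)
    hence "exp (- (k * Re x)) < exp (- ln C)" by simp
    also have "exp (- ln C) = 1 / C" using C by (simp add: exp_minus divide_inverse)
    finally have "C * exp (- (k * Re x)) < 1" using C by (simp add: field_simps)
    moreover have "norm (y * ?q x) \<le> C * exp (- (k * Re x))"
      unfolding norm_mult q using that C by (intro mult_mono) (auto simp: norm_exp_eq_Re)
    ultimately show ?thesis by linarith
  qed
  have C_ge: "norm d \<le> C" "norm (p / d) \<le> C" "norm a \<le> C" "norm (p / d') \<le> C" "norm a' \<le> C"
    unfolding C_def using norm_ge_zero[of d] norm_ge_zero[of "p / d"] norm_ge_zero[of a] norm_ge_zero[of "p / d'"] norm_ge_zero[of a']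
    by linarith+
  have small_x: "norm (d * ?q x) < 1" "norm (p * ?q x / d) < 1" "norm (a * ?q x) < 1" if "x \<in> Sx" for x
    using that small[of x d] small[of x "p / d"] small[of x a] C_ge by (simp_all add: Sx_def)
  have small_z: "norm (p * ?q z / d') < 1" "norm (a' * ?q z) < 1" if "z \<in> Sz" for z
    using that small[of z "p / d'"] small[of z a'] C_ge by (simp_all add: Sz_def)

  have Psi_pp: "L.qinf p * Psi x z = L.Psi1 (?q x) (?q z)" and Psi_pp': "L.qinf p * Psi x z = D.Psi1 (?q z) (?q x)"
    if xz: "x \<in> Sx" "z \<in> Sz" for x z
    using Psi0[OF nonres[OF xz] small_x(1)[OF xz(1)]] L.Psi0_eq_Psi1[OF nonres[OF xz] small_x[OF xz(1)]]
      L.Psi0_eq_dual_Psi1[OF nonres[OF xz] small_x(1)[OF xz(1)] small_z[OF xz(2)]] by simp_all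
  \<comment> \<open>Here q^(-z) need not be small: both the defining formula and
    \<open>Psi0_eq_Psi1\<close> restrict only the size of q^x.\<close>
  have Psi_pm: "L.qinf p * Psi x (- z) = L.Psi1 (?q x) (1 / ?q z)" if xz: "x \<in> Sx" "z \<in> Sz" for x z
  proof -
    have g: "L.generic (?q x) (?q (- z))" using L.generic_inverse[OF nonres[OF xz]] by (simp add: qpow_uminus)
    show ?thesis
      using Psi0[OF g small_x(1)[OF xz(1)]] L.Psi0_eq_Psi1[OF g small_x[OF xz(1)]] by (simp add: qpow_uminus)
  qed
  \<comment> \<open>The defining formula may be out of reach at -x. The entire function
    \<open>Psi\<close> agrees with the dual \<open>Psi1\<close> for x in \<open>Sx\<close>, and the
    continuation in x for fixed z carries this to -x.\<close>
  have Psi_mp: "L.qinf p * Psi (- x) z = D.Psi1 (?q z) (1 / ?q x)" if xz: "x \<in> Sx" "z \<in> Sz" for x z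
  proof -
    have exp: "exp (- of_real k * y) = ?q y" for y by (simp add: q)
    have "L.qinf p * Psi (- x) z = D.Psi1 (?q z) (exp (- of_real k * (- x)))"
    proof (rule L.dual_Psi1_continuation[where S = Sx and f = "\<lambda>x. L.qinf p * Psi x z"])
      have "(\<lambda>t. Psi (0 + t * 1) (z + t * 0)) holomorphic_on UNIV"
        using entire2_line[OF hol, of 0 1 z 0] by simp
      thus "(\<lambda>x. L.qinf p * Psi x z) holomorphic_on UNIV" by (intro holomorphic_intros) simp
      fix y assume y: "y \<in> Sx"
      have "L.nonres (d' * ?q z * ?q y ^ 2)"
        by (rule L.generic_nonres[OF nonres[OF y xz(2)], of _ d' 2 1]) (use nz in simp_all)
      thus "L.qinf p * Psi y z = D.Psi1 (?q z) (exp (- of_real k * y)) \<and> L.qinf (d' * ?q z * exp (- of_real k * y) ^ 2) \<noteq> 0"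
        unfolding exp using Psi_pp'[OF y xz(2)] L.nonres_qinf by blast
    next
      have "L.nonres (d' * ?q z * ?q (- x) ^ 2)"
        by (rule L.generic_nonres[OF nonres[OF xz], of _ d' "-2" 1])
          (use nz in \<open>simp_all add: qpow_uminus power_int_minus field_simps\<close>)
      thus "L.qinf (d' * ?q z * exp (- of_real k * (- x)) ^ 2) \<noteq> 0"
        unfolding exp by (rule L.nonres_qinf)
    qed (use S small_z[OF xz(2)] qpow_nonzero in simp_all)
    thus ?thesis unfolding exp by (simp add: qpow_uminus)
  qed

  have nonvan: "L.StX (?q x) \<noteq> 0" "L.StX (1 / ?q x) \<noteq> 0" "L.StZ (?q z) \<noteq> 0" "L.StZ (1 / ?q z) \<noteq> 0"
    "D.cXZ (?q z) (1 / ?q x) \<noteq> 0" "L.theta1 (1 / ?q z ^ 2) \<noteq> 0" "L.theta1 (?q z ^ 2) \<noteq> 0" "L.theta1 (d * ?q x) \<noteq> 0"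
    "L.theta1 (1 / ?q x ^ 2) \<noteq> 0" "L.theta1 (?q x ^ 2) \<noteq> 0" "L.theta1 (d' * ?q z) \<noteq> 0"
    if xz: "x \<in> Sx" "z \<in> Sz" for x z
  proof -
    note G = L.generic_nonres[OF nonres[OF xz]]
    have X: "L.nonres (r * ?q x)" "L.nonres (r / ?q x)" "L.nonres (r * ?q z)" "L.nonres (r / ?q z)" "L.nonres (r * ?q z * ?q x)"
      if "r \<in> \<real>" "r \<noteq> 0" for r
      subgoal by (rule G[of _ r 1 0]) (use that in simp_all)
      subgoal by (rule G[of _ r "-1" 0]) (use that in \<open>simp_all add: power_int_minus divide_inverse\<close>)
      subgoal by (rule G[of _ r 0 1]) (use that in simp_all)
      subgoal by (rule G[of _ r 0 "-1"]) (use that in \<open>simp_all add: power_int_minus divide_inverse\<close>)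
      subgoal by (rule G[of _ r 1 1]) (use that in simp_all)
      done
    have X': "L.nonres (p * ?q x / y)" "L.nonres (p * (1 / ?q x) / y)" "L.nonres (p * ?q z / y)" "L.nonres (p * (1 / ?q z) / y)"
      if "y \<in> \<real>" "y \<noteq> 0" for y
      using X[of "p / y"] that nz by (simp_all add: mult.commute)
    show "L.StX (?q x) \<noteq> 0" "L.StX (1 / ?q x) \<noteq> 0" "L.StZ (?q z) \<noteq> 0" "L.StZ (1 / ?q z) \<noteq> 0"
      unfolding L.StX_def L.StZ_def using L.nonres_qinf[OF X'(1)] L.nonres_qinf[OF X'(2)] L.nonres_qinf[OF X'(3)] L.nonres_qinf[OF X'(4)] nz
      by simp_all
    have sq: "L.nonres (1 / ?q z ^ 2)" "L.nonres (?q z ^ 2)" "L.nonres (1 / ?q x ^ 2)" "L.nonres (?q x ^ 2)"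
      subgoal by (rule G[of _ 1 0 "-2"]) (simp_all add: power_int_minus divide_inverse)
      subgoal by (rule G[of _ 1 0 2]) simp_all
      subgoal by (rule G[of _ 1 "-2" 0]) (simp_all add: power_int_minus divide_inverse)
      subgoal by (rule G[of _ 1 2 0]) simp_all
      done
    show ths: "L.theta1 (1 / ?q z ^ 2) \<noteq> 0" "L.theta1 (?q z ^ 2) \<noteq> 0" "L.theta1 (d * ?q x) \<noteq> 0"
      "L.theta1 (1 / ?q x ^ 2) \<noteq> 0" "L.theta1 (?q x ^ 2) \<noteq> 0" "L.theta1 (d' * ?q z) \<noteq> 0"
      using sq X(1)[of d] X(3)[of d'] nz by (simp_all add: L.nonres_theta1)
    have "L.nonres (d' * ?q z / (a * (1 / ?q x)))"
      using X(5)[of "d' / a"] nz by simp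
    thus "D.cXZ (?q z) (1 / ?q x) \<noteq> 0"
      unfolding D.cXZ_def using ths X(1)[of a] X(1)[of b] X(1)[of c] nz by (simp add: L.nonres_theta1 power_one_over)
  qed

  have eq: "Phi Psi \<tau> s \<kappa> lam \<upsilon> \<sigma> (- x) z =
       (c_fun \<tau> s \<kappa> lam \<upsilon> \<sigma> x z - c_dual \<tau> s \<kappa> lam \<upsilon> \<sigma> z x)
         / c_dual \<tau> s \<kappa> lam \<upsilon> \<sigma> z (- x) * Phi Psi \<tau> s \<kappa> lam \<upsilon> \<sigma> x z
       + c_fun \<tau> s \<kappa> lam \<upsilon> \<sigma> x (- z)
         / c_dual \<tau> s \<kappa> lam \<upsilon> \<sigma> z (- x) * Phi Psi \<tau> s \<kappa> lam \<upsilon> \<sigma> x (- z)"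
    if xz: "x \<in> Sx" "z \<in> Sz" for x z
  proof -
    \<comment> \<open>Here \<open>r\<close> is \<open>qinf p\<close> and \<open>w\<close>,
      \<open>w'\<close>, \<open>w''\<close> are the values of \<open>W\<close> at (x, z), (-x, z),
      (x, -z). In each product the \<open>W\<close> of \<Phi> cancels the one in its coefficient,
      and the denominator c^d(z, -x) leaves the common factor \<open>w'\<close>.\<close>
    have alg: "w' / (s' * t) * \<psi>' = (c1 / w - c2 / w) / (c3 / w') * (w / (s * t) * \<psi>) + c4 / w'' / (c3 / w') * (w'' / (s * t') * \<psi>'')"
      if e: "c1 / (s * t) * (r * \<psi>) + c4 / (s * t') * (r * \<psi>'') = c2 / (t * s) * (r * \<psi>) + c3 / (t * s') * (r * \<psi>')"
        and n: "w \<noteq> 0" "w' \<noteq> 0" "w'' \<noteq> 0" "s \<noteq> 0" "s' \<noteq> 0" "t \<noteq> 0" "t' \<noteq> 0" "c3 \<noteq> 0" "r \<noteq> 0"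
      for c1 c2 c3 c4 s s' t t' w w' w'' r \<psi> \<psi>' \<psi>'' :: complex
    proof -
      have "r * (c3 / (t * s') * \<psi>') = r * ((c1 - c2) / (s * t) * \<psi> + c4 / (s * t') * \<psi>'')"
        using e by (simp add: algebra_simps diff_divide_distrib)
      hence "c3 / (t * s') * \<psi>' = (c1 - c2) / (s * t) * \<psi> + c4 / (s * t') * \<psi>''"
        using n(9) mult_left_cancel by blast
      hence "w' / c3 * (c3 / (t * s') * \<psi>') = w' / c3 * ((c1 - c2) / (s * t) * \<psi> + c4 / (s * t') * \<psi>'')" by simp
      moreover have "w' / c3 * (c3 / (t * s') * \<psi>') = w' / (s' * t) * \<psi>'" using n by (simp add: mult.commute)
      moreover have "w' / c3 * ((c1 - c2) / (s * t) * \<psi> + c4 / (s * t') * \<psi>'') =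
          (c1 / w - c2 / w) / (c3 / w') * (w / (s * t) * \<psi>) + c4 / w'' / (c3 / w') * (w'' / (s * t') * \<psi>'')"
        using n by (simp add: distrib_left mult_ac flip: diff_divide_distrib)
      ultimately show ?thesis by simp
    qed
    show ?thesis
      unfolding Phi c_fun c_dual qpow_uminus
      by (rule alg[OF L.connection_formula[OF nonres[OF xz] small_x(2)[OF xz(1)] small_z(1)[OF xz(2)],
            folded Psi_pp[OF xz] Psi_pm[OF xz] Psi_mp[OF xz], folded Psi_pp'[OF xz]]])
        (use nonvan[OF xz] W0 L.qinf_p_nz in simp_all)
  qed

  have ent_q: "entire2 (\<lambda>v. ?q (f v))" if "entire2 f" for f
    by (rule entire2_compose_entire[OF _ that]) (unfold qpow_def, intro holomorphic_intros)
  have ent_qinf: "entire2 (\<lambda>v. L.qinf (f v))" if "entire2 f" for f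
    by (rule entire2_compose_entire[OF L.qinf_holomorphic_UNIV that])
  have ent_theta1: "entire2 (\<lambda>v. L.theta1 (f v))" if "entire2 f" "\<And>v. f v \<noteq> 0" for f
    unfolding L.theta1_def by (intro entire2_mult ent_qinf entire2_divide entire2_const that)
  note ent = entire2_const entire2_fst entire2_snd entire2_add entire2_mult entire2_divide ent_q ent_qinf ent_theta1
  \<comment> \<open>The scalings \<epsilon> and \<delta> treat all sign changes of x and z at once;
    below they are 1 or -1.\<close>
  have ent_W: "entire2 (\<lambda>v. W (\<epsilon> * fst v) (\<delta> * snd v))" for \<epsilon> \<delta>
    unfolding W_def W_fun_def by (intro ent) (use assms(4) in simp)
  have ent_X: "entire2 (\<lambda>v. ?q (\<epsilon> * fst v))" and ent_Z: "entire2 (\<lambda>v. ?q (\<epsilon> * snd v))" for \<epsilon>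
    by (intro ent)+
  have quo_Phi: "quotient2 (\<lambda>v. Phi Psi \<tau> s \<kappa> lam \<upsilon> \<sigma> (\<epsilon> * fst v) (\<delta> * snd v))"
    if "\<And>v. v \<in> Sx \<times> Sz \<Longrightarrow> L.StX (?q (\<epsilon> * fst v)) * L.StZ (?q (\<delta> * snd v)) \<noteq> 0" for \<epsilon> \<delta>
    unfolding Phi
  proof (rule quotient2_mult[OF quotient2_divide[OF quotient2_entire[OF ent_W] quotient2_entire S(5,6) that] quotient2_entire])
    show "entire2 (\<lambda>v. L.StX (?q (\<epsilon> * fst v)) * L.StZ (?q (\<delta> * snd v)))"
      unfolding L.StX_def L.StZ_def by (intro ent) (use nz in simp_all)
    show "entire2 (\<lambda>v. Psi (\<epsilon> * fst v) (\<delta> * snd v))"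
      using entire2_scale[OF hol, of \<epsilon> \<delta>] by simp
  qed
  have quo_L: "quotient2 (\<lambda>v. L.cXZ (f v) (g v))"
    if "entire2 f" "entire2 g" "\<And>v. f v \<noteq> 0" "\<And>v. g v \<noteq> 0"
      "\<And>v. v \<in> Sx \<times> Sz \<Longrightarrow> L.theta1 (1 / g v ^ 2) * L.theta1 (d * f v) \<noteq> 0" for f g
    unfolding L.cXZ_def power2_eq_square
    by (intro quotient2_divide[OF _ _ S(5,6)] quotient2_entire ent that(1,2))
      (use nz that in \<open>simp_all add: power2_eq_square\<close>)
  have quo_D: "quotient2 (\<lambda>v. D.cXZ (f v) (g v))"
    if "entire2 f" "entire2 g" "\<And>v. f v \<noteq> 0" "\<And>v. g v \<noteq> 0"
      "\<And>v. v \<in> Sx \<times> Sz \<Longrightarrow> L.theta1 (1 / g v ^ 2) * L.theta1 (d' * f v) \<noteq> 0" for f g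
    unfolding D.cXZ_def power2_eq_square
    by (intro quotient2_divide[OF _ _ S(5,6)] quotient2_entire ent that(1,2))
      (use nz that in \<open>simp_all add: power2_eq_square\<close>)
  have "quotient2 (\<lambda>v. Phi Psi \<tau> s \<kappa> lam \<upsilon> \<sigma> (- 1 * fst v) (1 * snd v))"
    "quotient2 (\<lambda>v. Phi Psi \<tau> s \<kappa> lam \<upsilon> \<sigma> (1 * fst v) (1 * snd v))"
    "quotient2 (\<lambda>v. Phi Psi \<tau> s \<kappa> lam \<upsilon> \<sigma> (1 * fst v) (- 1 * snd v))"
    by (rule quo_Phi; use nonvan(1-4) in \<open>auto simp: qpow_uminus\<close>)+
  hence quo: "quotient2 (\<lambda>v. Phi Psi \<tau> s \<kappa> lam \<upsilon> \<sigma> (- fst v) (snd v))"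
    "quotient2 (\<lambda>v. Phi Psi \<tau> s \<kappa> lam \<upsilon> \<sigma> (fst v) (snd v))"
    "quotient2 (\<lambda>v. Phi Psi \<tau> s \<kappa> lam \<upsilon> \<sigma> (fst v) (- snd v))"
    by simp_all
  have quo_W: "quotient2 (\<lambda>v. F v / W (\<epsilon> * fst v) (\<delta> * snd v))" if "quotient2 F" for F \<epsilon> \<delta>
    using W0 by (intro quotient2_divide[OF that quotient2_entire[OF ent_W] S(5,6)])
  have "quotient2 (\<lambda>v. L.cXZ (?q (1 * fst v)) (?q (1 * snd v)) / W (1 * fst v) (1 * snd v))"
    "quotient2 (\<lambda>v. L.cXZ (?q (1 * fst v)) (?q (- 1 * snd v)) / W (1 * fst v) (- 1 * snd v))"
    by (intro quo_W quo_L ent_X ent_Z qpow_nonzero; use nonvan(6-11) in \<open>auto simp: qpow_uminus power_one_over\<close>)+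
  moreover have "quotient2 (\<lambda>v. D.cXZ (?q (1 * snd v)) (?q (1 * fst v)) / W (1 * fst v) (1 * snd v))"
    "quotient2 (\<lambda>v. D.cXZ (?q (1 * snd v)) (?q (- 1 * fst v)) / W (- 1 * fst v) (1 * snd v))"
    by (intro quo_W quo_D ent_X ent_Z qpow_nonzero; use nonvan(6-11) in \<open>auto simp: qpow_uminus power_one_over\<close>)+
  ultimately have cs: "quotient2 (\<lambda>v. c_fun \<tau> s \<kappa> lam \<upsilon> \<sigma> (fst v) (snd v))"
    "quotient2 (\<lambda>v. c_fun \<tau> s \<kappa> lam \<upsilon> \<sigma> (fst v) (- snd v))"
    "quotient2 (\<lambda>v. c_dual \<tau> s \<kappa> lam \<upsilon> \<sigma> (snd v) (fst v))"
    "quotient2 (\<lambda>v. c_dual \<tau> s \<kappa> lam \<upsilon> \<sigma> (snd v) (- fst v))"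
    by (simp_all add: c_fun c_dual)
  have nz_dual: "c_dual \<tau> s \<kappa> lam \<upsilon> \<sigma> (snd v) (- fst v) \<noteq> 0" if "v \<in> Sx \<times> Sz" for v
    using that nonvan(5)[of "fst v" "snd v"] W0 by (auto simp: c_dual qpow_uminus)
  show ?thesis
    unfolding case_prod_unfold
  proof (rule quotient2_eqI[OF quo(1) _ S(5,6)])
    show "quotient2 (\<lambda>v. (c_fun \<tau> s \<kappa> lam \<upsilon> \<sigma> (fst v) (snd v) - c_dual \<tau> s \<kappa> lam \<upsilon> \<sigma> (snd v) (fst v))
         / c_dual \<tau> s \<kappa> lam \<upsilon> \<sigma> (snd v) (- fst v) * Phi Psi \<tau> s \<kappa> lam \<upsilon> \<sigma> (fst v) (snd v)
       + c_fun \<tau> s \<kappa> lam \<upsilon> \<sigma> (fst v) (- snd v)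
         / c_dual \<tau> s \<kappa> lam \<upsilon> \<sigma> (snd v) (- fst v) * Phi Psi \<tau> s \<kappa> lam \<upsilon> \<sigma> (fst v) (- snd v))"
      by (intro quotient2_add quotient2_mult quotient2_diff quotient2_divide[OF _ _ S(5,6) nz_dual] quo cs)
  qed (use eq in auto)
qed

end
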